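(* Let $\Gamma = E_7$, $A = A(\Gamma)$ and $W = W(\Gamma)$. Then there is a unique equivalence class of proper up-to-center-epimorphisms $A\to W$, represented by $\mu': A\to W$, where $$\mu'(\sigma_i)=w_0s_i\quad\text{for } 1\le i\le 7,$$ and $w_0$ denotes the longest element of $W$. In particular, any proper up-to-center-epimorphism $A\to W$ is ordinary.
   Context: The Coxeter graph $E_7$ has vertices $1,\dots,7$ and edges $\{1,3\},\{3,4\},\{2,4\},\{4,5\},\{5,6\},\{6,7\}$, all with $m_{ij}=3$ (and $m_{ij}=2$ for the other pairs $i\neq j$). The Artin group $A=A(E_7)$ is generated by $\sigma_1,\dots,\sigma_7$ subject to $\sigma_i\sigma_j\sigma_i=\sigma_j\sigma_i\sigma_j$ if $\{i,j\}$ is an edge and $\sigma_i\sigma_j=\sigma_j\sigma_i$ otherwise. The Coxeter group $W=W(E_7)$ is the quotient of $A$ by the relations $\sigma_i^2=1$, and $s_i$ is the image of $\sigma_i$. The longest element $w_0$ is the unique element of maximal word length in $W$ with respect to $s_1,\dots,s_7$; it is central in $W$. Let $Z(W)$ denote the center of $W$. A homomorphism $\varphi: A\to W$ is an up-to-center-epimorphism if $W = \mathrm{Im}\,\varphi\cdot Z(W)$; it is proper if moreover it is not an epimorphism (not surjective). An up-to-center-epimorphism $\varphi$ is ordinary if $\varphi(\sigma_i^2)=1$ for all $i$. Two homomorphisms $\varphi_1,\varphi_2: A\to W$ are equivalent if there is an automorphism $\alpha$ of $W$ such that $\varphi_2=\alpha\circ\varphi_1$. *)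

theory Defs
  imports "HOL-Algebra.Coset" "HOL-Algebra.Bij"
begin

section \<open>Groups given by generators and relations\<close>

text \<open>A letter \<open>(x, True)\<close> stands for the generator \<open>x\<close> and \<open>(x, False)\<close> for its formal inverse.
  A relation \<open>u = v\<close> is the pair \<open>(u, v)\<close> of words.\<close>

type_synonym 'a gword = "('a \<times> bool) list"

abbreviation gwords :: "'a set \<Rightarrow> 'a gword set"
  where "gwords X \<equiv> lists (X \<times> UNIV)"

inductive_set pres_rel :: "'a set \<Rightarrow> ('a gword \<times> 'a gword) set \<Rightarrow> ('a gword \<times> 'a gword) set"
  for X :: "'a set" and R :: "('a gword \<times> 'a gword) set"
  where
    refl: "w \<in> gwords X \<Longrightarrow> (w, w) \<in> pres_rel X R"
  | sym: "(v, w) \<in> pres_rel X R \<Longrightarrow> (w, v) \<in> pres_rel X R"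
  | trans: "(u, v) \<in> pres_rel X R \<Longrightarrow> (v, w) \<in> pres_rel X R \<Longrightarrow> (u, w) \<in> pres_rel X R"
  | cancel: "u \<in> gwords X \<Longrightarrow> v \<in> gwords X \<Longrightarrow> x \<in> X \<Longrightarrow>
      (u @ [(x, b), (x, \<not> b)] @ v, u @ v) \<in> pres_rel X R"
  | rel: "(r, s) \<in> R \<Longrightarrow> r \<in> gwords X \<Longrightarrow> s \<in> gwords X \<Longrightarrow> u \<in> gwords X \<Longrightarrow> v \<in> gwords X \<Longrightarrow>
      (u @ r @ v, u @ s @ v) \<in> pres_rel X R"

definition presented_group :: "'a set \<Rightarrow> ('a gword \<times> 'a gword) set \<Rightarrow> 'a gword set monoid"
  where "presented_group X R =
    \<lparr>carrier = gwords X // pres_rel X R,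
     mult = (\<lambda>C D. \<Union>u\<in>C. \<Union>v\<in>D. pres_rel X R `` {u @ v}),
     one = pres_rel X R `` {[]}\<rparr>"

definition pres_gen :: "'a set \<Rightarrow> ('a gword \<times> 'a gword) set \<Rightarrow> 'a \<Rightarrow> 'a gword set"
  where "pres_gen X R x = pres_rel X R `` {[(x, True)]}"

lemma pres_rel_words: "(u, v) \<in> pres_rel X R \<Longrightarrow> u \<in> gwords X \<and> v \<in> gwords X"
  by (induction rule: pres_rel.induct) auto

lemma equiv_pres_rel: "equiv (gwords X) (pres_rel X R)"
proof (rule equivI)
  show "pres_rel X R \<subseteq> gwords X \<times> gwords X"
    by (auto dest: pres_rel_words)
  show "refl_on (gwords X) (pres_rel X R)"
    by (rule refl_onI) (rule pres_rel.refl)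
  show "Relation.sym (pres_rel X R)"
    by (rule symI) (rule pres_rel.sym)
  show "Relation.trans (pres_rel X R)"
    by (rule transI) (rule pres_rel.trans)
qed

lemma pres_rel_context:
  assumes "(u, v) \<in> pres_rel X R" and p: "p \<in> gwords X" and q: "q \<in> gwords X"
  shows "(p @ u @ q, p @ v @ q) \<in> pres_rel X R"
  using assms(1)
proof (induction rule: pres_rel.induct)
  case (refl w)
  then show ?case using p q by (intro pres_rel.refl) simp
next
  case (sym v w)
  then show ?case by (blast intro: pres_rel.sym)
next
  case (trans u v w)
  then show ?case by (blast intro: pres_rel.trans)
next
  case (cancel u v x b)
  then show ?case
    using pres_rel.cancel[of "p @ u" X "v @ q" x b R] p q by simp
next
  case (rel r s u v)
  then show ?case
    using pres_rel.rel[of r s R X "p @ u" "v @ q"] p q by simp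
qed

lemma pres_rel_append:
  assumes "(u, u') \<in> pres_rel X R" and "(v, v') \<in> pres_rel X R"
  shows "(u @ v, u' @ v') \<in> pres_rel X R"
proof -
  have "(u @ v, u' @ v) \<in> pres_rel X R"
    using pres_rel_context[OF assms(1), of "[]" v] pres_rel_words[OF assms(2)] by simp
  moreover have "(u' @ v, u' @ v') \<in> pres_rel X R"
    using pres_rel_context[OF assms(2), of u' "[]"] pres_rel_words[OF assms(1)] by simp
  ultimately show ?thesis by (rule pres_rel.trans)
qed

lemma carrier_presented_group: "carrier (presented_group X R) = gwords X // pres_rel X R"
  by (simp add: presented_group_def)

lemma one_presented_group: "\<one>\<^bsub>presented_group X R\<^esub> = pres_rel X R `` {[]}"
  by (simp add: presented_group_def)

lemma mult_presented_group:
  assumes "u \<in> gwords X" and "v \<in> gwords X"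
  shows "pres_rel X R `` {u} \<otimes>\<^bsub>presented_group X R\<^esub> pres_rel X R `` {v} = pres_rel X R `` {u @ v}"
proof -
  have eq: "pres_rel X R `` {u' @ v'} = pres_rel X R `` {u @ v}"
    if "u' \<in> pres_rel X R `` {u}" "v' \<in> pres_rel X R `` {v}" for u' v'
  proof -
    have "(u @ v, u' @ v') \<in> pres_rel X R"
      using that by (intro pres_rel_append) simp_all
    then show ?thesis
      by (rule equiv_class_eq[OF equiv_pres_rel pres_rel.sym])
  qed
  have "(\<Union>u'\<in>pres_rel X R `` {u}. \<Union>v'\<in>pres_rel X R `` {v}. pres_rel X R `` {u' @ v'}) =
      (\<Union>u'\<in>pres_rel X R `` {u}. \<Union>v'\<in>pres_rel X R `` {v}. pres_rel X R `` {u @ v})"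
    by (intro SUP_cong HOL.refl eq)
  moreover have "u \<in> pres_rel X R `` {u}" "v \<in> pres_rel X R `` {v}"
    using assms by (auto intro: pres_rel.refl)
  then have "pres_rel X R `` {u} \<noteq> {}" "pres_rel X R `` {v} \<noteq> {}"
    by blast+
  ultimately show ?thesis
    by (simp add: presented_group_def)
qed

lemma pres_rel_left_inverse:
  "w \<in> gwords X \<Longrightarrow> (rev (map (\<lambda>(x, b). (x, \<not> b)) w) @ w, []) \<in> pres_rel X R"
proof (induction w)
  case Nil
  then show ?case by (simp add: pres_rel.refl)
next
  case (Cons a w)
  obtain x b where a: "a = (x, b)" by (cases a)
  let ?w' = "rev (map (\<lambda>(x, b). (x, \<not> b)) w)"
  have "w \<in> gwords X" "x \<in> X" "?w' \<in> gwords X"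
    using Cons.prems a by (auto simp: in_lists_conv_set)
  then have "(?w' @ [(x, \<not> b), (x, \<not> \<not> b)] @ w, ?w' @ w) \<in> pres_rel X R"
    by (intro pres_rel.cancel)
  then have "(?w' @ [(x, \<not> b), (x, b)] @ w, []) \<in> pres_rel X R"
    using Cons.IH \<open>w \<in> gwords X\<close> by (auto intro: pres_rel.trans)
  then show ?case by (simp add: a)
qed

lemma group_presented_group: "group (presented_group X R)"
proof (rule groupI)
  fix C D E
  assume "C \<in> carrier (presented_group X R)" "D \<in> carrier (presented_group X R)"
    "E \<in> carrier (presented_group X R)"
  then obtain u v w where "u \<in> gwords X" "v \<in> gwords X" "w \<in> gwords X"
    and [simp]: "C = pres_rel X R `` {u}" "D = pres_rel X R `` {v}" "E = pres_rel X R `` {w}"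
    by (auto simp: carrier_presented_group elim!: quotientE)
  then show "C \<otimes>\<^bsub>presented_group X R\<^esub> D \<otimes>\<^bsub>presented_group X R\<^esub> E =
      C \<otimes>\<^bsub>presented_group X R\<^esub> (D \<otimes>\<^bsub>presented_group X R\<^esub> E)"
    by (simp add: mult_presented_group)
next
  fix C D
  assume "C \<in> carrier (presented_group X R)" "D \<in> carrier (presented_group X R)"
  then obtain u v where "u \<in> gwords X" "v \<in> gwords X"
    and [simp]: "C = pres_rel X R `` {u}" "D = pres_rel X R `` {v}"
    by (auto simp: carrier_presented_group elim!: quotientE)
  then show "C \<otimes>\<^bsub>presented_group X R\<^esub> D \<in> carrier (presented_group X R)"
    by (simp add: mult_presented_group carrier_presented_group quotientI)
next
  show "\<one>\<^bsub>presented_group X R\<^esub> \<in> carrier (presented_group X R)"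
    by (simp add: one_presented_group carrier_presented_group quotientI)
next
  fix C
  assume "C \<in> carrier (presented_group X R)"
  then obtain u where u: "u \<in> gwords X" and C: "C = pres_rel X R `` {u}"
    by (auto simp: carrier_presented_group elim!: quotientE)
  show "\<one>\<^bsub>presented_group X R\<^esub> \<otimes>\<^bsub>presented_group X R\<^esub> C = C"
    using u by (simp add: C one_presented_group mult_presented_group)
  let ?u' = "rev (map (\<lambda>(x, b). (x, \<not> b)) u)"
  have u': "?u' \<in> gwords X"
    using u by (auto simp: in_lists_conv_set)
  have "pres_rel X R `` {?u' @ u} = pres_rel X R `` {[]}"
    using u by (intro equiv_class_eq[OF equiv_pres_rel] pres_rel_left_inverse)
  then have "pres_rel X R `` {?u'} \<otimes>\<^bsub>presented_group X R\<^esub> C = \<one>\<^bsub>presented_group X R\<^esub>"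
    using u u' by (simp add: C one_presented_group mult_presented_group)
  moreover have "pres_rel X R `` {?u'} \<in> carrier (presented_group X R)"
    using u' by (simp add: carrier_presented_group quotientI)
  ultimately show "\<exists>D\<in>carrier (presented_group X R).
      D \<otimes>\<^bsub>presented_group X R\<^esub> C = \<one>\<^bsub>presented_group X R\<^esub>"
    by blast
qed

section \<open>The Artin group and the Coxeter group of type $E_7$\<close>

definition E7_vertices :: "nat set"
  where "E7_vertices = {1..7}"

definition E7_edges :: "nat set set"
  where "E7_edges = {{1, 3}, {3, 4}, {2, 4}, {4, 5}, {5, 6}, {6, 7}}"

definition artin_relations :: "(nat gword \<times> nat gword) set"
  where "artin_relations =
    {([(i, True), (j, True), (i, True)], [(j, True), (i, True), (j, True)]) | i j.
       i \<in> E7_vertices \<and> j \<in> E7_vertices \<and> i \<noteq> j \<and> {i, j} \<in> E7_edges} \<union>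
    {([(i, True), (j, True)], [(j, True), (i, True)]) | i j.
       i \<in> E7_vertices \<and> j \<in> E7_vertices \<and> i \<noteq> j \<and> {i, j} \<notin> E7_edges}"

definition coxeter_relations :: "(nat gword \<times> nat gword) set"
  where "coxeter_relations =
    artin_relations \<union> {([(i, True), (i, True)], []) | i. i \<in> E7_vertices}"

definition A_E7 :: "nat gword set monoid"
  where "A_E7 = presented_group E7_vertices artin_relations"

definition W_E7 :: "nat gword set monoid"
  where "W_E7 = presented_group E7_vertices coxeter_relations"

definition \<sigma> :: "nat \<Rightarrow> nat gword set"
  where "\<sigma> i = pres_gen E7_vertices artin_relations i"

definition s :: "nat \<Rightarrow> nat gword set"
  where "s i = pres_gen E7_vertices coxeter_relations i"

text \<open>Only positive words are needed for the word length, because every \<open>s i\<close> is its own inverse.\<close>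

definition W_length :: "nat gword set \<Rightarrow> nat"
  where "W_length w = (LEAST n. \<exists>is. length is = n \<and> set is \<subseteq> E7_vertices \<and>
    w = foldr (\<lambda>i x. s i \<otimes>\<^bsub>W_E7\<^esub> x) is \<one>\<^bsub>W_E7\<^esub>)"

definition w\<^sub>0 :: "nat gword set"
  where "w\<^sub>0 = (THE w. is_arg_max W_length (\<lambda>x. x \<in> carrier W_E7) w)"

section \<open>Homomorphisms up to the center\<close>

definition center :: "('a, 'c) monoid_scheme \<Rightarrow> 'a set"
  where "center G = {z \<in> carrier G. \<forall>g\<in>carrier G. z \<otimes>\<^bsub>G\<^esub> g = g \<otimes>\<^bsub>G\<^esub> z}"

text \<open>The condition \<open>extensional\<close> makes two homomorphisms equal as soon as they agree on
  the carrier of the domain, so that equivalence classes can be counted.\<close>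

definition homs :: "('a, 'c) monoid_scheme \<Rightarrow> ('b, 'd) monoid_scheme \<Rightarrow> ('a \<Rightarrow> 'b) set"
  where "homs G H = hom G H \<inter> extensional (carrier G)"

definition up_to_center_epis ::
    "('a, 'c) monoid_scheme \<Rightarrow> ('b, 'd) monoid_scheme \<Rightarrow> ('a \<Rightarrow> 'b) set"
  where "up_to_center_epis G H =
    {\<phi> \<in> homs G H. carrier H = (\<phi> ` carrier G) <#>\<^bsub>H\<^esub> center H}"

definition proper_up_to_center_epis ::
    "('a, 'c) monoid_scheme \<Rightarrow> ('b, 'd) monoid_scheme \<Rightarrow> ('a \<Rightarrow> 'b) set"
  where "proper_up_to_center_epis G H =
    {\<phi> \<in> up_to_center_epis G H. \<phi> ` carrier G \<noteq> carrier H}"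

definition ordinary :: "(nat gword set \<Rightarrow> nat gword set) \<Rightarrow> bool"
  where "ordinary \<phi> \<longleftrightarrow> \<phi> \<in> up_to_center_epis A_E7 W_E7 \<and>
    (\<forall>i\<in>E7_vertices. \<phi> (\<sigma> i \<otimes>\<^bsub>A_E7\<^esub> \<sigma> i) = \<one>\<^bsub>W_E7\<^esub>)"

definition hom_equiv ::
    "('a, 'c) monoid_scheme \<Rightarrow> ('b, 'd) monoid_scheme \<Rightarrow> (('a \<Rightarrow> 'b) \<times> ('a \<Rightarrow> 'b)) set"
  where "hom_equiv G H =
    {(\<phi>\<^sub>1, \<phi>\<^sub>2). \<phi>\<^sub>1 \<in> homs G H \<and> \<phi>\<^sub>2 \<in> homs G H \<and>
       (\<exists>\<alpha>\<in>auto H. \<phi>\<^sub>2 = compose (carrier G) \<alpha> \<phi>\<^sub>1)}"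

end

theory Submission
  imports Defs "HOL-Analysis.Analysis" "HOL-Algebra.Multiplicative_Group"
begin

text \<open>The group \<open>W\<close> acts faithfully on \<open>\<complex>\<^sup>7\<close> by its reflection representation, and \<open>w\<^sub>0\<close> acts as \<open>-1\<close>.
  An up-to-center-epimorphism \<open>\<phi>\<close> makes this an irreducible unitary representation of the Artin group,
  in which the generators act by real matrices \<open>F\<^sub>i\<close>. A braid group on six strands acts on a space of
  dimension at most \<open>3\<close> through a cyclic quotient. As \<open>F\<^sub>1\<close> commutes with \<open>F\<^sub>2, F\<^sub>4, F\<^sub>5, F\<^sub>6, F\<^sub>7\<close>,
  which form such a braid group, it has an eigenspace of dimension at least \<open>4\<close>; the eigenvalue is \<open>\<plusminus>1\<close>,
  since the complex conjugate eigenvalue occurs with the same multiplicity. Let \<open>U\<^sub>i\<close> be the orthogonal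
  complement of the corresponding eigenspace of \<open>F\<^sub>i\<close>. Irreducibility forces \<open>U\<^sub>i\<close> and \<open>U\<^sub>j\<close> to be
  orthogonal for commuting generators, and as \<open>1, 2, 5, 7\<close> are pairwise non-adjacent, \<open>U\<^sub>i\<close> is a line,
  on which \<open>F\<^sub>i\<close> is again \<open>\<plusminus>1\<close>. So \<open>\<phi>(\<sigma>\<^sub>i)\<^sup>2 = 1\<close>, and \<open>s\<^sub>i \<mapsto> w\<^sub>0 \<phi>(\<sigma>\<^sub>i)\<close> defines an endomorphism \<open>\<alpha>\<close>
  of \<open>W\<close>. If \<open>\<phi>\<close> is proper, its image consists of elements of even length, so \<open>\<alpha>\<close> preserves the
  parity of the length; hence \<open>\<alpha>\<close> fixes \<open>w\<^sub>0\<close>, is bijective, and \<open>\<phi> = \<alpha> \<circ> \<mu>'\<close>.\<close>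

section \<open>Unitary operators of finite order\<close>

text \<open>A priori \<open>\<phi> (\<sigma> i)\<close> is an arbitrary element of W, so every
  constraint has to come from the joint action on a space of dimension 7. It comes from counting
  orthogonal vectors: neither two orthogonal eigenspaces of dimension 4 nor four mutually orthogonal
  planes fit into dimension 7. For an edge, \<open>F i \<circ> F j\<close> conjugates
  \<open>F i\<close> into \<open>F j\<close>, so what is known at one vertex spreads over the
  connected diagram. Unitarity and finite order replace minimal polynomials: eigenspaces are images
  of averages over a cyclic group, and orthogonal complements of invariant subspaces are invariant.
  W is given by a presentation only. Its finiteness, the faithfulness of the action, the uniqueness
  of the longest element and the center of order 2 all have to be derived, from the way the length
  governs the signs of the images of simple roots. The factor \<open>w\<^sub>0\<close> in the
  definition of \<alpha> repairs the parity: \<open>w\<^sub>0\<close> is a product of 63 generators,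
  hence odd, whereas a proper image consists of even elements.\<close>

definition cinner :: "complex ^ 'n \<Rightarrow> complex ^ 'n \<Rightarrow> complex"
  where "cinner x y = (\<Sum>i\<in>UNIV. x $ i * cnj (y $ i))"

lemma cinner_add_left: "cinner (x + y) z = cinner x z + cinner y z"
  by (simp add: cinner_def sum.distrib ring_distribs)

lemma cinner_add_right: "cinner z (x + y) = cinner z x + cinner z y"
  by (simp add: cinner_def sum.distrib ring_distribs)

lemma cinner_diff_left: "cinner (x - y) z = cinner x z - cinner y z"
  by (simp add: cinner_def sum_subtractf ring_distribs)

lemma cinner_diff_right: "cinner z (x - y) = cinner z x - cinner z y"
  by (simp add: cinner_def sum_subtractf ring_distribs)

lemma cinner_scale_left: "cinner (c *s x) y = c * cinner x y"
  by (simp add: cinner_def sum_distrib_left mult.assoc)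

lemma cinner_scale_right: "cinner x (c *s y) = cnj c * cinner x y"
  by (simp add: cinner_def sum_distrib_left mult_ac)

lemma cinner_zero [simp]: "cinner 0 x = 0" "cinner x 0 = 0"
  by (simp_all add: cinner_def)

lemma cinner_sum_left: "cinner (\<Sum>i\<in>I. f i) y = (\<Sum>i\<in>I. cinner (f i) y)"
  by (induction I rule: infinite_finite_induct) (auto simp: cinner_add_left)

lemma cinner_commute: "cinner y x = cnj (cinner x y)"
  by (simp add: cinner_def mult.commute)

lemma cinner_eq_zero_commute: "cinner y x = 0 \<longleftrightarrow> cinner x y = 0"
  by (metis cinner_commute complex_cnj_zero_iff)

lemma cinner_self: "cinner x x = of_real (\<Sum>i\<in>UNIV. (cmod (x $ i))\<^sup>2)"
  by (simp add: cinner_def complex_norm_square flip: of_real_power)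

lemma cinner_self_eq_zero [simp]: "cinner x x = 0 \<longleftrightarrow> x = 0"
  unfolding cinner_self of_real_eq_0_iff by (subst sum_nonneg_eq_0_iff) (auto simp: vec_eq_iff)

lemmas cinner_simps = cinner_add_left cinner_add_right cinner_diff_left cinner_diff_right
  cinner_scale_left cinner_scale_right

section \<open>Orthogonal systems as a measure of dimension\<close>

definition orth_system :: "(complex ^ 'n) set \<Rightarrow> bool"
  where "orth_system B \<longleftrightarrow> 0 \<notin> B \<and> (\<forall>x\<in>B. \<forall>y\<in>B. x \<noteq> y \<longrightarrow> cinner x y = 0)"

text \<open>For a subspace this says that the dimension is at most \<open>k\<close>. It is phrased
  by orthogonal systems because the arguments below exhibit and enlarge such systems.\<close>

definition orth_rank_le :: "(complex ^ 'n) set \<Rightarrow> nat \<Rightarrow> bool"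
  where "orth_rank_le S k \<longleftrightarrow> (\<forall>B\<subseteq>S. orth_system B \<longrightarrow> finite B \<longrightarrow> card B \<le> k)"

lemma orth_system_independent:
  assumes "orth_system B"
  shows "vec.independent B"
proof
  assume "vec.dependent B"
  then obtain T u v where T: "finite T" "T \<subseteq> B" "(\<Sum>v\<in>T. u v *s v) = 0" and v: "v \<in> T" "u v \<noteq> 0"
    by (auto simp: vec.dependent_explicit)
  have "0 = cinner (\<Sum>w\<in>T. u w *s w) v"
    using T by simp
  also have "\<dots> = (\<Sum>w\<in>T. u w * cinner w v)"
    by (simp add: cinner_sum_left cinner_scale_left)
  also have "\<dots> = (\<Sum>w\<in>T. if w = v then u v * cinner v v else 0)"
    using assms T(2) v(1) by (intro sum.cong) (auto simp: orth_system_def)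
  also have "\<dots> = u v * cinner v v"
    using T(1) v(1) by simp
  finally show False
    using v T(2) assms by (auto simp: orth_system_def)
qed

lemma orth_rank_le_UNIV: "orth_rank_le (S :: (complex ^ 'n) set) CARD('n)"
  unfolding orth_rank_le_def
  using vec.independent_card_le_dim[of _ UNIV] orth_system_independent
  by (metis subset_UNIV vec_dim_card)

text \<open>Finite order makes the inverse a power, so a set carried into itself is carried onto
  itself; it also yields eigenvectors by averaging, without a characteristic polynomial.\<close>

definition finite_unitary :: "(complex ^ 'n \<Rightarrow> complex ^ 'n) \<Rightarrow> bool"
  where "finite_unitary f \<longleftrightarrow> Vector_Spaces.linear (*s) (*s) f \<and>
    (\<forall>x y. cinner (f x) (f y) = cinner x y) \<and> (\<exists>n>0. f ^^ n = id)"

lemma finite_unitary_add: "finite_unitary f \<Longrightarrow> f (x + y) = f x + f y"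
  and finite_unitary_scale: "finite_unitary f \<Longrightarrow> f (c *s x) = c *s f x"
  and finite_unitary_diff: "finite_unitary f \<Longrightarrow> f (x - y) = f x - f y"
  and finite_unitary_0: "finite_unitary f \<Longrightarrow> f 0 = 0"
  and finite_unitary_cinner: "finite_unitary f \<Longrightarrow> cinner (f x) (f y) = cinner x y"
  unfolding finite_unitary_def
  by (auto simp: vec.linear_add vec.linear_scale vec.linear_diff vec.linear_0)

lemma finite_unitary_sum: "finite_unitary f \<Longrightarrow> f (\<Sum>i\<in>I. g i) = (\<Sum>i\<in>I. f (g i))"
  unfolding finite_unitary_def by (simp add: vec.linear_sum)

lemma finite_unitary_eq_0: "finite_unitary f \<Longrightarrow> f x = 0 \<longleftrightarrow> x = 0"
  by (metis cinner_self_eq_zero finite_unitary_cinner)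

lemma finite_unitary_eq: "finite_unitary f \<Longrightarrow> f x = f y \<longleftrightarrow> x = y"
  by (metis finite_unitary_diff finite_unitary_eq_0 right_minus_eq)

lemma finite_unitary_inverse_power:
  assumes "finite_unitary f"
  obtains m where "\<And>x. (f ^^ m) (f x) = x" "\<And>x. f ((f ^^ m) x) = x"
proof -
  obtain n where "n > 0" and n: "f ^^ n = id"
    using assms by (auto simp: finite_unitary_def)
  then obtain m where m: "n = Suc m"
    by (cases n) auto
  have "(f ^^ m) (f x) = x" "f ((f ^^ m) x) = x" for x
    using fun_cong[OF n, of x] by (simp_all add: m funpow_swap1)
  then show thesis
    by (rule that)
qed

lemma funpow_invariant: "f ` S \<subseteq> S \<Longrightarrow> x \<in> S \<Longrightarrow> (f ^^ k) x \<in> S"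
  by (induction k) auto

lemma finite_unitary_preimage:
  assumes "finite_unitary f" "f ` S \<subseteq> S" "x \<in> S"
  obtains y where "y \<in> S" "f y = x"
proof -
  obtain m where m: "\<And>x. f ((f ^^ m) x) = x"
    using finite_unitary_inverse_power[OF assms(1)] by metis
  show thesis
    using that[of "(f ^^ m) x"] m funpow_invariant[OF assms(2,3)] by auto
qed

lemma finite_unitary_mem_iff:
  assumes "finite_unitary f" "f ` S \<subseteq> S"
  shows "f x \<in> S \<longleftrightarrow> x \<in> S"
  using finite_unitary_preimage[OF assms, of "f x"] finite_unitary_eq[OF assms(1)] assms(2)
  by auto

lemma finite_unitary_funpow:
  assumes "finite_unitary f"
  shows "(f ^^ k) (c *s x) = c *s (f ^^ k) x"
    and "cinner ((f ^^ k) x) ((f ^^ k) y) = cinner x y"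
  by (induction k) (auto simp: finite_unitary_scale[OF assms] finite_unitary_cinner[OF assms])

section \<open>Spectral projections by averaging over a cyclic group\<close>

text \<open>For \<open>f ^^ n = id\<close> and \<open>\<zeta> ^ n = 1\<close> this is the orthogonal
  projection onto the eigenspace of \<zeta>.\<close>

definition eigen_mean :: "(complex ^ 'n \<Rightarrow> complex ^ 'n) \<Rightarrow> nat \<Rightarrow> complex \<Rightarrow> complex ^ 'n \<Rightarrow> complex ^ 'n"
  where "eigen_mean f n \<zeta> x = (1 / of_nat n) *s (\<Sum>k<n. inverse \<zeta> ^ k *s (f ^^ k) x)"

text \<open>Applying \<open>f\<close> shifts the summation index by one; the last term wraps around
  to the first because \<open>f ^^ n = id\<close> and \<open>\<zeta> ^ n = 1\<close>.\<close>

lemma eigen_mean_eigen: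
  assumes f: "finite_unitary f" and n: "n > 0" "f ^^ n = id" and z: "\<zeta> ^ n = 1"
  shows "f (eigen_mean f n \<zeta> x) = \<zeta> *s eigen_mean f n \<zeta> x"
proof -
  have z0: "\<zeta> \<noteq> 0"
    using n z by (auto simp: power_0_left)
  have "f (\<Sum>k<n. inverse \<zeta> ^ k *s (f ^^ k) x) = (\<Sum>k<n. \<zeta> *s (inverse \<zeta> ^ Suc k *s (f ^^ Suc k) x))"
    using z0 by (simp add: finite_unitary_sum[OF f] finite_unitary_scale[OF f] flip: mult.assoc)
  also have "\<dots> = \<zeta> *s (\<Sum>k<n. inverse \<zeta> ^ Suc k *s (f ^^ Suc k) x)"
    by (simp only: vec.scale_sum_right)
  also have "(\<Sum>k<n. inverse \<zeta> ^ Suc k *s (f ^^ Suc k) x) = (\<Sum>k<n. inverse \<zeta> ^ k *s (f ^^ k) x)"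
  proof -
    have "x + (\<Sum>k<n. inverse \<zeta> ^ Suc k *s (f ^^ Suc k) x) = (\<Sum>k<Suc n. inverse \<zeta> ^ k *s (f ^^ k) x)"
      by (subst sum.lessThan_Suc_shift) simp
    also have "\<dots> = (\<Sum>k<n. inverse \<zeta> ^ k *s (f ^^ k) x) + x"
      using n z by (simp add: power_inverse)
    finally show ?thesis
      by (simp add: add.commute)
  qed
  finally show ?thesis
    by (simp add: eigen_mean_def finite_unitary_scale[OF f] mult.commute)
qed

lemma eigen_mean_in:
  assumes "vec.subspace S" "f ` S \<subseteq> S" "x \<in> S"
  shows "eigen_mean f n \<zeta> x \<in> S"
  unfolding eigen_mean_def
  by (intro vec.subspace_scale[OF assms(1)] vec.subspace_sum[OF assms(1)] funpow_invariant assms)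

text \<open>Since \<open>y\<close> equals \<open>inverse \<zeta> ^ k *s (f ^^ k) y\<close> and
  \<zeta> has modulus one, unitarity gives every summand the same product with \<open>y\<close>.
  Hence the remainder \<open>x - eigen_mean f n \<zeta> x\<close> is orthogonal to the whole
  eigenspace.\<close>

lemma cinner_eigen_mean:
  assumes f: "finite_unitary f" and n: "n > 0" and z: "\<zeta> ^ n = 1" and y: "f y = \<zeta> *s y"
  shows "cinner (eigen_mean f n \<zeta> x) y = cinner x y"
proof -
  have "cmod \<zeta> = 1"
    using power_eq_1_iff[OF z] n by simp
  then have z1: "\<zeta> * cnj \<zeta> = 1"
    by (simp flip: complex_norm_square)
  then have inv: "inverse \<zeta> = cnj \<zeta>"
    by (rule inverse_unique)
  have z0: "\<zeta> \<noteq> 0"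
    using z1 by auto
  have pw: "(f ^^ k) y = \<zeta> ^ k *s y" for k
    by (induction k) (simp_all add: y finite_unitary_scale[OF f] mult.commute)
  have "cinner (inverse \<zeta> ^ k *s (f ^^ k) x) y = cinner x y" for k
  proof -
    have "y = inverse \<zeta> ^ k *s (f ^^ k) y"
      using z0 by (simp add: pw flip: power_mult_distrib)
    then have "cinner (inverse \<zeta> ^ k *s (f ^^ k) x) y
        = cinner (inverse \<zeta> ^ k *s (f ^^ k) x) (inverse \<zeta> ^ k *s (f ^^ k) y)"
      by simp
    also have "\<dots> = (inverse \<zeta> * cnj (inverse \<zeta>)) ^ k * cinner x y"
      by (simp only: cinner_simps finite_unitary_funpow[OF f] power_mult_distrib
          complex_cnj_power mult_ac)
    also have "\<dots> = cinner x y"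
      using z1 by (simp add: inv mult.commute)
    finally show ?thesis .
  qed
  then show ?thesis
    using n by (simp add: eigen_mean_def cinner_scale_left cinner_sum_left)
qed

text \<open>The spectral theorem in the form used below: a linear condition holds on an invariant
  subspace once it holds for the eigenvectors there. By orthogonality of characters,
  \<open>x\<close> is the sum of its projections for all \<open>n\<close>-th roots of unity.\<close>

lemma eigen_decomposition:
  assumes f: "finite_unitary f" and S: "vec.subspace S" "f ` S \<subseteq> S" and T: "vec.subspace T"
    and eig: "\<And>x \<zeta>. x \<in> S \<Longrightarrow> f x = \<zeta> *s x \<Longrightarrow> x \<in> T"
  shows "S \<subseteq> T"
proof
  fix x assume x: "x \<in> S"
  obtain n where n: "n > 0" "f ^^ n = id"
    using f by (auto simp: finite_unitary_def)
  define \<omega> where "\<omega> = cis (2 * pi / real n)"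
  have w: "\<omega> ^ n = 1"
    using n unfolding \<omega>_def Complex.DeMoivre by simp
  have w0: "\<omega> \<noteq> 0"
    by (simp add: \<omega>_def)
  have geo: "(\<Sum>j<n. inverse (\<omega> ^ j) ^ k) = (if k = 0 then of_nat n else 0)" if k: "k < n" for k
  proof (cases "k = 0")
    case False
    \<comment> \<open>\<open>\<omega>\<close> is a primitive \<open>n\<close>-th root of unity, so
      the geometric sum vanishes for \<open>0 < k < n\<close>.\<close>
    have "inverse \<omega> ^ k \<noteq> 1"
    proof
      assume "inverse \<omega> ^ k = 1"
      then have "\<omega> ^ k = 1"
        by (simp add: power_inverse)
      then have "cos (2 * pi * (real k / real n)) = 1"
        by (simp add: \<omega>_def Complex.DeMoivre complex_eq_iff mult_ac)
      then obtain m :: int where "2 * pi * (real k / real n) = 2 * pi * real_of_int m"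
        by (auto simp: cos_one_2pi_int mult_ac)
      then have "real k = real_of_int m * real n"
        using n by (simp add: field_simps)
      then have "int k = m * int n"
        by (metis of_int_eq_iff of_int_mult of_int_of_nat_eq)
      then have "int n dvd int k"
        by simp
      then show False
        using k False by (auto dest: dvd_imp_le)
    qed
    moreover have "(inverse \<omega> ^ k) ^ n = 1"
      using w by (simp add: power_inverse power_mult[symmetric] mult.commute[of k])
        (simp add: power_mult)
    moreover have "inverse (\<omega> ^ j) ^ k = (inverse \<omega> ^ k) ^ j" for j
      by (simp add: power_inverse power_mult[symmetric] mult.commute)
    ultimately show ?thesis
      using False by (simp add: sum_gp_strict)
  qed (simp)
  have "(\<Sum>j<n. eigen_mean f n (\<omega> ^ j) x)
      = (1 / of_nat n) *s (\<Sum>j<n. \<Sum>k<n. inverse (\<omega> ^ j) ^ k *s (f ^^ k) x)"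
    by (simp add: eigen_mean_def vec.scale_sum_right)
  also have "(\<Sum>j<n. \<Sum>k<n. inverse (\<omega> ^ j) ^ k *s (f ^^ k) x)
      = (\<Sum>k<n. (\<Sum>j<n. inverse (\<omega> ^ j) ^ k) *s (f ^^ k) x)"
    by (subst sum.swap) (simp only: vec.scale_sum_left)
  also have "\<dots> = (\<Sum>k<n. if k = 0 then of_nat n *s x else 0)"
    by (intro sum.cong) (auto simp: geo)
  finally have "(\<Sum>j<n. eigen_mean f n (\<omega> ^ j) x) = x"
    using n by simp
  moreover have "eigen_mean f n (\<omega> ^ j) x \<in> T" for j
  proof (rule eig[where \<zeta> = "\<omega> ^ j"])
    show "eigen_mean f n (\<omega> ^ j) x \<in> S"
      by (rule eigen_mean_in[OF S x])
    have "(\<omega> ^ j) ^ n = 1"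
      using w by (metis mult.commute power_mult power_one)
    then show "f (eigen_mean f n (\<omega> ^ j) x) = \<omega> ^ j *s eigen_mean f n (\<omega> ^ j) x"
      by (rule eigen_mean_eigen[OF f n])
  qed
  ultimately show "x \<in> T"
    by (metis vec.subspace_sum[OF T])
qed

text \<open>The part \<open>u\<close> is orthogonal to the eigenspace in the whole space, not merely
  to its intersection with \<open>S\<close>. This is what allows complements to be compared on
  different invariant subspaces.\<close>

lemma eigen_split:
  assumes f: "finite_unitary f" and S: "vec.subspace S" "f ` S \<subseteq> S" and x: "x \<in> S"
  obtains e u where "x = e + u" "e \<in> S" "u \<in> S" "f e = \<zeta> *s e"
    "\<And>y. f y = \<zeta> *s y \<Longrightarrow> cinner u y = 0"
proof -
  obtain n where n: "n > 0" "f ^^ n = id"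
    using f by (auto simp: finite_unitary_def)
  show thesis
  proof (cases "\<zeta> ^ n = 1")
    case True
    show thesis
    proof (rule that)
      show "x = eigen_mean f n \<zeta> x + (x - eigen_mean f n \<zeta> x)" by simp
      show "eigen_mean f n \<zeta> x \<in> S" by (rule eigen_mean_in[OF S x])
      then show "x - eigen_mean f n \<zeta> x \<in> S" by (rule vec.subspace_diff[OF S(1) x])
      show "f (eigen_mean f n \<zeta> x) = \<zeta> *s eigen_mean f n \<zeta> x"
        by (rule eigen_mean_eigen[OF f n True])
      show "cinner (x - eigen_mean f n \<zeta> x) y = 0" if "f y = \<zeta> *s y" for y
        using cinner_eigen_mean[OF f n(1) True that] by (simp add: cinner_simps)
    qed
  next
    \<comment> \<open>Every eigenvalue of \<open>f\<close> is an \<open>n\<close>-th root of unity,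
      so here the eigenspace is zero and \<open>e = 0\<close> serves.\<close>
    case False
    have "y = 0" if y: "f y = \<zeta> *s y" for y
    proof -
      have "(f ^^ k) y = \<zeta> ^ k *s y" for k
        by (induction k) (simp_all add: y finite_unitary_scale[OF f] mult.commute)
      then have "y = \<zeta> ^ n *s y"
        using n by (metis id_apply)
      then have "(1 - \<zeta> ^ n) *s y = 0"
        by (simp add: vec.scale_left_diff_distrib)
      then show ?thesis
        using False by (simp only: vector_mul_eq_0) simp
    qed
    then have "cinner x y = 0" if "f y = \<zeta> *s y" for y
      using that by (metis cinner_zero(2))
    then show thesis
      using that[of 0 x] x vec.subspace_0[OF S(1)] by (simp add: finite_unitary_0[OF f])
  qed
qed

lemma eigen_exists:
  assumes f: "finite_unitary f" and S: "vec.subspace S" "f ` S \<subseteq> S" and "x \<in> S" "x \<noteq> 0"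
  obtains y \<zeta> where "y \<in> S" "y \<noteq> 0" "f y = \<zeta> *s y"
proof -
  have "\<not> S \<subseteq> {0}"
    using assms by auto
  then show thesis
    using eigen_decomposition[OF f S, of "{0}"] that vec.subspace_single_0 by blast
qed

declare One_nat_def [simp del]

section \<open>Braid relations on a space of small dimension\<close>

text \<open>On \<open>S\<close> the braid relation becomes \<open>g (f (f x)) = g (f (g x))\<close>,
  and \<open>g\<close> and \<open>f\<close> are injective.\<close>

lemma braid_commute_eq:
  assumes "finite_unitary f" "finite_unitary g" "f ` S \<subseteq> S"
    and "\<And>x. f (g (f x)) = g (f (g x))" "\<forall>x\<in>S. f (g x) = g (f x)" "x \<in> S"
  shows "f x = g x"
proof -
  have "g (f (f x)) = f (g (f x))"
    using assms(3,5,6) by auto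
  also have "\<dots> = g (f (g x))"
    by (rule assms(4))
  finally show ?thesis
    using assms(1,2) by (simp add: finite_unitary_eq)
qed

text \<open>The system \<open>B\<close> already has the maximal size, so no nonzero orthogonal
  vector can be added to it.\<close>

lemma orth_rank_le_dependent:
  assumes "orth_rank_le S k" and "finite B" "card B = k" "orth_system B" "B \<subseteq> S"
    and "x \<in> S" "\<And>y. y \<in> B \<Longrightarrow> cinner x y = 0"
  shows "x = 0"
proof (rule ccontr)
  assume x: "x \<noteq> 0"
  have "cinner y x = 0" if "y \<in> B" for y
    using assms(7)[OF that] by (simp add: cinner_eq_zero_commute[of y x])
  then have "orth_system (insert x B)"
    using assms(4,7) x by (auto simp: orth_system_def)
  moreover have "insert x B \<subseteq> S" "finite (insert x B)"
    using assms by auto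
  ultimately have "card (insert x B) \<le> k"
    using assms(1) unfolding orth_rank_le_def by blast
  moreover have "x \<notin> B"
    using assms(7)[of x] x by auto
  ultimately show False
    using assms(2,3) by simp
qed

lemma orth_rank_le_1_collinear:
  assumes "orth_rank_le S 1" "vec.subspace S" and "x \<in> S" "x \<noteq> 0" "y \<in> S"
  shows "\<exists>c. y = c *s x"
proof -
  let ?c = "cinner y x / cinner x x"
  have "y - ?c *s x = 0"
  proof (rule orth_rank_le_dependent[OF assms(1), of "{x}"])
    show "y - ?c *s x \<in> S"
      using assms by (intro vec.subspace_diff vec.subspace_scale)
  qed (use assms in \<open>auto simp: orth_system_def cinner_simps\<close>)
  then show ?thesis
    by auto
qed

lemma subspace_eigen:
  assumes "finite_unitary f" "vec.subspace S"
  shows "vec.subspace {x \<in> S. f x = \<zeta> *s x}"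
  using assms unfolding vec.subspace_def
  by (auto simp: finite_unitary_0 finite_unitary_add finite_unitary_scale vec.scale_right_distrib mult.commute)

lemma subspace_equalizer:
  assumes "finite_unitary f" "finite_unitary g" "vec.subspace S"
  shows "vec.subspace {x \<in> S. f x = g x}"
  using assms unfolding vec.subspace_def
  by (auto simp: finite_unitary_0 finite_unitary_add finite_unitary_scale)

lemma subspace_commuting:
  assumes "finite_unitary f" "finite_unitary g" "vec.subspace S"
  shows "vec.subspace {x \<in> S. f (g x) = g (f x)}"
  using assms unfolding vec.subspace_def
  by (auto simp: finite_unitary_0 finite_unitary_add finite_unitary_scale)

definition perp :: "(complex ^ 'n) set \<Rightarrow> (complex ^ 'n) set"
  where "perp E = {x. \<forall>y\<in>E. cinner x y = 0}"

lemma subspace_perp: "vec.subspace (perp E)"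
  by (simp add: perp_def vec.subspace_def cinner_simps)

text \<open>Every vector of \<open>E\<close> is the image of a vector of \<open>E\<close>, as
  \<open>f\<close> has finite order; unitarity then transports orthogonality.\<close>

lemma perp_invariant:
  assumes "finite_unitary f" "f ` E \<subseteq> E"
  shows "f ` perp E \<subseteq> perp E"
proof
  fix y assume "y \<in> f ` perp E"
  then obtain x where x: "x \<in> perp E" "y = f x" by auto
  show "y \<in> perp E"
    unfolding perp_def
  proof clarify
    fix z assume "z \<in> E"
    then obtain w where "w \<in> E" "f w = z"
      by (rule finite_unitary_preimage[OF assms])
    then show "cinner y z = 0"
      using x by (auto simp: perp_def finite_unitary_cinner[OF assms(1)])
  qed
qed

lemma not_orth_rank_le_1:
  assumes "\<not> orth_rank_le S 1"
  obtains x y where "x \<in> S" "y \<in> S" "x \<noteq> 0" "y \<noteq> 0" "cinner x y = 0"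
proof -
  obtain B where B: "B \<subseteq> S" "orth_system B" "finite B" "2 \<le> card B"
    using assms by (auto simp: orth_rank_le_def not_le)
  then obtain x y where "x \<in> B" "y \<in> B" "x \<noteq> y"
    by (metis card_le_Suc0_iff_eq not_less_eq_eq numeral_2_eq_2)
  then show thesis
    using that B by (metis orth_system_def subsetD)
qed

lemma finite_unitary_comp_preimage:
  assumes "finite_unitary f" "finite_unitary g" "f ` S \<subseteq> S" "g ` S \<subseteq> S" "x \<in> S"
  obtains y where "y \<in> S" "f (g y) = x"
  by (metis assms finite_unitary_preimage)

text \<open>If \<open>b 1\<close> is not scalar on \<open>S\<close>, either all its eigenspaces in \<open>S\<close> are lines, and then
  \<open>b 3\<close> and \<open>b 4\<close> commute, or all the \<open>b i\<close> are complex reflections in vectors \<open>l i\<close>; commuting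
  distinct reflections have orthogonal \<open>l i\<close>, and three dimensions are too few for that.\<close>

lemma braid_chain_low_rank:
  fixes b :: "nat \<Rightarrow> complex ^ 'n \<Rightarrow> complex ^ 'n"
  assumes fu: "\<And>i. i \<in> {1..5} \<Longrightarrow> finite_unitary (b i)"
    and S: "vec.subspace S" and inv: "\<And>i. i \<in> {1..5} \<Longrightarrow> b i ` S \<subseteq> S"
    and comm: "\<And>i j x. i \<in> {1..5} \<Longrightarrow> j \<in> {1..5} \<Longrightarrow> i + 1 < j \<Longrightarrow> b i (b j x) = b j (b i x)"
    and braid: "\<And>i x. i \<in> {1..4} \<Longrightarrow> b i (b (i + 1) (b i x)) = b (i + 1) (b i (b (i + 1) x))"
    and rank: "orth_rank_le S 3"
    and ij: "i \<in> {1..5}" "j \<in> {1..5}" and x: "x \<in> S"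
  shows "b i x = b j x"
proof -
  \<comment> \<open>\<open>E\<close> is equality and \<open>C\<close> commutation on
    \<open>S\<close>. Adjacent commuting generators are equal, and equality of one adjacent pair
    makes the neighbouring pairs commute. So one equality along the chain settles the claim.\<close>
  define E where "E i j \<longleftrightarrow> (\<forall>x\<in>S. b i x = b j x)" for i j
  define C where "C i j \<longleftrightarrow> (\<forall>x\<in>S. b i (b j x) = b j (b i x))" for i j
  have E_sym: "E i j \<Longrightarrow> E j i" for i j
    by (auto simp: E_def)
  have E_trans: "E i j \<Longrightarrow> E j k \<Longrightarrow> E i k" for i j k
    by (auto simp: E_def)
  have C_sym: "C i j \<Longrightarrow> C j i" for i j
    by (auto simp: C_def)
  have EC: "C i k" if "E i j" "C j k" "i \<in> {1..5}" "k \<in> {1..5}" for i j k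
    unfolding C_def
  proof
    fix x assume x: "x \<in> S"
    then have "b i x \<in> S" "b k x \<in> S"
      using inv that by blast+
    then show "b i (b k x) = b k (b i x)"
      using that(1,2) x unfolding E_def C_def by simp
  qed
  have CE: "E i (i + 1)" if "C i (i + 1)" "i \<in> {1..4}" for i
    unfolding E_def
  proof
    fix x assume "x \<in> S"
    moreover have "i \<in> {1..5}" "i + 1 \<in> {1..5}"
      using that by auto
    ultimately show "b i x = b (i + 1) x"
      using that(1) unfolding C_def by (intro braid_commute_eq[OF fu fu inv braid[OF that(2)]])
  qed
  have C: "C i j" if "i \<in> {1..5}" "j \<in> {1..5}" "i + 1 < j" for i j
    using comm[OF that] by (auto simp: C_def)
  have Cs: "C 1 3" "C 1 4" "C 1 5" "C 2 4" "C 2 5" "C 3 5"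
    by (auto intro: C)
  have CEs: "C 1 2 \<Longrightarrow> E 1 2" "C 2 3 \<Longrightarrow> E 2 3" "C 3 4 \<Longrightarrow> E 3 4" "C 4 5 \<Longrightarrow> E 4 5"
    using CE[of 1] CE[of 2] CE[of 3] CE[of 4] by (simp_all del: One_nat_def)
  have up: "E 1 2 \<Longrightarrow> E 2 3" "E 2 3 \<Longrightarrow> E 3 4" "E 3 4 \<Longrightarrow> E 4 5"
    using CEs EC[OF E_sym, of 1 2 3] EC[OF E_sym, of 2 3 4] EC[OF E_sym, of 3 4 5] Cs by auto
  have down: "E 2 3 \<Longrightarrow> E 1 2" "E 3 4 \<Longrightarrow> E 2 3" "E 4 5 \<Longrightarrow> E 3 4"
    using CEs EC[of 2 3 1] EC[of 3 4 2] EC[of 4 5 3] Cs C_sym by auto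
  have all: "E i j" if "E 1 2 \<or> E 2 3 \<or> E 3 4 \<or> E 4 5"
  proof -
    have "E 1 2" "E 2 3" "E 3 4" "E 4 5"
      using that up down by blast+
    then have "E 1 k" if "k \<in> {1..5}" for k
    proof -
      have "k = 1 \<or> k = 2 \<or> k = 3 \<or> k = 4 \<or> k = 5"
        using that by auto
      moreover have "E 1 1"
        by (simp add: E_def)
      ultimately show ?thesis
        using \<open>E 1 2\<close> \<open>E 2 3\<close> \<open>E 3 4\<close> \<open>E 4 5\<close> E_trans by metis
    qed
    then show ?thesis
      using ij E_sym E_trans by metis
  qed
  have "E 1 2 \<or> E 2 3 \<or> E 3 4 \<or> E 4 5"
  proof (cases "\<forall>\<zeta>. orth_rank_le {x \<in> S. b 1 x = \<zeta> *s x} 1")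
    case True
    have "S \<subseteq> {x \<in> S. b 3 (b 4 x) = b 4 (b 3 x)}"
    proof (rule eigen_decomposition[OF fu[of 1] S inv[of 1]])
      show "vec.subspace {x \<in> S. b 3 (b 4 x) = b 4 (b 3 x)}"
        by (intro subspace_commuting S fu) auto
      fix x \<zeta> assume x: "x \<in> S" "b 1 x = \<zeta> *s x"
      let ?E = "{x \<in> S. b 1 x = \<zeta> *s x}"
      \<comment> \<open>\<open>b 3\<close> and \<open>b 4\<close> commute with \<open>b 1\<close>,
        hence preserve its eigenlines and act on them by scalars.\<close>
      have scalar: "\<exists>c. b k x = c *s x" if k: "k \<in> {3, 4}" for k
      proof (cases "x = 0")
        case False
        have "b 1 (b k x) = \<zeta> *s b k x"
          using comm[of 1 k x] fu[of k] k x by (auto simp: finite_unitary_scale)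
        moreover have "b k x \<in> S"
          using inv[of k] k x by (auto simp: image_subset_iff)
        moreover have "orth_rank_le ?E 1" "vec.subspace ?E"
          using True subspace_eigen[OF fu[of 1] S] by auto
        ultimately show ?thesis
          using orth_rank_le_1_collinear[of ?E x "b k x"] False x by blast
      qed (use k fu[of k] in \<open>auto simp: finite_unitary_0\<close>)
      obtain c d where "b 3 x = c *s x" "b 4 x = d *s x"
        using scalar[of 3] scalar[of 4] by auto
      then show "x \<in> {x \<in> S. b 3 (b 4 x) = b 4 (b 3 x)}"
        using x fu[of 3] fu[of 4] by (simp add: finite_unitary_scale mult.commute)
    qed auto
    then have "C 3 4"
      by (auto simp: C_def)
    then show ?thesis
      using CEs by blast
  next
    case False
    then obtain \<zeta> where nr: "\<not> orth_rank_le {x \<in> S. b 1 x = \<zeta> *s x} 1"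
      by blast
    obtain e f where ef: "e \<in> S" "f \<in> S" "b 1 e = \<zeta> *s e" "b 1 f = \<zeta> *s f" "e \<noteq> 0" "f \<noteq> 0"
      "cinner e f = 0"
      by (rule not_orth_rank_le_1[OF nr]) auto
    \<comment> \<open>Two orthogonal nonzero vectors of \<open>L\<close> would form with
      \<open>e\<close> and \<open>f\<close> an orthogonal system of size 4, so \<open>L\<close> is
      at most a line.\<close>
    define L where "L = S \<inter> perp {x. b 1 x = \<zeta> *s x}"
    have L: "vec.subspace L"
      unfolding L_def by (intro vec.subspace_inter S subspace_perp)
    have split: "\<exists>e u. x = e + u \<and> e \<in> S \<and> b 1 e = \<zeta> *s e \<and> u \<in> L" if x: "x \<in> S" for x
    proof -
      obtain e u where "x = e + u" "e \<in> S" "u \<in> S" "b 1 e = \<zeta> *s e"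
          "\<And>y. b 1 y = \<zeta> *s y \<Longrightarrow> cinner u y = 0"
        using eigen_split[OF fu[of 1] S inv[of 1] x, of \<zeta>] by auto
      then show ?thesis
        by (auto simp: L_def perp_def)
    qed
    have rankL: "orth_rank_le L 1"
    proof (rule ccontr)
      assume "\<not> orth_rank_le L 1"
      then obtain u v where uv: "u \<in> L" "v \<in> L" "u \<noteq> 0" "v \<noteq> 0" "cinner u v = 0"
        by (rule not_orth_rank_le_1)
      have orth: "cinner u e = 0" "cinner u f = 0" "cinner v e = 0" "cinner v f = 0"
        using uv ef by (auto simp: L_def perp_def)
      then have ne: "u \<noteq> e" "u \<noteq> f" "u \<noteq> v" "v \<noteq> e" "v \<noteq> f" "e \<noteq> f"
        using uv ef by auto
      have "orth_system {u, v, e, f}"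
        using uv ef orth by (auto simp: orth_system_def cinner_eq_zero_commute)
      moreover have "card {u, v, e, f} = 4"
        using ne by simp
      ultimately show False
        using rank uv ef unfolding orth_rank_le_def
        by (auto simp: L_def dest!: spec[of _ "{u, v, e, f}"])
    qed
    show ?thesis
    proof (cases "L = {0}")
      case True
      \<comment> \<open>\<open>b 1\<close> is a scalar on \<open>S\<close>, and the braid relation
        forces the same scalar on \<open>b 2\<close>.\<close>
      have scal: "b 1 x = \<zeta> *s x" if "x \<in> S" for x
        using split[OF that] True by auto
      have z: "\<zeta> \<noteq> 0"
        using ef finite_unitary_eq_0[OF fu[of 1], of e] by auto
      have "b 1 x = b 2 x" if x: "x \<in> S" for x
      proof -
        have "b 2 x \<in> S"
          using x inv[of 2] by auto
        then have "b 2 (\<zeta> *s b 2 x) = b 2 (\<zeta> *s (\<zeta> *s x))"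
          using braid[of 1 x] fu[of 2] fu[of 1] scal[OF x] scal[of "b 2 x"]
          by (simp add: finite_unitary_scale del: One_nat_def)
        then have "\<zeta> *s b 2 x = \<zeta> *s (\<zeta> *s x)"
          using finite_unitary_eq[OF fu[of 2]] by simp
        then have "b 2 x = \<zeta> *s x"
          using z unfolding vector_mul_lcancel by blast
        then show ?thesis
          using scal[OF x] by simp
      qed
      then show ?thesis
        by (auto simp: E_def)
    next
      case False
      then obtain v where v: "v \<in> L" "v \<noteq> 0"
        using vec.subspace_0[OF L] by auto
      have vS: "v \<in> S"
        using v by (simp add: L_def)
      have "b 1 v \<in> L"
        using perp_invariant[OF fu[of 1], of "{x. b 1 x = \<zeta> *s x}"] inv[of 1] v fu[of 1]
        unfolding L_def by (auto simp: finite_unitary_scale image_subset_iff)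
      then obtain \<mu> where \<mu>: "b 1 v = \<mu> *s v"
        using orth_rank_le_1_collinear[OF rankL L v] by auto
      have "\<mu> \<noteq> \<zeta>"
      proof
        assume "\<mu> = \<zeta>"
        then have "cinner v v = 0"
          using v \<mu> by (auto simp: L_def perp_def)
        then show False
          using v by simp
      qed
      have \<mu>1: "\<mu> * cnj \<mu> = 1"
        using finite_unitary_cinner[OF fu[of 1], of v v] v by (auto simp: \<mu> cinner_simps mult.commute)
      \<comment> \<open>\<open>R i w\<close> says that \<open>b i\<close> acts on \<open>S\<close>
        as a complex reflection in \<open>w\<close>, with eigenvalue \<mu> on \<open>w\<close> and
        \<zeta> on its complement. The eigenvalues do not depend on \<open>i\<close>, since the
        generators are conjugate along the chain.\<close>
      define R where "R i w \<longleftrightarrow> w \<in> S \<and> w \<noteq> 0 \<and> b i w = \<mu> *s w \<and>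
        (\<forall>x\<in>S. cinner x w = 0 \<longrightarrow> b i x = \<zeta> *s x)" for i w
      have R1: "R 1 v"
        unfolding R_def
      proof (intro conjI ballI impI v vS \<mu>)
        fix x assume x: "x \<in> S" "cinner x v = 0"
        obtain e u where eu: "x = e + u" "b 1 e = \<zeta> *s e" "u \<in> L"
          using split[OF x(1)] by blast
        have "cinner e v = 0"
          by (subst cinner_eq_zero_commute) (use v eu in \<open>auto simp: L_def perp_def\<close>)
        then have "cinner u v = 0"
          using x eu by (simp add: cinner_simps)
        moreover obtain c where "u = c *s v"
          using orth_rank_le_1_collinear[OF rankL L v eu(3)] by auto
        ultimately have "u = 0"
          using v by (auto simp: cinner_simps)
        then show "b 1 x = \<zeta> *s x"
          using eu by simp
      qed
      \<comment> \<open>\<open>b i \<circ> b (i + 1)\<close> conjugates \<open>b i\<close> into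
        \<open>b (i + 1)\<close> and so carries a reflection vector of the one to a reflection
        vector of the other.\<close>
      have Rstep: "R (i + 1) (b i (b (i + 1) w))" if w: "R i w" and i: "i \<in> {1..4}" for i w
      proof -
        have i5: "i \<in> {1..5}" "i + 1 \<in> {1..5}"
          using i by auto
        have bb: "b (i + 1) (b i (b (i + 1) x)) = b i (b (i + 1) (b i x))" for x
          using braid[OF i] by simp
        show ?thesis
          unfolding R_def
        proof (intro conjI ballI impI)
          show "b i (b (i + 1) w) \<in> S"
            using w inv i5 unfolding R_def by blast
          show "b i (b (i + 1) w) \<noteq> 0"
            using w fu i5 by (simp add: finite_unitary_eq_0 R_def)
          show "b (i + 1) (b i (b (i + 1) w)) = \<mu> *s b i (b (i + 1) w)"
            using w fu i5 by (simp add: bb finite_unitary_scale R_def)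
          fix x assume x: "x \<in> S" "cinner x (b i (b (i + 1) w)) = 0"
          obtain y where y: "y \<in> S" "b i (b (i + 1) y) = x"
            using finite_unitary_comp_preimage[OF fu[OF i5(1)] fu[OF i5(2)] inv[OF i5(1)] inv[OF i5(2)] x(1)]
            by blast
          then have "cinner y w = 0"
            using x(2) fu i5 by (auto simp: finite_unitary_cinner)
          then have "b i y = \<zeta> *s y"
            using w y by (auto simp: R_def)
          then show "b (i + 1) x = \<zeta> *s x"
            using fu i5 bb[of y] y by (simp add: finite_unitary_scale)
        qed
      qed
      have split1: "\<exists>c x'. x = x' + c *s w \<and> x' \<in> S \<and> cinner x' w = 0 \<and> b i x' = \<zeta> *s x'"
        if "R i w" "x \<in> S" for i x w
      proof (intro exI conjI)
        show "x = (x - (cinner x w / cinner w w) *s w) + (cinner x w / cinner w w) *s w"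
          by simp
        show "x - (cinner x w / cinner w w) *s w \<in> S"
          using that S by (intro vec.subspace_diff vec.subspace_scale) (auto simp: R_def)
        moreover show "cinner (x - (cinner x w / cinner w w) *s w) w = 0"
          using that by (simp add: cinner_simps R_def)
        ultimately show "b i (x - (cinner x w / cinner w w) *s w)
            = \<zeta> *s (x - (cinner x w / cinner w w) *s w)"
          using that by (simp add: R_def)
      qed
      have Reig: "\<exists>c. x = c *s w" if R: "R i w" "x \<in> S" "b i x = \<mu> *s x" and i: "i \<in> {1..5}" for i x w
      proof -
        obtain c y where y: "x = y + c *s w" "b i y = \<zeta> *s y"
          using split1[OF R(1,2)] by blast
        have "b i x = \<zeta> *s y + c *s (\<mu> *s w)"
          using y fu[OF i] R by (simp add: finite_unitary_add finite_unitary_scale R_def)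
        then have "(\<mu> - \<zeta>) *s y = 0"
          using R y by (auto simp: algebra_simps vec.scale_left_diff_distrib vec.scale_right_distrib)
        then show ?thesis
          using \<open>\<mu> \<noteq> \<zeta>\<close> y by simp
      qed
      have Rcollinear: "E i j" if R: "R i w" "R j w'" "w' = c *s w" and i: "i \<in> {1..5}" "j \<in> {1..5}"
        for i j w w' c
        unfolding E_def
      proof
        fix x assume x: "x \<in> S"
        obtain a y where y: "x = y + a *s w'" "y \<in> S" "cinner y w' = 0" "b j y = \<zeta> *s y"
          using split1[OF R(2) x] by blast
        have c: "c \<noteq> 0"
          using R by (auto simp: R_def)
        then have "cinner y w = 0"
          using y R by (simp add: cinner_simps)
        then have "b i y = \<zeta> *s y"
          using R y by (simp add: R_def)
        moreover have "b i w' = \<mu> *s w'"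
          using R fu[OF i(1)] by (simp add: R_def finite_unitary_scale mult.commute)
        moreover have "b j w' = \<mu> *s w'"
          using R by (simp add: R_def)
        ultimately show "b i x = b j x"
          using y fu i by (simp add: finite_unitary_add finite_unitary_scale)
      qed
      \<comment> \<open>A commuting \<open>b j\<close> preserves the line of \<open>w\<close>,
        acting by some \<open>c\<close>. If \<open>w\<close> and \<open>w'\<close> are not
        orthogonal, unitarity of \<open>b j\<close> forces \<open>c = \<mu>\<close>; then
        \<open>w\<close> is a multiple of \<open>w'\<close> and the two reflections
        coincide.\<close>
      have Rorth: "cinner w w' = 0 \<or> E i j"
        if R: "R i w" "R j w'" and C: "C i j" and i: "i \<in> {1..5}" "j \<in> {1..5}" for i j w w'
      proof (cases "cinner w w' = 0")
        case False
        have w: "w \<in> S" "w' \<in> S" "b i w = \<mu> *s w" "b j w' = \<mu> *s w'"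
          using R by (auto simp: R_def)
        have "b i (b j w) = \<mu> *s b j w" "b j w \<in> S"
          using C w fu[OF i(2)] inv[OF i(2)] by (auto simp: C_def finite_unitary_scale)
        then obtain c where c: "b j w = c *s w"
          using Reig[OF R(1) _ _ i(1)] by blast
        have "cinner (b j w) (b j w') = cinner w w'"
          using fu[OF i(2)] by (rule finite_unitary_cinner)
        then have "c * cnj \<mu> = 1"
          using False by (simp add: c w cinner_simps mult.commute)
        then have "c = \<mu>"
          using \<mu>1 by (metis mult_cancel_right mult_zero_right zero_neq_one)
        then obtain d where "w = d *s w'"
          using Reig[OF R(2) w(1) _ i(2)] c by auto
        then show ?thesis
          using Rcollinear[OF R(2,1) _ i(2,1)] E_sym by blast
      qed simp
      define v2 where "v2 = b 1 (b 2 v)"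
      define v3 where "v3 = b 2 (b 3 v2)"
      define v4 where "v4 = b 3 (b 4 v3)"
      define v5 where "v5 = b 4 (b 5 v4)"
      have R2: "R 2 v2"
        using Rstep[OF R1] by (simp add: v2_def del: One_nat_def)
      have R3: "R 3 v3"
        using Rstep[OF R2] by (simp add: v3_def)
      have R4: "R 4 v4"
        using Rstep[OF R3] by (simp add: v4_def)
      have R5: "R 5 v5"
        using Rstep[OF R4] by (simp add: v5_def)
      have nz: "v \<noteq> 0" "v3 \<noteq> 0" "v5 \<noteq> 0" and inS: "v \<in> S" "v2 \<in> S" "v3 \<in> S" "v4 \<in> S" "v5 \<in> S"
        using R1 R2 R3 R4 R5 by (auto simp: R_def)
      show ?thesis
      proof (rule ccontr)
        assume ne: "\<not> ?thesis"
        \<comment> \<open>Equality of non-adjacent generators is excluded as well: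
          \<open>E 1 3\<close> and \<open>C 1 4\<close> give \<open>C 3 4\<close>, hence
          \<open>E 3 4\<close>. The other pairs are similar.\<close>
        have o13: "cinner v v3 = 0"
          using Rorth[OF R1 R3 Cs(1)] EC[OF _ Cs(2), of 3] EC[of 3 1 4] E_sym ne CEs Cs by auto
        have o14: "cinner v v4 = 0"
          using Rorth[OF R1 R4 Cs(2)] EC[of 4 1 3] E_sym ne CEs Cs C_sym by auto
        have o15: "cinner v v5 = 0"
          using Rorth[OF R1 R5 Cs(3)] EC[of 5 1 4] E_sym ne CEs Cs C_sym by auto
        have o24: "cinner v2 v4 = 0"
          using Rorth[OF R2 R4 Cs(4)] EC[of 2 4 1] E_sym ne CEs Cs C_sym by auto
        have o25: "cinner v2 v5 = 0"
          using Rorth[OF R2 R5 Cs(5)] EC[of 2 5 1] E_sym ne CEs Cs C_sym by auto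
        have o35: "cinner v3 v5 = 0"
          using Rorth[OF R3 R5 Cs(6)] EC[of 3 5 2] E_sym ne CEs Cs C_sym by auto
        have o': "cinner v3 v = 0" "cinner v5 v = 0" "cinner v5 v3 = 0" "cinner v4 v = 0"
          using o13 o15 o35 o14 by (simp_all add: cinner_eq_zero_commute[of v3 v] 
              cinner_eq_zero_commute[of v5 v] cinner_eq_zero_commute[of v5 v3] cinner_eq_zero_commute[of v4 v])
        \<comment> \<open>\<open>v\<close>, \<open>v3\<close>, \<open>v5\<close> reach the maximal
          size 3. So \<open>v4\<close>, being orthogonal to \<open>v\<close>, is a combination of
          \<open>v3\<close> and \<open>v5\<close>, with nonzero coefficient at \<open>v3\<close>. As
          \<open>v2\<close> is orthogonal to \<open>v4\<close> and \<open>v5\<close>, it is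
          orthogonal to \<open>v3\<close>, hence proportional to \<open>v\<close>.\<close>
        have sys: "orth_system {v, v3, v5}"
          using nz o13 o15 o35 o' by (auto simp: orth_system_def)
        have "v \<noteq> v3" "v \<noteq> v5" "v3 \<noteq> v5"
          using nz o13 o15 o35 by auto
        then have card: "card {v, v3, v5} = 3"
          by simp
        have zero: "x = 0" if "x \<in> S" "cinner x v = 0" "cinner x v3 = 0" "cinner x v5 = 0" for x
          by (rule orth_rank_le_dependent[OF rank _ card sys]) (use that inS in auto)
        define a where "a = cinner v4 v3 / cinner v3 v3"
        define c where "c = cinner v4 v5 / cinner v5 v5"
        have "v4 - a *s v3 - c *s v5 = 0"
        proof (rule zero)
          show "v4 - a *s v3 - c *s v5 \<in> S"
            using inS S by (intro vec.subspace_diff vec.subspace_scale)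
        qed (use nz o' o35 in \<open>auto simp: cinner_simps a_def c_def\<close>)
        then have v4: "v4 = a *s v3 + c *s v5"
          by (simp add: algebra_simps)
        have "a \<noteq> 0"
        proof
          assume "a = 0"
          then have "v4 = c *s v5"
            using v4 by simp
          then have "E 5 4"
            using Rcollinear[OF R5 R4] by auto
          then show False
            using ne E_sym by blast
        qed
        then have "cinner v2 v3 = 0"
          using o24 o25 by (simp add: v4 cinner_simps)
        have "v2 - (cinner v2 v / cinner v v) *s v = 0"
        proof (rule zero)
          show "v2 - (cinner v2 v / cinner v v) *s v \<in> S"
            using inS S by (intro vec.subspace_diff vec.subspace_scale)
        qed (use nz o13 o15 o25 \<open>cinner v2 v3 = 0\<close> in \<open>auto simp: cinner_simps\<close>)
        then have "E 1 2"
          using Rcollinear[OF R1 R2, of "cinner v2 v / cinner v v"] by auto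
        then show False
          using ne by blast
      qed
    qed
  qed
  then show ?thesis
    using all x by (auto simp: E_def)
qed

section \<open>Unitary representations of the braid relations of type $E_7$\<close>

lemma E7_connected:
  assumes "P 1" and step: "\<And>i j. i \<in> {1..7} \<Longrightarrow> j \<in> {1..7} \<Longrightarrow> i \<noteq> j \<Longrightarrow> {i, j} \<in> E7_edges \<Longrightarrow> P i \<Longrightarrow> P j"
    and k: "k \<in> {1..7}"
  shows "P (k :: nat)"
proof -
  have 3: "P 3" using step[of 1 3] assms(1) by (simp add: E7_edges_def)
  then have 4: "P 4" using step[of 3 4] by (simp add: E7_edges_def)
  then have 2: "P 2" using step[of 4 2] by (simp add: E7_edges_def insert_commute)
  have 5: "P 5" using 4 step[of 4 5] by (simp add: E7_edges_def)
  then have 6: "P 6" using step[of 5 6] by (simp add: E7_edges_def)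
  then have 7: "P 7" using step[of 6 7] by (simp add: E7_edges_def)
  have "k = 1 \<or> k = 2 \<or> k = 3 \<or> k = 4 \<or> k = 5 \<or> k = 6 \<or> k = 7"
    using k by auto
  then show ?thesis
    using assms(1) 2 3 4 5 6 7 by blast
qed

section \<open>Complex conjugation and dimension counts\<close>

definition cnj_vec :: "complex ^ 'n \<Rightarrow> complex ^ 'n"
  where "cnj_vec x = (\<chi> i. cnj (x $ i))"

lemma cinner_cnj_vec: "cinner (cnj_vec x) (cnj_vec y) = cnj (cinner x y)"
  by (simp add: cinner_def cnj_vec_def)

lemma cnj_vec_cnj_vec [simp]: "cnj_vec (cnj_vec x) = x"
  by (simp add: cnj_vec_def vec_eq_iff)

lemma cnj_vec_scale: "cnj_vec (c *s x) = cnj c *s cnj_vec x"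
  by (simp add: cnj_vec_def vec_eq_iff)

lemma cnj_vec_eq_0 [simp]: "cnj_vec x = 0 \<longleftrightarrow> x = 0"
  by (simp add: cnj_vec_def vec_eq_iff)

lemma inj_cnj_vec: "inj cnj_vec"
  by (metis cnj_vec_cnj_vec injI)

lemma orth_system_Un:
  assumes "orth_system A" "orth_system B" "\<And>x y. x \<in> A \<Longrightarrow> y \<in> B \<Longrightarrow> cinner x y = 0"
  shows "orth_system (A \<union> B)" and "A \<inter> B = {}"
proof -
  have "cinner y x = 0" if "x \<in> A" "y \<in> B" for x y
    using assms(3)[OF that] by (simp add: cinner_eq_zero_commute[of y x])
  then show "orth_system (A \<union> B)"
    using assms unfolding orth_system_def by blast
  show "A \<inter> B = {}"
  proof (rule ccontr)
    assume "A \<inter> B \<noteq> {}"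
    then obtain x where "x \<in> A" "x \<in> B" by auto
    then show False
      using assms(1) assms(3)[of x x] by (auto simp: orth_system_def)
  qed
qed

lemma orth_card_le:
  fixes A B :: "(complex ^ 'n) set"
  assumes "orth_system A" "orth_system B" "\<And>x y. x \<in> A \<Longrightarrow> y \<in> B \<Longrightarrow> cinner x y = 0"
    and "finite A" "finite B"
  shows "card A + card B \<le> CARD('n)"
proof -
  have "orth_system (A \<union> B)" "A \<inter> B = {}"
    by (rule orth_system_Un; use assms in blast)+
  then show ?thesis
    using orth_rank_le_UNIV[of "A \<union> B"] assms(4,5)
    by (auto simp: orth_rank_le_def card_Un_disjoint)
qed

text \<open>The two complements refer to eigenspaces in the whole space, where \<open>f\<close> and
  \<open>g\<close> may differ. Splitting \<open>x\<close> inside \<open>S\<close> bridges the gap: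
  the eigenvector part \<open>e\<close> stays in \<open>S\<close>, so it is an eigenvector of
  \<open>g\<close> too, hence orthogonal to \<open>x\<close>, hence zero.\<close>

lemma perp_agree:
  assumes f: "finite_unitary f" "f ` S \<subseteq> S" and S: "vec.subspace S"
    and eq: "\<And>x. x \<in> S \<Longrightarrow> f x = g x"
    and x: "x \<in> S" "x \<in> perp {x. g x = \<zeta> *s x}"
  shows "x \<in> perp {x. f x = \<zeta> *s x}"
proof -
  obtain e u where eu: "x = e + u" "e \<in> S" "f e = \<zeta> *s e"
    and u: "\<And>y. f y = \<zeta> *s y \<Longrightarrow> cinner u y = 0"
    using eigen_split[OF f(1) S f(2) x(1)] by metis
  have "cinner x e = 0"
    using x(2) eu eq[of e] by (simp add: perp_def)
  then have "e = 0"
    using u[OF eu(3)] by (simp add: eu(1) cinner_simps)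
  then show ?thesis
    using u by (simp add: eu(1) perp_def)
qed

text \<open>Only the Artin relations, reality and irreducibility of the family enter, not the group
  W. The involution property is shown at vertex 1 and carried along edges by conjugation.\<close>

lemma E7_braid_rep:
  fixes F :: "nat \<Rightarrow> complex ^ 'n \<Rightarrow> complex ^ 'n"
  assumes card: "CARD('n) = 7"
    and fu: "\<And>i. i \<in> {1..7} \<Longrightarrow> finite_unitary (F i)"
    and real: "\<And>i x. i \<in> {1..7} \<Longrightarrow> F i (cnj_vec x) = cnj_vec (F i x)"
    and comm: "\<And>i j x. i \<in> {1..7} \<Longrightarrow> j \<in> {1..7} \<Longrightarrow> i \<noteq> j \<Longrightarrow> {i, j} \<notin> E7_edges \<Longrightarrow>
      F i (F j x) = F j (F i x)"
    and braid: "\<And>i j x. i \<in> {1..7} \<Longrightarrow> j \<in> {1..7} \<Longrightarrow> i \<noteq> j \<Longrightarrow> {i, j} \<in> E7_edges \<Longrightarrow>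
      F i (F j (F i x)) = F j (F i (F j x))"
    and irred: "\<And>X. vec.subspace X \<Longrightarrow> (\<And>i. i \<in> {1..7} \<Longrightarrow> F i ` X \<subseteq> X) \<Longrightarrow> X \<noteq> {0} \<Longrightarrow> X = UNIV"
    and k: "k \<in> {1..7}"
  shows "F k (F k x) = x"
proof -
  note edges = E7_edges_def doubleton_eq_iff
  have rank7: "orth_rank_le S 7" for S :: "(complex ^ 'n) set"
    using orth_rank_le_UNIV[of S] card by simp
  have no_line: False if y: "y \<noteq> 0" "\<And>i. i \<in> {1..7} \<Longrightarrow> \<exists>c. F i y = c *s y" for y
  proof -
    define X where "X = range (\<lambda>c. c *s y)"
    have X_span: "X = vec.span {y}"
      by (simp add: X_def vec.span_singleton)
    then have X: "vec.subspace X"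
      by simp
    have "F i ` X \<subseteq> X" if i: "i \<in> {1..7}" for i
      using y(2)[OF i] by (auto simp: X_def finite_unitary_scale[OF fu[OF i]])
    moreover have "y \<in> X"
      unfolding X_def by (rule range_eqI[of _ _ 1]) simp
    ultimately have X1: "X = UNIV"
      using irred[OF X] y(1) by blast
    have "\<not> CARD('n) \<le> Suc 0"
      by (simp add: card)
    then obtain i j :: 'n where "i \<noteq> j"
      using card_le_Suc0_iff_eq[of "UNIV :: 'n set"] by auto
    have "axis i 1 \<in> X" "axis j 1 \<in> X"
      by (simp_all add: X1)
    then obtain c d where cd: "axis i 1 = c *s y" "axis j 1 = d *s y"
      by (auto simp: X_def)
    have "c * y $ i = 1" "c * y $ j = 0" "d * y $ j = 1"
      using arg_cong[OF cd(1), of "\<lambda>v. v $ i"] arg_cong[OF cd(1), of "\<lambda>v. v $ j"]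
        arg_cong[OF cd(2), of "\<lambda>v. v $ j"] \<open>i \<noteq> j\<close> by (auto simp: axis_def)
    then show False by auto
  qed
  have ex_nz: "\<exists>y :: complex ^ 'n. y \<noteq> 0"
    by (metis vec_eq_iff one_index zero_index zero_neq_one)
  have C: "F i (F j x) = F j (F i x)" if "i \<in> {1..7}" "j \<in> {1..7}" "{i, j} \<notin> E7_edges" for i j x
    using comm[OF that(1,2) _ that(3)] by (cases "i = j") auto
  have chain: "F i x = F j x"
    if S: "vec.subspace S" "\<And>i. i \<in> {2,4,5,6,7} \<Longrightarrow> F i ` S \<subseteq> S" "orth_rank_le S 3" "x \<in> S"
      and ij: "i \<in> {2,4,5,6,7}" "j \<in> {2,4,5,6,7}" for S i j x
  proof -
    \<comment> \<open>The path 2, 4, 5, 6, 7 of the diagram, renumbered from 1 to 5; the entry at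
      position 0 is a filler.\<close>
    define m where "m = (!) [0, 2, 4, 5, 6, 7 :: nat]"
    have m: "m 1 = 2" "m 2 = 4" "m 3 = 5" "m 4 = 6" "m 5 = 7"
      by (simp_all add: m_def)
    have five: "i = 1 \<or> i = 2 \<or> i = 3 \<or> i = 4 \<or> i = 5" if "i \<in> {1..5}" for i :: nat
      using that by auto
    have four: "i = 1 \<or> i = 2 \<or> i = 3 \<or> i = 4" if "i \<in> {1..4}" for i :: nat
      using that by auto
    have m1: "m i \<in> {2,4,5,6,7}" if "i \<in> {1..5}" for i
      using five[OF that] by (elim disjE; simp add: m)
    then have "m i \<in> {1..7}" if "i \<in> {1..5}" for i
      using that by fastforce
    note mm = m1 this
    have Fm: "F (m a) x = F (m b) x" if ab: "a \<in> {1..5}" "b \<in> {1..5}" for a b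
    proof (rule braid_chain_low_rank[OF _ S(1) _ _ _ S(3) ab S(4)])
      show "finite_unitary (F (m i))" if "i \<in> {1..5}" for i
        using fu mm that by blast
      show "F (m i) ` S \<subseteq> S" if "i \<in> {1..5}" for i
        using S(2) mm that by blast
      show "F (m i) (F (m j) x) = F (m j) (F (m i) x)" if i: "i \<in> {1..5}" "j \<in> {1..5}" "i + 1 < j" for i j x
      proof (rule C)
        show "{m i, m j} \<notin> E7_edges"
          using five[OF i(1)] five[OF i(2)] i(3) by (elim disjE; simp add: m edges)
      qed (use mm i in blast)+
      show "F (m i) (F (m (i + 1)) (F (m i) x)) = F (m (i + 1)) (F (m i) (F (m (i + 1)) x))"
        if i: "i \<in> {1..4}" for i x
      proof (rule braid)
        show "{m i, m (i + 1)} \<in> E7_edges"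
          using four[OF i] by (elim disjE; simp add: m edges)
        show "m i \<noteq> m (i + 1)"
          using four[OF i] by (elim disjE; simp add: m)
      qed (use mm(2)[of i] mm(2)[of "i + 1"] i in auto)
    qed
    have ex: "\<exists>a\<in>{1..5}. m a = l" if "l \<in> {2,4,5,6,7}" for l
    proof -
      have "m 1 = l \<or> m 2 = l \<or> m 3 = l \<or> m 4 = l \<or> m 5 = l"
        using that by (auto simp: m)
      moreover have "{1, 2, 3, 4, 5} \<subseteq> {1..5 :: nat}"
        by simp
      ultimately show ?thesis
        by blast
    qed
    obtain a b where ab: "a \<in> {1..5}" "b \<in> {1..5}" and "m a = i" "m b = j"
      using ex[OF ij(1)] ex[OF ij(2)] by blast
    then show ?thesis
      using Fm[OF ab] by simp
  qed
  have twist: "F j (F i (F j x)) = F i (F j (F i x))"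
    if "i \<in> {1..7}" "j \<in> {1..7}" "i \<noteq> j" "{i, j} \<in> E7_edges" for i j x
    using braid[OF that] by simp
  \<comment> \<open>Otherwise \<open>chain\<close> applies to every eigenspace of \<open>F 1\<close>
    and gives \<open>F 4 = F 5\<close> everywhere. The equality spreads over the diagram, and an
    eigenvector of the single remaining operator spans an invariant line.\<close>
  have "\<exists>\<zeta>. \<not> orth_rank_le {x. F 1 x = \<zeta> *s x} 3"
  proof (rule ccontr)
    assume "\<not> ?thesis"
    then have rank: "orth_rank_le {x. F 1 x = \<zeta> *s x} 3" for \<zeta>
      by blast
    have "UNIV \<subseteq> {x \<in> UNIV. F 4 x = F 5 x}"
    proof (rule eigen_decomposition[OF fu[of 1]])
      show "vec.subspace {x \<in> UNIV. F 4 x = F 5 x}"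
        by (intro subspace_equalizer fu vec.subspace_UNIV) auto
      fix x \<zeta> assume x: "F 1 x = \<zeta> *s x"
      have "F 4 x = F 5 x"
      proof (rule chain[OF _ _ rank[of \<zeta>]])
        show "vec.subspace {x. F 1 x = \<zeta> *s x}"
          using subspace_eigen[OF fu[of 1] vec.subspace_UNIV] by simp
        show "F i ` {x. F 1 x = \<zeta> *s x} \<subseteq> {x. F 1 x = \<zeta> *s x}" if "i \<in> {2,4,5,6,7}" for i
        proof -
          have i: "i \<in> {1..7}" "{1, i} \<notin> E7_edges"
            using that by (auto simp: edges)
          then show ?thesis
            using C[of 1 i] by (auto simp: finite_unitary_scale[OF fu[OF i(1)]])
        qed
      qed (use x in auto)
      then show "x \<in> {x \<in> UNIV. F 4 x = F 5 x}" by simp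
    qed auto
    then have 45: "F 4 x = F 5 x" for x
      by auto
    \<comment> \<open>\<open>F i\<close> commutes with \<open>F l\<close>, hence with its equal
      \<open>F j\<close>; the braid relation then identifies \<open>F i\<close> and
      \<open>F j\<close>.\<close>
    have merge: "F i x = F j x"
      if "\<And>x. F j x = F l x" "i \<in> {1..7}" "j \<in> {1..7}" "l \<in> {1..7}"
        "i \<noteq> j" "{i, j} \<in> E7_edges" "{i, l} \<notin> E7_edges" for i j l x
      using braid_commute_eq[of "F i" "F j" UNIV x] fu braid[of i j] C[of i l] that by simp
    have 65: "F 6 x = F 5 x" for x
      using merge[of 5 4 6] 45 by (simp add: edges)
    have 34: "F 3 x = F 4 x" for x
      using merge[of 4 5 3] 45 by (simp add: edges)
    have 24: "F 2 x = F 4 x" for x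
      using merge[of 4 5 2] 45 by (simp add: edges)
    have 13: "F 1 x = F 3 x" for x
      using merge[of 3 4 1] 34 by (simp add: edges)
    have 76: "F 7 x = F 6 x" for x
      using merge[of 6 5 7] 65 by (simp add: edges)
    have eq: "F i x = F 4 x" if "i \<in> {1..7}" for i x
    proof -
      have "i = 1 \<or> i = 2 \<or> i = 3 \<or> i = 4 \<or> i = 5 \<or> i = 6 \<or> i = 7"
        using that by auto
      then show ?thesis
        by (elim disjE; simp only: 45[symmetric] 65 34 24 13 76)
    qed
    obtain y0 :: "complex ^ 'n" where "y0 \<noteq> 0"
      using ex_nz by blast
    then obtain y \<zeta> where "y \<noteq> 0" "F 4 y = \<zeta> *s y"
      using eigen_exists[OF fu[of 4] vec.subspace_UNIV, of y0] by auto
    then show False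
      using no_line[of y] eq by metis
  qed
  then obtain \<zeta> B where B: "B \<subseteq> {x. F 1 x = \<zeta> *s x}" "orth_system B" "finite B" "4 \<le> card B"
    by (auto simp: orth_rank_le_def not_le)
  have \<zeta>: "\<zeta> * \<zeta> = 1"
  proof (rule ccontr)
    assume ne: "\<zeta> * \<zeta> \<noteq> 1"
    have "cinner x y = 0" if "x \<in> B" "y \<in> cnj_vec ` B" for x y
    proof -
      have "F 1 x = \<zeta> *s x" "F 1 y = cnj \<zeta> *s y"
        using that B(1) by (auto simp: real cnj_vec_scale)
      then have "cinner x y = (\<zeta> * \<zeta>) * cinner x y"
        using finite_unitary_cinner[OF fu[of 1], of x y] by (simp add: cinner_simps)
      then show ?thesis
        using ne by simp
    qed
    moreover have "orth_system (cnj_vec ` B)"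
      using B(2) by (auto simp: orth_system_def cinner_cnj_vec)
    ultimately have "card B + card (cnj_vec ` B) \<le> CARD('n)"
      using B by (intro orth_card_le) auto
    then show False
      using B(4) card by (simp add: card_image[OF inj_on_subset[OF inj_cnj_vec]])
  qed
  define E where "E i = {x. F i x = \<zeta> *s x}" for i
  define U where "U i = perp (E i)" for i
  have subU: "vec.subspace (U i)" for i
    by (simp add: U_def subspace_perp)
  \<comment> \<open>\<open>F i \<circ> F j\<close> conjugates \<open>F i\<close> into
    \<open>F j\<close>: it carries \<open>E i\<close> onto \<open>E j\<close> and, being unitary,
    \<open>U i\<close> onto \<open>U j\<close>.\<close>
  have E_iff: "F i (F j x) \<in> E j \<longleftrightarrow> x \<in> E i"
    if ij: "i \<in> {1..7}" "j \<in> {1..7}" "i \<noteq> j" "{i, j} \<in> E7_edges" for i j x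
  proof -
    have "\<zeta> *s F i (F j x) = F i (F j (\<zeta> *s x))"
      using fu ij by (simp add: finite_unitary_scale)
    then show ?thesis
      using fu ij by (simp add: E_def twist[OF ij] finite_unitary_eq)
  qed
  have E_comm: "F i ` E j \<subseteq> E j" if ij: "i \<in> {1..7}" "j \<in> {1..7}" "{i, j} \<notin> E7_edges" for i j
    using C[OF ij, symmetric] by (auto simp: E_def finite_unitary_scale[OF fu[OF ij(1)]])
  have U_comm: "F i ` U j \<subseteq> U j" if ij: "i \<in> {1..7}" "j \<in> {1..7}" "{i, j} \<notin> E7_edges" for i j
    unfolding U_def by (rule perp_invariant[OF fu[OF ij(1)] E_comm[OF ij]])
  have surj: "\<exists>y. F i (F j y) = x" if "i \<in> {1..7}" "j \<in> {1..7}" for i j x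
    using finite_unitary_comp_preimage[OF fu[OF that(1)] fu[OF that(2)], of UNIV x] by auto
  have U_iff: "F i (F j x) \<in> U j \<longleftrightarrow> x \<in> U i"
    if ij: "i \<in> {1..7}" "j \<in> {1..7}" "i \<noteq> j" "{i, j} \<in> E7_edges" for i j x
  proof -
    have "F i (F j x) \<in> U j \<longleftrightarrow> (\<forall>y. F i (F j y) \<in> E j \<longrightarrow> cinner (F i (F j x)) (F i (F j y)) = 0)"
      using surj[OF ij(1,2)] unfolding U_def perp_def by auto metis
    also have "\<dots> \<longleftrightarrow> x \<in> U i"
      using ij by (simp add: E_iff finite_unitary_cinner fu U_def perp_def Ball_def)
    finally show ?thesis .
  qed
  have split: "\<exists>e u. x = e + u \<and> e \<in> E i \<and> e \<in> S \<and> u \<in> U i \<and> u \<in> S"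
    if S: "i \<in> {1..7}" "vec.subspace S" "F i ` S \<subseteq> S" "x \<in> S" for i S x
  proof -
    obtain e u where "x = e + u" "e \<in> S" "u \<in> S" "F i e = \<zeta> *s e"
      "\<And>y. F i y = \<zeta> *s y \<Longrightarrow> cinner u y = 0"
      using eigen_split[OF fu[OF S(1)] S(2-4), of \<zeta>] by auto
    then show ?thesis
      by (auto simp: E_def U_def perp_def)
  qed
  have UE: "cinner u e = 0" "cinner e u = 0" if "u \<in> U i" "e \<in> E i" for i u e
    using that by (auto simp: U_def perp_def cinner_eq_zero_commute[of e u])
  \<comment> \<open>The bound is 7 - 4 = 3, just what \<open>chain\<close> requires.\<close>
  have rankU: "orth_rank_le (U 1) 3"
    unfolding orth_rank_le_def
  proof (intro allI impI)
    fix B' assume B': "B' \<subseteq> U 1" "orth_system B'" "finite B'"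
    have "card B + card B' \<le> CARD('n)"
    proof (rule orth_card_le[OF B(2) B'(2) _ B(3) B'(3)])
      fix x y assume "x \<in> B" "y \<in> B'"
      then have "x \<in> E 1" "y \<in> U 1"
        using B(1) B'(1) by (auto simp: E_def)
      then show "cinner x y = 0"
        by (rule UE(2)[rotated])
    qed
    then show "card B' \<le> 3"
      using B(4) card by simp
  qed
  have agree1: "F i x = F j x" if "x \<in> U 1" "i \<in> {2,4,5,6,7}" "j \<in> {2,4,5,6,7}" for i j x
  proof (rule chain[OF subU _ rankU that])
    show "F i ` U 1 \<subseteq> U 1" if "i \<in> {2,4,5,6,7}" for i
      using that by (intro U_comm) (auto simp: edges)
  qed
  \<comment> \<open>The operators at 2, 4, 5, 6, 7 agree on \<open>U 1\<close>, so all their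
    \<open>U i\<close> meet \<open>U 1\<close> in the same subspace. It will turn out to be
    invariant under every \<open>F i\<close>, hence zero.\<close>
  define X where "X = U 1 \<inter> U 7"
  have subX: "vec.subspace X"
    unfolding X_def by (intro vec.subspace_inter subU)
  have X_eq: "U 1 \<inter> U i = X" if i: "i \<in> {2,4,5,6,7}" for i
  proof -
    have "x \<in> U j" if x: "x \<in> U 1" "x \<in> U i" and ij: "i \<in> {2,4,5,6,7}" "j \<in> {2,4,5,6,7}" for x i j
      unfolding U_def E_def
    proof (rule perp_agree[OF _ _ subU])
      show "finite_unitary (F j)"
        using ij fu by auto
      show "F j ` U 1 \<subseteq> U 1"
        using ij by (intro U_comm) (auto simp: edges)
      show "x \<in> perp {x. F i x = \<zeta> *s x}"
        using x by (simp add: U_def E_def)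
    qed (use x ij agree1 in blast)+
    then show ?thesis
      using i unfolding X_def by blast
  qed
  have "X = {0}"
  proof (rule ccontr)
    assume X0: "X \<noteq> {0}"
    \<comment> \<open>Away from 6 and 7 the conjugating operators preserve \<open>U 7\<close>, so
      the dimension of the intersection does not grow along 1, 3, 4, 2. Since
      \<open>U 7 \<inter> U 4\<close> and \<open>U 7 \<inter> U 2\<close> contain \<open>X\<close>,
      they are equal to it.\<close>
    have dimU: "vec.dim (U 7 \<inter> U j) \<le> vec.dim (U 7 \<inter> U i)"
      if ij: "i \<in> {1..5}" "j \<in> {1..5}" "i \<noteq> j" "{i, j} \<in> E7_edges" for i j
    proof -
      have i7: "i \<in> {1..7}" "j \<in> {1..7}" "{i, 7} \<notin> E7_edges" "{j, 7} \<notin> E7_edges"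
        using ij by (auto simp: edges)
      have mem: "F i (F j x) \<in> U 7 \<longleftrightarrow> x \<in> U 7" for x
        using finite_unitary_mem_iff[OF fu[OF i7(1)] U_comm[OF i7(1) _ i7(3)], of "F j x"]
          finite_unitary_mem_iff[OF fu[OF i7(2)] U_comm[OF i7(2) _ i7(4)], of x] by simp
      have "U 7 \<inter> U j \<subseteq> (F i \<circ> F j) ` (U 7 \<inter> U i)"
      proof
        fix x assume x: "x \<in> U 7 \<inter> U j"
        obtain y where y: "F i (F j y) = x"
          using surj[OF i7(1,2)] by blast
        then have "y \<in> U 7 \<inter> U i"
          using x mem[of y] U_iff[OF i7(1,2) ij(3,4), of y] by simp
        then show "x \<in> (F i \<circ> F j) ` (U 7 \<inter> U i)"
          using y by auto
      qed
      then have "vec.dim (U 7 \<inter> U j) \<le> vec.dim ((F i \<circ> F j) ` (U 7 \<inter> U i))"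
        by (rule vec.dim_subset)
      also have "\<dots> \<le> vec.dim (U 7 \<inter> U i)"
      proof (rule vec.dim_image_le)
        show "Vector_Spaces.linear (*s) (*s) (F i \<circ> F j)"
          using fu[OF i7(1)] fu[OF i7(2)] unfolding finite_unitary_def
          by (blast intro: Vector_Spaces.linear_compose)
      qed
      finally show ?thesis .
    qed
    have d4: "vec.dim (U 7 \<inter> U 4) \<le> vec.dim X"
      using dimU[of 1 3] dimU[of 3 4] by (simp add: edges X_def Int_commute)
    have d2: "vec.dim (U 7 \<inter> U 2) \<le> vec.dim X"
      using dimU[of 4 2] d4 by (simp add: edges)
    have X7: "U 7 \<inter> U i = X" if i: "i \<in> {2, 4}" for i
    proof -
      have "X = U 7 \<inter> U i"
      proof (rule vec.subspace_dim_equal[OF subX])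
        show "X \<subseteq> U 7 \<inter> U i"
          using X_eq[of i] i by (auto simp: X_def)
        show "vec.dim (U 7 \<inter> U i) \<le> vec.dim X"
          using i d2 d4 by auto
        show "vec.subspace (U 7 \<inter> U i)"
          by (intro vec.subspace_inter subU)
      qed
      then show ?thesis
        by (rule HOL.sym)
    qed
    \<comment> \<open>\<open>U 7\<close> is the sum of \<open>X\<close>, where \<open>agree1\<close>
      applies, and of \<zeta>-eigenvectors of \<open>F 4\<close>. The latter are
      \<zeta>-eigenvectors of \<open>F 2\<close> as well, because their \<open>U 2\<close>-part lies
      in \<open>U 4\<close> and is orthogonal to them.\<close>
    have agree7: "F 4 x = F 2 x" if x: "x \<in> U 7" for x
    proof -
      obtain e u where eu: "x = e + u" "e \<in> E 4" "e \<in> U 7" "u \<in> U 4" "u \<in> U 7"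
        using split[of 4 "U 7" x] U_comm[of 4 7] subU x by (auto simp: edges)
      obtain e' u' where eu': "e = e' + u'" "e' \<in> E 2" "e' \<in> U 7" "u' \<in> U 2" "u' \<in> U 7"
        using split[of 2 "U 7" e] U_comm[of 2 7] subU eu by (auto simp: edges)
      have "u' \<in> U 4"
        using X7 eu'(4,5) by blast
      then have "cinner u' e = 0" "cinner u' e' = 0"
        using UE eu eu' by blast+
      then have "u' = 0"
        by (simp add: eu'(1) cinner_simps)
      then have "F 4 e = F 2 e"
        using eu eu' by (simp add: E_def)
      moreover have "u \<in> U 1"
        using X7 X_eq[of 4] eu by blast
      then have "F 4 u = F 2 u"
        by (rule agree1) auto
      ultimately show ?thesis
        using fu[of 4] fu[of 2] by (simp add: eu(1) finite_unitary_add)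
    qed
    \<comment> \<open>\<open>F 3\<close> commutes with \<open>F 2\<close>, so on \<open>U 7\<close>
      it commutes with \<open>F 4\<close>; the braid relation makes the two equal there.\<close>
    have F3: "F 3 x = F 4 x" if x: "x \<in> U 7" for x
    proof (rule braid_commute_eq[of _ _ "U 7", OF _ _ _ _ _ x])
      show "\<forall>x\<in>U 7. F 3 (F 4 x) = F 4 (F 3 x)"
      proof
        fix x assume x: "x \<in> U 7"
        then have "F 3 x \<in> U 7"
          using U_comm[of 3 7] by (auto simp: edges)
        then show "F 3 (F 4 x) = F 4 (F 3 x)"
          using C[of 3 2 x] x by (simp add: agree7 edges)
      qed
    qed (use fu U_comm[of 3 7] braid[of 3 4] in \<open>auto simp: edges\<close>)
    have "X = UNIV"
    proof (rule irred[OF subX _ X0])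
      fix i :: nat assume "i \<in> {1..7}"
      \<comment> \<open>Vertices 1, 2, 4, 5, 7 are adjacent neither to 1 nor to 7; vertex 6 is
        adjacent neither to 1 nor to 2, and \<open>X = U 1 \<inter> U 2\<close>; on
        \<open>U 7\<close> the operator \<open>F 3\<close> is \<open>F 4\<close>.\<close>
      then consider "i \<in> {1,2,4,5,7}" | "i = 6" | "i = 3"
        by fastforce
      then show "F i ` X \<subseteq> X"
      proof cases
        case 1
        then have "F i ` U 1 \<subseteq> U 1" "F i ` U 7 \<subseteq> U 7"
          by (intro U_comm; auto simp: edges)+
        then show ?thesis
          by (auto simp: X_def)
      next
        case 2
        have "F 6 ` U 1 \<subseteq> U 1" "F 6 ` U 2 \<subseteq> U 2"
          by (rule U_comm; simp add: edges)+
        then show ?thesis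
          using X_eq[of 2] 2 by auto
      next
        case 3
        have "F 4 ` U 1 \<subseteq> U 1" "F 4 ` U 7 \<subseteq> U 7"
          by (rule U_comm; simp add: edges)+
        then show ?thesis
          using 3 F3 by (auto simp: X_def)
      qed
    qed
    then have "U 1 = UNIV"
      by (auto simp: X_def)
    moreover obtain e where "e \<in> B"
      using B(4) by fastforce
    ultimately have "cinner e e = 0"
      using UE(1)[of e 1 e] B(1) by (auto simp: E_def)
    then show False
      using B(2) \<open>e \<in> B\<close> by (auto simp: orth_system_def)
  qed
  define orth where "orth i j \<longleftrightarrow> (\<forall>x\<in>U i. \<forall>y\<in>U j. cinner x y = 0)" for i j
  \<comment> \<open>With \<open>X = {0}\<close> a vector of \<open>U 1\<close> has no
    \<open>U i\<close>-part, that is, \<open>U 1\<close> lies in \<open>E i\<close>.\<close>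
  have O1: "orth 1 i" if i: "i \<in> {2,4,5,6,7}" for i
    unfolding orth_def
  proof (intro ballI)
    fix x y assume xy: "x \<in> U 1" "y \<in> U i"
    have i7: "i \<in> {1..7}" "{i, 1} \<notin> E7_edges"
      using i by (auto simp: edges)
    obtain e u where "x = e + u" "e \<in> E i" "u \<in> U 1" "u \<in> U i"
      using split[OF i7(1) subU U_comm[OF i7(1) _ i7(2)] xy(1)] by auto
    moreover have "u = 0"
      using X_eq[OF i] \<open>X = {0}\<close> calculation by blast
    ultimately show "cinner x y = 0"
      using UE xy by auto
  qed
  have orth_sym: "orth i j \<Longrightarrow> orth j i" for i j
    unfolding orth_def by (metis cinner_eq_zero_commute)
  \<comment> \<open>Conjugation moves \<open>i\<close> to \<open>j\<close> and preserves
    \<open>U l\<close>, as neither vertex is adjacent to \<open>l\<close>. In this way the pair 1, 7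
    reaches 2, 7 and 5, 7, and then 5, 2; with \<open>O1\<close> these are all pairs among 1, 2, 5,
    7.\<close>
  have orth_step: "orth j l" if O: "orth i l" and ij: "i \<in> {1..7}" "j \<in> {1..7}" "i \<noteq> j" "{i, j} \<in> E7_edges"
    and l: "l \<in> {1..7}" "{i, l} \<notin> E7_edges" "{j, l} \<notin> E7_edges" for i j l
    unfolding orth_def
  proof (intro ballI)
    fix x y assume xy: "x \<in> U j" "y \<in> U l"
    obtain x' y' where x': "F i (F j x') = x" "F i (F j y') = y"
      using surj[OF ij(1,2), of x] surj[OF ij(1,2), of y] by blast
    have "x' \<in> U i"
      using U_iff[OF ij, of x'] xy x' by simp
    moreover have "y' \<in> U l"
      using finite_unitary_mem_iff[OF fu[OF ij(1)] U_comm[OF ij(1) l(1,2)], of "F j y'"]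
        finite_unitary_mem_iff[OF fu[OF ij(2)] U_comm[OF ij(2) l(1,3)], of y'] xy x' by simp
    ultimately have "cinner x' y' = 0"
      using O by (auto simp: orth_def)
    then show "cinner x y = 0"
      using finite_unitary_cinner[OF fu[OF ij(1)], of "F j x'" "F j y'"]
        finite_unitary_cinner[OF fu[OF ij(2)], of x' y'] by (simp add: x')
  qed
  have O37: "orth 3 7" using orth_step[OF O1[of 7], of 3] by (simp add: edges)
  have O47: "orth 4 7" using orth_step[OF O37, of 4] by (simp add: edges)
  have O27: "orth 2 7" using orth_step[OF O47, of 2] by (simp add: edges)
  have O57: "orth 5 7" using orth_step[OF O47, of 5] by (simp add: edges)
  have O62: "orth 6 2" using orth_step[OF orth_sym[OF O27], of 6] by (simp add: edges)
  have O52: "orth 5 2" using orth_step[OF O62, of 5] by (simp add: edges)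
  have rank1: "orth_rank_le (U 1) 1"
  proof (rule ccontr)
    assume "\<not> orth_rank_le (U 1) 1"
    then have P1: "\<exists>p q. p \<in> U 1 \<and> q \<in> U 1 \<and> p \<noteq> 0 \<and> q \<noteq> 0 \<and> cinner p q = 0"
      by (rule not_orth_rank_le_1) blast
    have P: "\<exists>p q. p \<in> U l \<and> q \<in> U l \<and> p \<noteq> 0 \<and> q \<noteq> 0 \<and> cinner p q = 0" if l: "l \<in> {1..7}" for l
    proof (rule E7_connected[of "\<lambda>l. \<exists>p q. p \<in> U l \<and> q \<in> U l \<and> p \<noteq> 0 \<and> q \<noteq> 0 \<and> cinner p q = 0" l, OF P1 _ l])
      fix i j assume ij: "i \<in> {1..7}" "j \<in> {1..7}" "i \<noteq> j" "{i, j} \<in> E7_edges"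
      assume "\<exists>p q. p \<in> U i \<and> q \<in> U i \<and> p \<noteq> 0 \<and> q \<noteq> 0 \<and> cinner p q = 0"
      then obtain p q where "p \<in> U i" "q \<in> U i" "p \<noteq> 0" "q \<noteq> 0" "cinner p q = 0"
        by blast
      then show "\<exists>p q. p \<in> U j \<and> q \<in> U j \<and> p \<noteq> 0 \<and> q \<noteq> 0 \<and> cinner p q = 0"
        using U_iff[OF ij] fu ij
        by (intro exI[of _ "F i (F j p)"] exI[of _ "F i (F j q)"])
          (simp add: finite_unitary_eq_0 finite_unitary_cinner)
    qed
    have Q: "\<exists>A\<subseteq>U l. orth_system A \<and> finite A \<and> card A = 2" if l: "l \<in> {1..7}" for l
    proof -
      obtain p q where pq: "p \<in> U l" "q \<in> U l" "p \<noteq> 0" "q \<noteq> 0" "cinner p q = 0"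
        using P[OF l] by blast
      then have "p \<noteq> q" by auto
      then show ?thesis
        using pq by (intro exI[of _ "{p, q}"]) (auto simp: orth_system_def cinner_eq_zero_commute)
    qed
    obtain A1 where A1: "A1 \<subseteq> U 1" "orth_system A1" "finite A1" "card A1 = 2"
      using Q[of 1] by auto
    obtain A2 where A2: "A2 \<subseteq> U 2" "orth_system A2" "finite A2" "card A2 = 2"
      using Q[of 2] by auto
    obtain A5 where A5: "A5 \<subseteq> U 5" "orth_system A5" "finite A5" "card A5 = 2"
      using Q[of 5] by auto
    obtain A7 where A7: "A7 \<subseteq> U 7" "orth_system A7" "finite A7" "card A7 = 2"
      using Q[of 7] by auto
    have s12: "orth_system (A1 \<union> A2)" "A1 \<inter> A2 = {}"
      by (rule orth_system_Un; use A1 A2 O1[of 2] in \<open>auto simp: orth_def\<close>)+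
    have s57: "orth_system (A5 \<union> A7)" "A5 \<inter> A7 = {}"
      by (rule orth_system_Un; use A5 A7 O57 in \<open>auto simp: orth_def\<close>)+
    have "card (A1 \<union> A2) + card (A5 \<union> A7) \<le> CARD('n)"
    proof (rule orth_card_le[OF s12(1) s57(1)])
      fix x y assume "x \<in> A1 \<union> A2" "y \<in> A5 \<union> A7"
      then show "cinner x y = 0"
        using A1(1) A2(1) A5(1) A7(1) O1[of 5] O1[of 7] O27 orth_sym[OF O52] unfolding orth_def by blast
    qed (use A1 A2 A5 A7 in auto)
    then show False
      using A1 A2 A5 A7 s12 s57 card by (simp add: card_Un_disjoint)
  qed
  have split1: "\<exists>e u. x = e + u \<and> e \<in> E 1 \<and> u \<in> U 1" for x
    using split[of 1 UNIV x] by auto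
  have "U 1 \<noteq> {0}"
  proof
    assume U0: "U 1 = {0}"
    have "x \<in> E 1" for x
      using split1[of x] U0 by auto
    then have scal: "\<forall>x. x \<in> E 1" by blast
    obtain y :: "complex ^ 'n" where y: "y \<noteq> 0"
      using ex_nz by blast
    have "\<forall>x. x \<in> E i" if i: "i \<in> {1..7}" for i
    proof (rule E7_connected[of "\<lambda>i. \<forall>x. x \<in> E i" i, OF scal _ i])
      show "\<forall>x. x \<in> E j" if "i \<in> {1..7}" "j \<in> {1..7}" "i \<noteq> j" "{i, j} \<in> E7_edges" "\<forall>x. x \<in> E i" for i j
        using E_iff[OF that(1-4)] that(5) surj[OF that(1,2)] by metis
    qed
    then show False
      using no_line[OF y] unfolding E_def by blast
  qed
  then obtain u where u: "u \<in> U 1" "u \<noteq> 0"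
    using vec.subspace_0[OF subU[of 1]] by auto
  have "F 1 u \<in> U 1"
    using U_comm[of 1 1] u by (auto simp: edges)
  then obtain \<mu> where \<mu>: "F 1 u = \<mu> *s u"
    using orth_rank_le_1_collinear[OF rank1 subU u] by blast
  \<comment> \<open>As \<zeta> is real, conjugation preserves \<open>E 1\<close> and hence the line
    \<open>U 1\<close>. So \<open>cnj_vec u\<close> is a multiple of \<open>u\<close>, and \<mu> is
    equal to its conjugate.\<close>
  have "cnj \<zeta> = \<zeta>"
    using \<zeta> by (auto simp: square_eq_1_iff)
  then have cnjE: "cnj_vec x \<in> E 1 \<longleftrightarrow> x \<in> E 1" for x
    using real[of 1] by (simp add: E_def) (metis cnj_vec_cnj_vec cnj_vec_scale)
  have "cnj_vec u \<in> U 1"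
    unfolding U_def perp_def
  proof clarify
    fix y assume "y \<in> E 1"
    then have "cinner u (cnj_vec y) = 0"
      using u(1) cnjE UE by blast
    then show "cinner (cnj_vec u) y = 0"
      by (metis cinner_cnj_vec cnj_vec_cnj_vec complex_cnj_zero_iff)
  qed
  then obtain c where c: "cnj_vec u = c *s u"
    using orth_rank_le_1_collinear[OF rank1 subU u] by blast
  have c0: "c \<noteq> 0"
  proof
    assume "c = 0"
    then have "cnj_vec u = 0" using c by simp
    then show False using u by simp
  qed
  have "cnj \<mu> *s cnj_vec u = F 1 (cnj_vec u)"
    by (simp add: real \<mu> cnj_vec_scale)
  also have "\<dots> = \<mu> *s cnj_vec u"
    using finite_unitary_scale[OF fu[of 1]] by (simp add: c \<mu> mult.commute)
  finally have "(cnj \<mu> - \<mu>) *s cnj_vec u = 0"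
    by (simp add: vec.scale_left_diff_distrib)
  then have "cnj \<mu> = \<mu>"
    using u by (simp only: vector_mul_eq_0 cnj_vec_eq_0) simp
  moreover have "\<mu> * cnj \<mu> = 1"
    using finite_unitary_cinner[OF fu[of 1], of u u] u by (simp add: \<mu> cinner_simps mult.commute)
  ultimately have \<mu>1: "\<mu> * \<mu> = 1"
    by simp
  have "\<forall>x. F 1 (F 1 x) = x"
  proof
    fix x
    obtain e w where x: "x = e + w" "e \<in> E 1" "w \<in> U 1"
      using split1 by blast
    obtain d where "w = d *s u"
      using orth_rank_le_1_collinear[OF rank1 subU u x(3)] by blast
    then show "F 1 (F 1 x) = x"
      using x(2) \<zeta> \<mu>1 fu[of 1] unfolding x(1) E_def
      by (simp add: finite_unitary_add finite_unitary_scale \<mu> mult.assoc mult.left_commute)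
  qed
  then have "\<forall>x. F k (F k x) = x"
  proof (rule E7_connected[of "\<lambda>i. \<forall>x. F i (F i x) = x", OF _ _ k])
    show "\<forall>x. F j (F j x) = x"
      if ij: "i \<in> {1..7}" "j \<in> {1..7}" "i \<noteq> j" "{i, j} \<in> E7_edges" and "\<forall>x. F i (F i x) = x" for i j
      using twist[OF ij] surj[OF ij(1,2)] that(5) by metis
  qed
  then show ?thesis by blast
qed

section \<open>Homomorphisms from presented groups\<close>

fun word_eval :: "('b, 'm) monoid_scheme \<Rightarrow> ('a \<Rightarrow> 'b) \<Rightarrow> 'a gword \<Rightarrow> 'b"
  where
    "word_eval H f [] = \<one>\<^bsub>H\<^esub>"
  | "word_eval H f (p # w) = (if snd p then f (fst p) else inv\<^bsub>H\<^esub> f (fst p)) \<otimes>\<^bsub>H\<^esub> word_eval H f w"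

definition word_class :: "'a set \<Rightarrow> ('a gword \<times> 'a gword) set \<Rightarrow> 'a gword \<Rightarrow> 'a gword set"
  where "word_class X R w = pres_rel X R `` {w}"

lemma carrier_presented_groupE:
  assumes "C \<in> carrier (presented_group X R)"
  obtains w where "w \<in> gwords X" "C = word_class X R w"
  using assms by (auto simp: carrier_presented_group word_class_def elim!: quotientE)

lemma word_class_closed: "w \<in> gwords X \<Longrightarrow> word_class X R w \<in> carrier (presented_group X R)"
  by (simp add: carrier_presented_group word_class_def quotientI)

lemma word_class_append:
  "u \<in> gwords X \<Longrightarrow> v \<in> gwords X \<Longrightarrow>
    word_class X R (u @ v) = word_class X R u \<otimes>\<^bsub>presented_group X R\<^esub> word_class X R v"
  by (simp add: word_class_def mult_presented_group)

lemma word_class_Nil: "word_class X R [] = \<one>\<^bsub>presented_group X R\<^esub>"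
  by (simp add: word_class_def one_presented_group)

lemma word_class_eq_iff:
  assumes "v \<in> gwords X"
  shows "word_class X R u = word_class X R v \<longleftrightarrow> (u, v) \<in> pres_rel X R"
  using eq_equiv_class[OF _ equiv_pres_rel assms] equiv_class_eq[OF equiv_pres_rel]
  unfolding word_class_def by blast

lemma word_class_relation:
  assumes "(u, v) \<in> R" "u \<in> gwords X" "v \<in> gwords X"
  shows "word_class X R u = word_class X R v"
  using pres_rel.rel[OF assms, of "[]" "[]"] assms by (simp add: word_class_eq_iff)

lemma word_class_gen: "word_class X R [(x, True)] = pres_gen X R x"
  by (simp add: word_class_def pres_gen_def)

lemma pres_gen_closed: "x \<in> X \<Longrightarrow> pres_gen X R x \<in> carrier (presented_group X R)"
  by (simp flip: word_class_gen add: word_class_closed)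

lemma word_class_inv:
  assumes "x \<in> X"
  shows "word_class X R [(x, False)] = inv\<^bsub>presented_group X R\<^esub> pres_gen X R x"
proof -
  interpret P: group "presented_group X R" by (rule group_presented_group)
  have "([(x, False), (x, True)], []) \<in> pres_rel X R"
    using pres_rel.cancel[of "[]" X "[]" x False R] assms by simp
  then have "word_class X R ([(x, False)] @ [(x, True)]) = word_class X R []"
    by (simp add: word_class_eq_iff)
  then have "word_class X R [(x, False)] \<otimes>\<^bsub>presented_group X R\<^esub> pres_gen X R x = \<one>\<^bsub>presented_group X R\<^esub>"
    using assms by (simp add: word_class_append word_class_Nil word_class_gen del: append.simps)
  then show ?thesis
    using assms by (intro P.inv_equality[symmetric] word_class_closed pres_gen_closed) auto
qed

section \<open>The universal property of a presented group\<close>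

context group
begin

lemma word_eval_closed:
  "f ` X \<subseteq> carrier G \<Longrightarrow> w \<in> gwords X \<Longrightarrow> word_eval G f w \<in> carrier G"
  by (induction w) auto

lemma word_eval_append:
  assumes "f ` X \<subseteq> carrier G" "u \<in> gwords X" "v \<in> gwords X"
  shows "word_eval G f (u @ v) = word_eval G f u \<otimes> word_eval G f v"
  using assms(2)
proof (induction u)
  case Nil
  then show ?case using word_eval_closed[OF assms(1,3)] by simp
next
  case (Cons p u)
  then have "f (fst p) \<in> carrier G" "word_eval G f u \<in> carrier G"
    using assms(1) word_eval_closed[OF assms(1)] by auto
  then show ?case
    using Cons word_eval_closed[OF assms(1,3)] by (simp add: m_assoc)
qed

lemma word_eval_pres_rel:
  assumes f: "f ` X \<subseteq> carrier G"
    and R: "\<And>u v. (u, v) \<in> R \<Longrightarrow> u \<in> gwords X \<Longrightarrow> v \<in> gwords X \<Longrightarrow> word_eval G f u = word_eval G f v"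
    and "(u, v) \<in> pres_rel X R"
  shows "word_eval G f u = word_eval G f v"
  using assms(3)
proof (induction rule: pres_rel.induct)
  case (cancel u v x b)
  then have x: "f x \<in> carrier G"
    using f by auto
  have "word_eval G f [(x, b), (x, \<not> b)] = \<one>"
    using x by simp
  moreover have "word_eval G f (u @ [(x, b), (x, \<not> b)] @ v)
      = word_eval G f u \<otimes> (word_eval G f [(x, b), (x, \<not> b)] \<otimes> word_eval G f v)"
  proof -
    have "[(x, b), (x, \<not> b)] \<in> gwords X" "[(x, b), (x, \<not> b)] @ v \<in> gwords X"
      using cancel by auto
    then show ?thesis
      using cancel word_eval_append[OF f] by metis
  qed
  ultimately show ?case
    using cancel word_eval_closed[OF f] word_eval_append[OF f] by simp
next
  case (rel r s u v)
  then have "r @ v \<in> gwords X" "s @ v \<in> gwords X"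
    by auto
  then show ?case
    using rel word_eval_append[OF f] R by simp
qed auto

text \<open>The induced homomorphism. The value does not depend on the chosen representative once
  the family \<open>f\<close> satisfies the relations.\<close>

definition pres_lift :: "'x set \<Rightarrow> ('x gword \<times> 'x gword) set \<Rightarrow> ('x \<Rightarrow> 'a) \<Rightarrow> 'x gword set \<Rightarrow> 'a"
  where "pres_lift X R f = (\<lambda>C\<in>carrier (presented_group X R). word_eval G f (SOME w. w \<in> C))"

lemma pres_lift_word_class:
  assumes f: "f ` X \<subseteq> carrier G"
    and R: "\<And>u v. (u, v) \<in> R \<Longrightarrow> u \<in> gwords X \<Longrightarrow> v \<in> gwords X \<Longrightarrow> word_eval G f u = word_eval G f v"
    and w: "w \<in> gwords X"
  shows "pres_lift X R f (word_class X R w) = word_eval G f w"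
proof -
  have "w \<in> word_class X R w"
    using w by (simp add: word_class_def pres_rel.refl)
  then have "(SOME v. v \<in> word_class X R w) \<in> word_class X R w"
    by (rule someI)
  then have "(w, SOME v. v \<in> word_class X R w) \<in> pres_rel X R"
    by (simp add: word_class_def)
  then show ?thesis
    using word_eval_pres_rel[OF f R] w by (simp add: pres_lift_def word_class_closed)
qed

lemma pres_lift_hom:
  assumes f: "f ` X \<subseteq> carrier G"
    and R: "\<And>u v. (u, v) \<in> R \<Longrightarrow> u \<in> gwords X \<Longrightarrow> v \<in> gwords X \<Longrightarrow> word_eval G f u = word_eval G f v"
  shows "pres_lift X R f \<in> hom (presented_group X R) G"
proof (rule homI)
  note lift = pres_lift_word_class[OF f R]
  fix C D
  assume C: "C \<in> carrier (presented_group X R)" and D: "D \<in> carrier (presented_group X R)"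
  obtain u where u: "u \<in> gwords X" "C = word_class X R u"
    using C by (rule carrier_presented_groupE)
  obtain v where v: "v \<in> gwords X" "D = word_class X R v"
    using D by (rule carrier_presented_groupE)
  show "pres_lift X R f C \<in> carrier G"
    using u word_eval_closed[OF f] by (simp add: lift)
  have "u @ v \<in> gwords X"
    using u v by simp
  then show "pres_lift X R f (C \<otimes>\<^bsub>presented_group X R\<^esub> D) = pres_lift X R f C \<otimes> pres_lift X R f D"
    using u v word_eval_append[OF f] by (simp add: lift flip: word_class_append)
qed

lemma pres_lift_gen:
  assumes f: "f ` X \<subseteq> carrier G"
    and R: "\<And>u v. (u, v) \<in> R \<Longrightarrow> u \<in> gwords X \<Longrightarrow> v \<in> gwords X \<Longrightarrow> word_eval G f u = word_eval G f v"
    and x: "x \<in> X"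
  shows "pres_lift X R f (pres_gen X R x) = f x"
proof -
  have "f x \<in> carrier G"
    using f x by auto
  then show ?thesis
    using pres_lift_word_class[OF f R, where w = "[(x, True)]"] x by (simp add: word_class_gen)
qed

lemma hom_presented_eq:
  assumes \<phi>: "\<phi> \<in> hom (presented_group X R) G" and w: "w \<in> gwords X"
  shows "\<phi> (word_class X R w) = word_eval G (\<lambda>x. \<phi> (pres_gen X R x)) w"
proof -
  interpret P: group "presented_group X R" by (rule group_presented_group)
  interpret h: group_hom "presented_group X R" G \<phi>
    by (unfold_locales) (rule \<phi>)
  show ?thesis
    using w
  proof (induction w)
    case Nil
    then show ?case by (simp add: word_class_Nil)
  next
    case (Cons p w)
    obtain x b where p: "p = (x, b)" by (cases p)
    have x: "x \<in> X" "w \<in> gwords X" "[(x, b)] \<in> gwords X"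
      using Cons.hyps p by auto
    have "word_class X R (p # w) = word_class X R [(x, b)] \<otimes>\<^bsub>presented_group X R\<^esub> word_class X R w"
      using word_class_append[OF x(3,2), of R] p by simp
    moreover have "word_class X R [(x, b)] = (if b then pres_gen X R x else inv\<^bsub>presented_group X R\<^esub> pres_gen X R x)"
      using x by (simp add: word_class_gen word_class_inv)
    ultimately show ?case
      using x Cons.IH p by (simp add: pres_gen_closed word_class_closed)
  qed
qed

end

lemma presented_group_hom_eqI:
  assumes "group H" "\<phi> \<in> hom (presented_group X R) H" "\<psi> \<in> hom (presented_group X R) H"
    and "\<And>x. x \<in> X \<Longrightarrow> \<phi> (pres_gen X R x) = \<psi> (pres_gen X R x)"
    and C: "C \<in> carrier (presented_group X R)"
  shows "\<phi> C = \<psi> C"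
proof -
  obtain w where w: "w \<in> gwords X" "C = word_class X R w"
    using C by (rule carrier_presented_groupE)
  have "word_eval H (\<lambda>x. \<phi> (pres_gen X R x)) w = word_eval H (\<lambda>x. \<psi> (pres_gen X R x)) w"
    using w(1) by (induction w) (auto simp: assms(4))
  then show ?thesis
    using group.hom_presented_eq[OF assms(1)] assms(2,3) w by metis
qed

section \<open>The reflection representation\<close>

lemma cinner_axis: "cinner x (axis k c) = x $ k * cnj c"
proof -
  have "cinner x (axis k c) = (\<Sum>i\<in>UNIV. if i = k then x $ k * cnj c else 0)"
    unfolding cinner_def by (intro sum.cong) (auto simp: axis_def)
  then show ?thesis by simp
qed

text \<open>The roots are the vectors of norm \<open>4\<close> in the integral lattice whose reduction modulo \<open>2\<close>
  is the \<open>[7,3]\<close> simplex code: \<open>\<plusminus>2e\<^sub>k\<close> and \<open>\<plusminus>e\<^sub>a \<plusminus> e\<^sub>b \<plusminus> e\<^sub>c \<plusminus> e\<^sub>d\<close> for the complements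
  \<open>abcd\<close> of the lines of the Fano plane. So the coordinates are orthonormal and integral.\<close>

definition simple_root :: "nat \<Rightarrow> complex ^ 7"
  where "simple_root i =
    (if i = 1 then axis 6 1 - axis 2 1 - axis 4 1 - axis 5 1
     else if i = 2 then axis 0 2
     else if i = 3 then axis 2 2
     else if i = 4 then axis 4 1 - axis 0 1 - axis 2 1 - axis 3 1
     else if i = 5 then axis 3 2
     else if i = 6 then axis 5 1 - axis 1 1 - axis 3 1 - axis 4 1
     else axis 1 2)"

lemma simple_root_simps:
  "simple_root 1 = axis 6 1 - axis 2 1 - axis 4 1 - axis 5 1"
  "simple_root 2 = axis 0 2"
  "simple_root 3 = axis 2 2"
  "simple_root 4 = axis 4 1 - axis 0 1 - axis 2 1 - axis 3 1"
  "simple_root 5 = axis 3 2"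
  "simple_root 6 = axis 5 1 - axis 1 1 - axis 3 1 - axis 4 1"
  "simple_root 7 = axis 1 2"
  by (simp_all add: simple_root_def)

lemma vertex_cases:
  assumes "i \<in> {1..7 :: nat}"
  shows "i = 1 \<or> i = 2 \<or> i = 3 \<or> i = 4 \<or> i = 5 \<or> i = 6 \<or> i = 7"
  using assms by auto

lemma index_7_neq:
  "(0 :: 7) \<noteq> 1" "(0 :: 7) \<noteq> 2" "(0 :: 7) \<noteq> 3" "(0 :: 7) \<noteq> 4" "(0 :: 7) \<noteq> 5" "(0 :: 7) \<noteq> 6"
  "(1 :: 7) \<noteq> 2" "(1 :: 7) \<noteq> 3" "(1 :: 7) \<noteq> 4" "(1 :: 7) \<noteq> 5" "(1 :: 7) \<noteq> 6"
  "(2 :: 7) \<noteq> 3" "(2 :: 7) \<noteq> 4" "(2 :: 7) \<noteq> 5" "(2 :: 7) \<noteq> 6"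
  "(3 :: 7) \<noteq> 4" "(3 :: 7) \<noteq> 5" "(3 :: 7) \<noteq> 6"
  "(4 :: 7) \<noteq> 5" "(4 :: 7) \<noteq> 6" "(5 :: 7) \<noteq> 6"
  by simp_all

lemma axis_nth_7:
  "axis k c $ k = c" "j \<noteq> k \<Longrightarrow> axis k c $ j = 0" "k \<noteq> j \<Longrightarrow> axis k c $ j = (0 :: complex)" for j k :: 7
  by (simp_all add: axis_def)

lemma cinner_simple_root:
  assumes "i \<in> {1..7}" "j \<in> {1..7}"
  shows "cinner (simple_root i) (simple_root j) = (if i = j then 4 else if {i, j} \<in> E7_edges then -2 else 0)"
  using vertex_cases[OF assms(1)] vertex_cases[OF assms(2)]
  by (elim disjE; simp add: simple_root_simps cinner_simps cinner_axis axis_nth_7 index_7_neq E7_edges_def doubleton_eq_iff)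

lemma UNIV_7: "(UNIV :: 7 set) = {0, 1, 2, 3, 4, 5, 6}"
proof (rule HOL.sym, rule card_subset_eq)
  show "card {0, 1, 2, 3, 4, 5, 6 :: 7} = card (UNIV :: 7 set)"
    by simp
qed auto

lemma all_7: "(\<forall>k :: 7. P k) \<longleftrightarrow> P 0 \<and> P 1 \<and> P 2 \<and> P 3 \<and> P 4 \<and> P 5 \<and> P 6"
proof -
  have "(\<forall>k :: 7. P k) \<longleftrightarrow> (\<forall>k\<in>{0, 1, 2, 3, 4, 5, 6}. P k)"
    by (simp flip: UNIV_7)
  then show ?thesis by simp
qed

text \<open>The roots form a triangular system: 2, 7, 3, 5 are doubled unit vectors, and 4, 6, 1, in
  this order, each bring in one new coordinate.\<close>

lemma axis_in_span:
  "axis k 1 \<in> vec.span (simple_root ` {1..7})"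
proof -
  let ?S = "vec.span (simple_root ` {1..7})"
  have r: "c *s simple_root i \<in> ?S" if "i \<in> {1..7}" for i c
    using that by (intro vec.span_scale vec.span_base) auto
  have half: "axis k 1 = (1/2) *s (axis k 2 :: complex ^ 7)" for k
    by (simp add: vec_eq_iff axis_def)
  have e0: "axis 0 1 \<in> ?S" using r[of 2 "1/2"] by (simp add: half[of 0] simple_root_simps)
  have e1: "axis 1 1 \<in> ?S" using r[of 7 "1/2"] by (simp add: half[of 1] simple_root_simps)
  have e2: "axis 2 1 \<in> ?S" using r[of 3 "1/2"] by (simp add: half[of 2] simple_root_simps)
  have e3: "axis 3 1 \<in> ?S" using r[of 5 "1/2"] by (simp add: half[of 3] simple_root_simps)
  have "simple_root 4 + axis 0 1 + axis 2 1 + axis 3 1 \<in> ?S"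
    using r[of 4 1] by (intro vec.span_add e0 e2 e3) simp
  then have e4: "axis 4 1 \<in> ?S" by (simp add: simple_root_simps)
  have "simple_root 6 + axis 1 1 + axis 3 1 + axis 4 1 \<in> ?S"
    using r[of 6 1] by (intro vec.span_add e1 e3 e4) simp
  then have e5: "axis 5 1 \<in> ?S" by (simp add: simple_root_simps)
  have "simple_root 1 + axis 2 1 + axis 4 1 + axis 5 1 \<in> ?S"
    using r[of 1 1] by (intro vec.span_add e2 e4 e5) simp
  then have e6: "axis 6 1 \<in> ?S" by (simp add: simple_root_simps)
  have "\<forall>k. axis k 1 \<in> ?S"
    unfolding all_7 using e0 e1 e2 e3 e4 e5 e6 by blast
  then show ?thesis by blast
qed

lemma span_simple_root: "vec.span (simple_root ` {1..7}) = UNIV"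
proof -
  have "x \<in> vec.span (simple_root ` {1..7})" for x
  proof -
    have "x = (\<Sum>k\<in>UNIV. x $ k *s axis k 1)"
      by (simp add: basis_expansion)
    also have "\<dots> \<in> vec.span (simple_root ` {1..7})"
      by (intro vec.span_sum vec.span_scale axis_in_span)
    finally show ?thesis .
  qed
  then show ?thesis by blast
qed

text \<open>The roots have norm 4, so the usual factor 2/4 becomes 1/2.\<close>

definition reflection :: "nat \<Rightarrow> complex ^ 7 \<Rightarrow> complex ^ 7"
  where "reflection i x = x - (cinner x (simple_root i) / 2) *s simple_root i"

lemma reflection_reflection: "i \<in> {1..7} \<Longrightarrow> reflection i (reflection i x) = x"
  by (simp add: reflection_def cinner_simps cinner_simple_root vec_eq_iff)

lemma reflection_braid:
  assumes "i \<in> {1..7}" "j \<in> {1..7}" "i \<noteq> j" "{i, j} \<in> E7_edges"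
  shows "reflection i (reflection j (reflection i x)) = reflection j (reflection i (reflection j x))"
  using assms(3,4)
  by (simp add: reflection_def cinner_simps cinner_simple_root[OF assms(1,1)] cinner_simple_root[OF assms(1,2)]
      cinner_simple_root[OF assms(2,1)] cinner_simple_root[OF assms(2,2)] insert_commute vec_eq_iff)
    (simp add: field_simps)

lemma reflection_comm:
  assumes "i \<in> {1..7}" "j \<in> {1..7}" "i \<noteq> j" "{i, j} \<notin> E7_edges"
  shows "reflection i (reflection j x) = reflection j (reflection i x)"
  using assms(3,4)
  by (simp add: reflection_def cinner_simps cinner_simple_root[OF assms(1,2)]
      cinner_simple_root[OF assms(2,1)] insert_commute)

lemma reflection_simple_root:
  assumes "i \<in> {1..7}" "j \<in> {1..7}"
  shows "reflection i (simple_root j) = (if i = j then - simple_root i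
    else if {i, j} \<in> E7_edges then simple_root j + simple_root i else simple_root j)"
  using cinner_simple_root[OF assms(2,1)]
  by (auto simp: reflection_def insert_commute vec_eq_iff)

lemma finite_unitary_reflection:
  assumes "i \<in> {1..7}"
  shows "finite_unitary (reflection i)"
  unfolding finite_unitary_def
proof (intro conjI allI)
  show "Vector_Spaces.linear (*s) (*s) (reflection i)"
    unfolding Vector_Spaces.linear_iff
    by (intro conjI allI vec.vector_space_axioms) (simp_all add: reflection_def cinner_simps vec_eq_iff field_simps)
  have "cnj (cinner y (simple_root i)) = cinner (simple_root i) y" for y
    by (rule cinner_commute[symmetric])
  then show "cinner (reflection i x) (reflection i y) = cinner x y" for x y
    using assms by (simp add: reflection_def cinner_simps cinner_simple_root)
  have "reflection i ^^ 2 = id"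
    using reflection_reflection[OF assms] by (auto simp: numeral_2_eq_2)
  then show "\<exists>n>0. reflection i ^^ n = id"
    by (intro exI[of _ 2]) simp
qed

lemma cnj_vec_simple_root: "cnj_vec (simple_root i) = simple_root i"
  by (auto simp: simple_root_def cnj_vec_def vec_eq_iff axis_def)

lemma cnj_vec_diff: "cnj_vec (x - y) = cnj_vec x - cnj_vec y"
  by (simp add: cnj_vec_def vec_eq_iff)

lemma reflection_cnj_vec: "reflection i (cnj_vec x) = cnj_vec (reflection i x)"
  using cinner_cnj_vec[of x "simple_root i"]
  by (simp add: reflection_def cnj_vec_diff cnj_vec_scale cnj_vec_simple_root)

section \<open>Words in the Coxeter group\<close>

definition pos_word :: "nat list \<Rightarrow> nat gword"
  where "pos_word is = map (\<lambda>i. (i, True)) is"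

definition W_word :: "nat list \<Rightarrow> nat gword set"
  where "W_word is = word_class E7_vertices coxeter_relations (pos_word is)"

lemma group_A_E7: "group A_E7"
  by (simp add: A_E7_def group_presented_group)

interpretation W: group W_E7
  by (simp add: W_E7_def group_presented_group)

lemma pos_word_in: "set is \<subseteq> {1..7} \<Longrightarrow> pos_word is \<in> gwords E7_vertices"
  by (auto simp: pos_word_def E7_vertices_def)

lemma W_word_closed: "set is \<subseteq> {1..7} \<Longrightarrow> W_word is \<in> carrier W_E7"
  by (simp add: W_word_def W_E7_def word_class_closed pos_word_in)

lemma W_word_append:
  "set is \<subseteq> {1..7} \<Longrightarrow> set js \<subseteq> {1..7} \<Longrightarrow> W_word (is @ js) = W_word is \<otimes>\<^bsub>W_E7\<^esub> W_word js"
  using word_class_append[OF pos_word_in pos_word_in, of "is" js]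
  by (simp add: W_word_def W_E7_def pos_word_def)

lemma W_word_Nil: "W_word [] = \<one>\<^bsub>W_E7\<^esub>"
  by (simp add: W_word_def W_E7_def pos_word_def word_class_Nil)

lemma W_word_single: "W_word [i] = s i"
  by (simp add: W_word_def pos_word_def word_class_gen s_def)

lemma s_closed: "i \<in> {1..7} \<Longrightarrow> s i \<in> carrier W_E7"
  using W_word_closed[of "[i]"] by (simp add: W_word_single)

lemma W_word_Cons: "i \<in> {1..7} \<Longrightarrow> set is \<subseteq> {1..7} \<Longrightarrow> W_word (i # is) = s i \<otimes>\<^bsub>W_E7\<^esub> W_word is"
  using W_word_append[of "[i]" "is"] by (simp add: W_word_single)

lemma W_word_foldr:
  "set is \<subseteq> {1..7} \<Longrightarrow> foldr (\<lambda>i x. s i \<otimes>\<^bsub>W_E7\<^esub> x) is \<one>\<^bsub>W_E7\<^esub> = W_word is"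
  by (induction "is") (simp_all add: W_word_Nil W_word_Cons)

lemma coxeter_word_eq:
  assumes "(pos_word is, pos_word js) \<in> coxeter_relations" "set is \<subseteq> {1..7}" "set js \<subseteq> {1..7}"
  shows "W_word is = W_word js"
  unfolding W_word_def by (intro word_class_relation assms pos_word_in)

lemma s_s: "i \<in> {1..7} \<Longrightarrow> s i \<otimes>\<^bsub>W_E7\<^esub> s i = \<one>\<^bsub>W_E7\<^esub>"
  using coxeter_word_eq[of "[i, i]" "[]"]
  by (simp add: coxeter_relations_def pos_word_def E7_vertices_def W_word_Cons W_word_Nil s_closed)

lemma s_braid:
  assumes "i \<in> {1..7}" "j \<in> {1..7}" "i \<noteq> j" "{i, j} \<in> E7_edges"
  shows "s i \<otimes>\<^bsub>W_E7\<^esub> (s j \<otimes>\<^bsub>W_E7\<^esub> s i) = s j \<otimes>\<^bsub>W_E7\<^esub> (s i \<otimes>\<^bsub>W_E7\<^esub> s j)"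
  using coxeter_word_eq[of "[i, j, i]" "[j, i, j]"] assms
  by (auto simp: coxeter_relations_def artin_relations_def pos_word_def E7_vertices_def
      W_word_Cons W_word_Nil s_closed)

lemma s_comm:
  assumes "i \<in> {1..7}" "j \<in> {1..7}" "i \<noteq> j" "{i, j} \<notin> E7_edges"
  shows "s i \<otimes>\<^bsub>W_E7\<^esub> s j = s j \<otimes>\<^bsub>W_E7\<^esub> s i"
  using coxeter_word_eq[of "[i, j]" "[j, i]"] assms
  by (auto simp: coxeter_relations_def artin_relations_def pos_word_def E7_vertices_def
      W_word_Cons W_word_Nil s_closed)

text \<open>Each generator is its own inverse, so formal inverses can be replaced by positive
  letters.\<close>

lemma W_word_exists:
  assumes "w \<in> carrier W_E7"
  obtains "is" where "set is \<subseteq> {1..7}" "w = W_word is"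
proof -
  obtain u where u: "u \<in> gwords E7_vertices" "w = word_class E7_vertices coxeter_relations u"
    using assms unfolding W_E7_def by (rule carrier_presented_groupE)
  have "\<exists>is. set is \<subseteq> {1..7} \<and> word_class E7_vertices coxeter_relations u = W_word is"
    using u(1)
  proof (induction u)
    case Nil
    then show ?case
      by (intro exI[of _ "[]"]) (simp add: W_word_def pos_word_def)
  next
    case (Cons p u)
    obtain i b where p: "p = (i, b)" "i \<in> {1..7}"
      using Cons.hyps by (cases p) (auto simp: E7_vertices_def)
    then have i: "i \<in> E7_vertices"
      by (simp add: E7_vertices_def)
    obtain "is" where is': "set is \<subseteq> {1..7}" "word_class E7_vertices coxeter_relations u = W_word is"
      using Cons.IH by blast
    have "inv\<^bsub>W_E7\<^esub> s i = s i"
      using s_s[OF p(2)] s_closed[OF p(2)] by (intro W.inv_equality)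
    then have "word_class E7_vertices coxeter_relations [(i, b)] = s i"
      using word_class_inv[OF i, of coxeter_relations]
      by (cases b) (simp_all add: word_class_gen s_def W_E7_def)
    moreover have "word_class E7_vertices coxeter_relations (p # u)
        = word_class E7_vertices coxeter_relations [(i, b)] \<otimes>\<^bsub>W_E7\<^esub> word_class E7_vertices coxeter_relations u"
      using word_class_append[of "[(i, b)]" E7_vertices u coxeter_relations] i p Cons.hyps by (simp add: W_E7_def)
    ultimately have "word_class E7_vertices coxeter_relations (p # u) = W_word (i # is)"
      using is' p(2) by (simp add: W_word_Cons)
    then show ?case
      using is' p(2) by (intro exI[of _ "i # is"]) simp
  qed
  then show thesis
    using that u by blast
qed

text \<open>Each relation changes the length by an even number. This yields the sign character of W
  directly from the presentation.\<close>

lemma coxeter_even_length: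
  assumes "(u, v) \<in> pres_rel E7_vertices coxeter_relations"
  shows "even (length u) = even (length v)"
  using assms
  by (induction rule: pres_rel.induct) (auto simp: coxeter_relations_def artin_relations_def)

lemma W_word_parity:
  assumes "set is \<subseteq> {1..7}" "set js \<subseteq> {1..7}" "W_word is = W_word js"
  shows "even (length is) = even (length js)"
  using coxeter_even_length[of "pos_word is" "pos_word js"] assms
  by (simp add: W_word_def word_class_eq_iff pos_word_in) (simp add: pos_word_def)

section \<open>The representation of the Coxeter group\<close>

text \<open>The group of all bijections suffices as the target of the universal property; linearity
  of the operators is obtained from words in the reflections.\<close>

abbreviation GL7 :: "(complex ^ 7 \<Rightarrow> complex ^ 7) monoid"
  where "GL7 \<equiv> BijGroup UNIV"

lemma finite_unitary_bij: "finite_unitary f \<Longrightarrow> bij f"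
  by (metis bijI finite_unitary_eq finite_unitary_inverse_power injI surjI)

lemma carrier_GL7: "f \<in> carrier GL7 \<longleftrightarrow> bij f"
  by (simp add: BijGroup_def Bij_def)

lemma mult_GL7: "bij f \<Longrightarrow> bij g \<Longrightarrow> f \<otimes>\<^bsub>GL7\<^esub> g = f \<circ> g"
  by (auto simp: BijGroup_def Bij_def compose_def)

lemma one_GL7: "\<one>\<^bsub>GL7\<^esub> = id"
  by (auto simp: BijGroup_def)

lemma reflection_bij: "i \<in> {1..7} \<Longrightarrow> bij (reflection i)"
  by (intro finite_unitary_bij finite_unitary_reflection)

lemma word_eval_pos_word:
  assumes "set is \<subseteq> {1..7}"
  shows "word_eval GL7 reflection (pos_word is) = foldr reflection is \<and> bij (foldr reflection is)"
  using assms
proof (induction "is")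
  case Nil
  then show ?case by (simp add: pos_word_def one_GL7 bij_id[unfolded id_def] id_def)
next
  case (Cons i "is")
  then have "bij (reflection i)" "bij (foldr reflection is)"
    by (simp_all add: reflection_bij)
  then show ?case
    using Cons bij_comp[of "foldr reflection is" "reflection i"]
    by (simp add: pos_word_def mult_GL7 comp_def)
qed

definition rho :: "nat gword set \<Rightarrow> complex ^ 7 \<Rightarrow> complex ^ 7"
  where "rho = group.pres_lift GL7 E7_vertices coxeter_relations reflection"

lemma reflection_carrier: "reflection ` E7_vertices \<subseteq> carrier GL7"
  by (auto simp: E7_vertices_def carrier_GL7 reflection_bij)

lemma reflection_respects:
  assumes "(u, v) \<in> coxeter_relations"
  shows "word_eval GL7 reflection u = word_eval GL7 reflection v"
proof -
  have pos: "word_eval GL7 reflection (pos_word is) = foldr reflection is" if "set is \<subseteq> {1..7}" for "is"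
    using word_eval_pos_word[OF that] by blast
  consider i j where "u = pos_word [i, j, i]" "v = pos_word [j, i, j]"
      "i \<in> {1..7}" "j \<in> {1..7}" "i \<noteq> j" "{i, j} \<in> E7_edges"
    | i j where "u = pos_word [i, j]" "v = pos_word [j, i]"
      "i \<in> {1..7}" "j \<in> {1..7}" "i \<noteq> j" "{i, j} \<notin> E7_edges"
    | i where "u = pos_word [i, i]" "v = pos_word []" "i \<in> {1..7}"
    using assms unfolding coxeter_relations_def artin_relations_def pos_word_def E7_vertices_def
    by auto
  then show ?thesis
  proof cases
    case 1
    then show ?thesis
      using pos[of "[i, j, i]"] pos[of "[j, i, j]"] reflection_braid[of i j] by (simp add: fun_eq_iff)
  next
    case 2
    then show ?thesis
      using pos[of "[i, j]"] pos[of "[j, i]"] reflection_comm[of i j] by (simp add: fun_eq_iff)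
  next
    case 3
    then show ?thesis
      using pos[of "[i, i]"] pos[of "[]"] reflection_reflection[of i] by (simp add: fun_eq_iff)
  qed
qed

interpretation GL7: group GL7
  by (rule group_BijGroup)

lemma rho_hom: "rho \<in> hom W_E7 GL7"
  unfolding rho_def W_E7_def by (intro GL7.pres_lift_hom reflection_carrier reflection_respects)

lemma rho_word: "set is \<subseteq> {1..7} \<Longrightarrow> rho (W_word is) = foldr reflection is"
  unfolding rho_def W_word_def
  using GL7.pres_lift_word_class[OF reflection_carrier reflection_respects pos_word_in] word_eval_pos_word by simp

lemma rho_mult: "v \<in> carrier W_E7 \<Longrightarrow> w \<in> carrier W_E7 \<Longrightarrow> rho (v \<otimes>\<^bsub>W_E7\<^esub> w) = rho v \<circ> rho w"
  using hom_mult[OF rho_hom] mult_GL7[of "rho v" "rho w"] hom_in_carrier[OF rho_hom]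
  by (simp add: carrier_GL7)

lemma rho_one: "rho \<one>\<^bsub>W_E7\<^esub> = id"
  using rho_word[of "[]"] by (simp add: W_word_Nil id_def)

lemma rho_s: "i \<in> {1..7} \<Longrightarrow> rho (s i) = reflection i"
  using rho_word[of "[i]"] by (simp add: W_word_single)

lemma foldr_reflection:
  assumes "set is \<subseteq> {1..7}"
  shows foldr_reflection_add: "foldr reflection is (x + y) = foldr reflection is x + foldr reflection is y"
    and foldr_reflection_scale: "foldr reflection is (c *s x) = c *s foldr reflection is x"
    and foldr_reflection_cinner: "cinner (foldr reflection is x) (foldr reflection is y) = cinner x y"
    and foldr_reflection_cnj_vec: "foldr reflection is (cnj_vec x) = cnj_vec (foldr reflection is x)"
  using assms
  by (induction "is")
    (auto simp: finite_unitary_add finite_unitary_scale finite_unitary_cinner finite_unitary_reflection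
      reflection_cnj_vec)

lemma rho_add: "w \<in> carrier W_E7 \<Longrightarrow> rho w (x + y) = rho w x + rho w y"
  and rho_scale: "w \<in> carrier W_E7 \<Longrightarrow> rho w (c *s x) = c *s rho w x"
  and rho_cinner: "w \<in> carrier W_E7 \<Longrightarrow> cinner (rho w x) (rho w y) = cinner x y"
  and rho_cnj_vec: "w \<in> carrier W_E7 \<Longrightarrow> rho w (cnj_vec x) = cnj_vec (rho w x)"
  by (metis W_word_exists rho_word foldr_reflection)+

lemma rho_minus: "w \<in> carrier W_E7 \<Longrightarrow> rho w (- x) = - rho w x"
  using rho_scale[of w "-1" x] by (simp add: vec.scale_minus_left)

lemma rho_mult_s:
  assumes "w \<in> carrier W_E7" "i \<in> {1..7}"
  shows "rho (w \<otimes>\<^bsub>W_E7\<^esub> s i) x = rho w (reflection i x)"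
  using assms by (simp add: rho_mult s_closed rho_s)

section \<open>Length and positivity\<close>

text \<open>A linear form separating positive from negative roots. The weights are powers of two, so
  the last nonzero coordinate of a simple root, which is positive, outweighs the others.\<close>

definition height :: "complex ^ 7 \<Rightarrow> real"
  where "height x = Re (x $ 0 + 2 * x $ 1 + 4 * x $ 2 + 8 * x $ 3 + 16 * x $ 4 + 32 * x $ 5 + 64 * x $ 6)"

lemma height_add: "height (x + y) = height x + height y"
  by (simp add: height_def)

lemma height_minus: "height (- x) = - height x"
  by (simp add: height_def)

lemma height_simple_root:
  assumes "i \<in> {1..7}"
  shows "height (simple_root i) > 0"
  using vertex_cases[OF assms]
  by (elim disjE; simp add: height_def simple_root_simps axis_nth_7 index_7_neq)

lemma W_length_eq:
  "W_length w = (LEAST n. \<exists>is. length is = n \<and> set is \<subseteq> {1..7} \<and> w = W_word is)"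
  unfolding W_length_def E7_vertices_def
  by (rule arg_cong[where f = Least]) (auto simp: fun_eq_iff W_word_foldr)

lemma W_length_word: "set is \<subseteq> {1..7} \<Longrightarrow> W_length (W_word is) \<le> length is"
  unfolding W_length_eq by (rule Least_le) blast

lemma W_length_exists:
  assumes "w \<in> carrier W_E7"
  obtains "is" where "set is \<subseteq> {1..7}" "w = W_word is" "length is = W_length w"
proof -
  have "\<exists>n is. length is = n \<and> set is \<subseteq> {1..7} \<and> w = W_word is"
    using assms by (metis W_word_exists)
  then have "\<exists>is. length is = W_length w \<and> set is \<subseteq> {1..7} \<and> w = W_word is"
    unfolding W_length_eq by (rule LeastI_ex)
  then show thesis
    using that by blast
qed

lemma W_length_mult_s_le:
  assumes "w \<in> carrier W_E7" "i \<in> {1..7}"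
  shows "W_length (w \<otimes>\<^bsub>W_E7\<^esub> s i) \<le> W_length w + 1"
proof -
  obtain "is" where "set is \<subseteq> {1..7}" "w = W_word is" "length is = W_length w"
    using assms(1) by (rule W_length_exists)
  then show ?thesis
    using W_length_word[of "is @ [i]"] assms(2) by (simp add: W_word_append W_word_single)
qed

lemma W_length_parity:
  assumes "set is \<subseteq> {1..7}"
  shows "even (W_length (W_word is)) = even (length is)"
proof -
  obtain js where "set js \<subseteq> {1..7}" "W_word is = W_word js" "length js = W_length (W_word is)"
    using W_word_closed[OF assms] by (rule W_length_exists)
  then show ?thesis
    using W_word_parity[OF assms] by metis
qed

lemma W_length_mult_parity:
  assumes "v \<in> carrier W_E7" "w \<in> carrier W_E7"
  shows "even (W_length (v \<otimes>\<^bsub>W_E7\<^esub> w)) \<longleftrightarrow> even (W_length v) = even (W_length w)"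
proof -
  obtain "is" where is': "set is \<subseteq> {1..7}" "v = W_word is"
    using assms(1) by (rule W_word_exists)
  obtain js where js: "set js \<subseteq> {1..7}" "w = W_word js"
    using assms(2) by (rule W_word_exists)
  show ?thesis
    using W_length_parity[of "is @ js"] W_length_parity[of "is"] W_length_parity[of js] is' js
    by (simp add: W_word_append)
qed

lemma W_length_s_odd: "i \<in> {1..7} \<Longrightarrow> odd (W_length (s i))"
  using W_length_parity[of "[i]"] by (simp add: W_word_single)

lemma mult_s_s:
  assumes "w \<in> carrier W_E7" "i \<in> {1..7}"
  shows "w \<otimes>\<^bsub>W_E7\<^esub> s i \<otimes>\<^bsub>W_E7\<^esub> s i = w"
  using assms by (simp add: W.m_assoc s_closed s_s)

lemma W_last_letter:
  assumes "w \<in> carrier W_E7" "w \<noteq> \<one>\<^bsub>W_E7\<^esub>"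
  obtains v i where "v \<in> carrier W_E7" "i \<in> {1..7}" "w = v \<otimes>\<^bsub>W_E7\<^esub> s i" "W_length w = W_length v + 1"
proof -
  obtain "is" where is': "set is \<subseteq> {1..7}" "w = W_word is" "length is = W_length w"
    using assms(1) by (rule W_length_exists)
  then have "is \<noteq> []"
    using assms(2) by (auto simp: W_word_Nil)
  then obtain js i where js: "is = js @ [i]"
    by (metis rev_exhaust)
  then have j: "set js \<subseteq> {1..7}" "i \<in> {1..7}"
    using is' by auto
  have w: "w = W_word js \<otimes>\<^bsub>W_E7\<^esub> s i"
    using is' j js by (simp add: W_word_append W_word_single)
  have "W_length w \<le> W_length (W_word js) + 1"
    unfolding w by (rule W_length_mult_s_le[OF W_word_closed[OF j(1)] j(2)])
  then have "W_length w = W_length (W_word js) + 1"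
    using W_length_word[OF j(1)] is'(3) js by simp
  then show thesis
    using that W_word_closed[OF j(1)] j(2) w by blast
qed

text \<open>Induction on the length, with a last letter \<open>s j\<close> split off a shortest
  word, leaving \<open>v\<close>. If \<open>s i\<close> and \<open>s j\<close> commute,
  \<open>w\<close> and \<open>v\<close> agree on the root \<open>i\<close>. If they are joined,
  \<open>w\<close> sends it to the sum of the images under \<open>v\<close> of the roots
  \<open>i\<close> and \<open>j\<close>, both positive unless \<open>s i\<close> shortens
  \<open>v\<close>.\<close>

lemma height_pos:
  assumes "w \<in> carrier W_E7" "i \<in> {1..7}" "W_length w \<le> W_length (w \<otimes>\<^bsub>W_E7\<^esub> s i)"
  shows "height (rho w (simple_root i)) > 0"
  using assms
proof (induction "W_length w" arbitrary: w i rule: less_induct)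
  case less
  note w = less.prems(1) and i = less.prems(2)
  show ?case
  proof (cases "w = \<one>\<^bsub>W_E7\<^esub>")
    case True
    then show ?thesis
      using i by (simp add: rho_one height_simple_root)
  next
    case False
    then obtain v j where v: "v \<in> carrier W_E7" "j \<in> {1..7}" "w = v \<otimes>\<^bsub>W_E7\<^esub> s j"
        "W_length w = W_length v + 1"
      using w by (metis W_last_letter)
    have "i \<noteq> j"
    proof
      assume "i = j"
      then have "w \<otimes>\<^bsub>W_E7\<^esub> s i = v"
        using v by (simp add: mult_s_s)
      then show False
        using less.prems(3) v by simp
    qed
    have rho_w: "rho w x = rho v (reflection j x)" for x
      using v by (simp add: rho_mult_s)
    have sc: "s i \<in> carrier W_E7" "s j \<in> carrier W_E7"
      using i v(2) by (simp_all add: s_closed)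
    show ?thesis
    proof (cases "{i, j} \<in> E7_edges")
      case False
      have "W_length v \<le> W_length (v \<otimes>\<^bsub>W_E7\<^esub> s i)"
      proof (rule ccontr)
        assume "\<not> ?thesis"
        moreover have "w \<otimes>\<^bsub>W_E7\<^esub> s i = v \<otimes>\<^bsub>W_E7\<^esub> s i \<otimes>\<^bsub>W_E7\<^esub> s j"
          using s_comm[OF i v(2) \<open>i \<noteq> j\<close> False] v(1) sc by (simp add: v(3) W.m_assoc)
        moreover have "W_length (v \<otimes>\<^bsub>W_E7\<^esub> s i \<otimes>\<^bsub>W_E7\<^esub> s j) \<le> W_length (v \<otimes>\<^bsub>W_E7\<^esub> s i) + 1"
          using v sc by (intro W_length_mult_s_le) auto
        ultimately show False
          using less.prems(3) v(4) by simp
      qed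
      then have "height (rho v (simple_root i)) > 0"
        using less.hyps[of v i] v i by simp
      moreover have "reflection j (simple_root i) = simple_root i"
        using i v(2) \<open>i \<noteq> j\<close> False by (simp add: reflection_simple_root insert_commute)
      ultimately show ?thesis
        by (simp add: rho_w)
    next
      case True
      then have refl_ij: "reflection j (simple_root i) = simple_root i + simple_root j"
        using i v(2) \<open>i \<noteq> j\<close> by (simp add: reflection_simple_root insert_commute)
      then have w_i: "rho w (simple_root i) = rho v (simple_root i) + rho v (simple_root j)"
        using v(1) by (simp add: rho_w rho_add)
      have pos_j: "height (rho v (simple_root j)) > 0"
        using less.hyps[of v j] v by simp
      show ?thesis
      proof (cases "W_length v \<le> W_length (v \<otimes>\<^bsub>W_E7\<^esub> s i)")
        case True
        then have "height (rho v (simple_root i)) > 0"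
          using less.hyps[of v i] v i by simp
        then show ?thesis
          unfolding w_i height_add using pos_j by simp
      next
        \<comment> \<open>Now \<open>v\<close> itself ends in \<open>s i\<close>, and
          \<open>w\<close> is \<open>u\<close> followed by \<open>s i\<close> and
          \<open>s j\<close>. The rank two computation shows that \<open>w\<close> acts on the root
          \<open>i\<close> as the shorter \<open>u\<close> does on the root
          \<open>j\<close>.\<close>
        case False
        define u where "u = v \<otimes>\<^bsub>W_E7\<^esub> s i"
        have u: "u \<in> carrier W_E7" "v = u \<otimes>\<^bsub>W_E7\<^esub> s i" "W_length u < W_length v"
          using v(1) i sc False by (simp_all add: u_def mult_s_s)
        have "W_length v \<le> W_length u + 1"
          unfolding u(2) by (rule W_length_mult_s_le[OF u(1) i])
        have "W_length u \<le> W_length (u \<otimes>\<^bsub>W_E7\<^esub> s j)"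
        proof (rule ccontr)
          assume *: "\<not> ?thesis"
          have "w \<otimes>\<^bsub>W_E7\<^esub> s i = u \<otimes>\<^bsub>W_E7\<^esub> s j \<otimes>\<^bsub>W_E7\<^esub> s i \<otimes>\<^bsub>W_E7\<^esub> s j"
            using s_braid[OF i v(2) \<open>i \<noteq> j\<close> True] u(1) sc by (simp add: v(3) u(2) W.m_assoc)
          moreover have "W_length (u \<otimes>\<^bsub>W_E7\<^esub> s j \<otimes>\<^bsub>W_E7\<^esub> s i \<otimes>\<^bsub>W_E7\<^esub> s j)
              \<le> W_length (u \<otimes>\<^bsub>W_E7\<^esub> s j \<otimes>\<^bsub>W_E7\<^esub> s i) + 1"
            using u(1) v(2) sc by (intro W_length_mult_s_le) auto
          moreover have "W_length (u \<otimes>\<^bsub>W_E7\<^esub> s j \<otimes>\<^bsub>W_E7\<^esub> s i) \<le> W_length (u \<otimes>\<^bsub>W_E7\<^esub> s j) + 1"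
            using u(1) i sc by (intro W_length_mult_s_le) auto
          ultimately show False
            using less.prems(3) * u(3) v(4) by simp
        qed
        then have "height (rho u (simple_root j)) > 0"
          using less.hyps[of u j] u v by simp
        moreover have "rho w (simple_root i) = rho u (simple_root j)"
        proof -
          have "reflection i (simple_root i + simple_root j) = simple_root j"
            using i v(2) \<open>i \<noteq> j\<close> True
            by (simp add: finite_unitary_add finite_unitary_reflection reflection_simple_root)
          then show ?thesis
            using u(1) i by (simp add: rho_w refl_ij u(2) rho_mult_s)
        qed
        ultimately show ?thesis
          by simp
      qed
    qed
  qed
qed

text \<open>A shortest word of a nontrivial \<open>w\<close> ends in some \<open>s i\<close>, and
  then \<open>w\<close> sends the root \<open>i\<close> to the negative of a vector of positive
  height.\<close>

lemma no_descent:
  assumes "w \<in> carrier W_E7" "\<And>i. i \<in> {1..7} \<Longrightarrow> height (rho w (simple_root i)) > 0"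
  shows "w = \<one>\<^bsub>W_E7\<^esub>"
proof (rule ccontr)
  assume "w \<noteq> \<one>\<^bsub>W_E7\<^esub>"
  then obtain v i where v: "v \<in> carrier W_E7" "i \<in> {1..7}" "w = v \<otimes>\<^bsub>W_E7\<^esub> s i"
      "W_length w = W_length v + 1"
    using assms(1) by (metis W_last_letter)
  then have "height (rho v (simple_root i)) > 0"
    by (intro height_pos) auto
  moreover have "rho w (simple_root i) = - rho v (simple_root i)"
    using v by (simp add: rho_mult_s reflection_simple_root rho_minus)
  ultimately show False
    using assms(2)[OF v(2)] by (simp add: height_minus)
qed

lemma rho_faithful: "w \<in> carrier W_E7 \<Longrightarrow> rho w = id \<Longrightarrow> w = \<one>\<^bsub>W_E7\<^esub>"
  by (rule no_descent) (auto simp: height_simple_root)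

lemma rho_inj:
  assumes "v \<in> carrier W_E7" "w \<in> carrier W_E7" "rho v = rho w"
  shows "v = w"
proof -
  have "rho (inv\<^bsub>W_E7\<^esub> v \<otimes>\<^bsub>W_E7\<^esub> w) = rho (inv\<^bsub>W_E7\<^esub> v) \<circ> rho v"
    using assms by (simp add: rho_mult)
  also have "\<dots> = rho (inv\<^bsub>W_E7\<^esub> v \<otimes>\<^bsub>W_E7\<^esub> v)"
    using assms by (intro rho_mult[symmetric]) auto
  also have "\<dots> = id"
    using assms by (simp add: rho_one)
  finally have "inv\<^bsub>W_E7\<^esub> v \<otimes>\<^bsub>W_E7\<^esub> w = \<one>\<^bsub>W_E7\<^esub>"
    using assms by (intro rho_faithful) auto
  then have "inv\<^bsub>W_E7\<^esub> w = inv\<^bsub>W_E7\<^esub> v"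
    using assms by (intro W.inv_equality) auto
  then show ?thesis
    using assms by (metis W.inv_inv)
qed

lemma rho_eq_on_simple_roots:
  assumes "v \<in> carrier W_E7" "w \<in> carrier W_E7"
    and "\<And>i. i \<in> {1..7} \<Longrightarrow> rho v (simple_root i) = rho w (simple_root i)"
  shows "v = w"
proof -
  have 0: "rho u 0 = 0" if "u \<in> carrier W_E7" for u
    using rho_scale[OF that, of 0 0] by simp
  have "vec.subspace {x. rho v x = rho w x}"
    using assms(1,2) unfolding vec.subspace_def by (auto simp: rho_add rho_scale 0)
  then have "vec.span (simple_root ` {1..7}) \<subseteq> {x. rho v x = rho w x}"
    using assms(3) by (intro vec.span_minimal) auto
  then have "rho v = rho w"
    using span_simple_root by auto
  then show ?thesis
    by (rule rho_inj[OF assms(1,2)])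
qed

section \<open>An invariant lattice and the finiteness of W\<close>

text \<open>As roots have norm 4, \<open>cinner x (simple_root j) / 2\<close> is the pairing with a
  simple coroot, so the second condition is that of an integral weight. It makes a reflection
  subtract an integral multiple of the root, which keeps coordinates integral.\<close>

definition root_lattice :: "(complex ^ 7) set"
  where "root_lattice = {x. (\<forall>k. x $ k \<in> \<int>) \<and> (\<forall>j\<in>{1..7}. cinner x (simple_root j) / 2 \<in> \<int>)}"

lemma simple_root_half_cinner: "i \<in> {1..7} \<Longrightarrow> j \<in> {1..7} \<Longrightarrow> cinner (simple_root i) (simple_root j) / 2 \<in> \<int>"
  by (auto simp: cinner_simple_root)

lemma simple_root_in_lattice: "i \<in> {1..7} \<Longrightarrow> simple_root i \<in> root_lattice"
  by (auto simp: root_lattice_def simple_root_half_cinner simp del: atLeastAtMost_iff)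
    (auto simp: simple_root_def axis_def)

lemma reflection_in_lattice:
  assumes i: "i \<in> {1..7}" and x: "x \<in> root_lattice"
  shows "reflection i x \<in> root_lattice"
  unfolding root_lattice_def
proof (intro CollectI conjI allI ballI)
  have c: "cinner x (simple_root i) / 2 \<in> \<int>"
    using x i by (auto simp: root_lattice_def)
  show "reflection i x $ k \<in> \<int>" for k
  proof -
    have "reflection i x $ k = x $ k - cinner x (simple_root i) / 2 * simple_root i $ k"
      by (simp add: reflection_def)
    also have "\<dots> \<in> \<int>"
      using x simple_root_in_lattice[OF i] by (intro Ints_diff Ints_mult c) (auto simp: root_lattice_def)
    finally show ?thesis .
  qed
  show "cinner (reflection i x) (simple_root j) / 2 \<in> \<int>" if j: "j \<in> {1..7}" for j
  proof -
    have "cinner (reflection i x) (simple_root j) / 2 = cinner x (simple_root j) / 2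
        - cinner x (simple_root i) / 2 * (cinner (simple_root i) (simple_root j) / 2)"
      by (simp add: reflection_def cinner_simps diff_divide_distrib)
    also have "\<dots> \<in> \<int>"
      using x by (intro Ints_diff Ints_mult c simple_root_half_cinner i j) (use j in \<open>auto simp: root_lattice_def\<close>)
    finally show ?thesis .
  qed
qed

lemma rho_in_lattice:
  assumes "w \<in> carrier W_E7" "x \<in> root_lattice"
  shows "rho w x \<in> root_lattice"
proof -
  obtain "is" where is': "set is \<subseteq> {1..7}" "w = W_word is"
    using assms(1) by (rule W_word_exists)
  have "foldr reflection is x \<in> root_lattice"
    using is'(1) by (induction "is") (auto simp: assms(2) reflection_in_lattice)
  then show ?thesis
    using is' by (simp add: rho_word)
qed

text \<open>An element is determined by the images of the simple roots. These are integral vectors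
  of norm 4, so their coordinates lie between -2 and 2 and there are finitely many of them.\<close>

lemma finite_W_E7: "finite (carrier W_E7)"
proof -
  define S where "S = (of_int ` {-2..2} :: complex set)"
  define T where "T = {x :: complex ^ 7. \<forall>k. x $ k \<in> S}"
  have "T \<subseteq> vec_lambda ` (UNIV \<rightarrow>\<^sub>E S)"
  proof
    fix x assume "x \<in> T"
    then have "x = vec_lambda (vec_nth x)" "vec_nth x \<in> UNIV \<rightarrow>\<^sub>E S"
      by (auto simp: T_def)
    then show "x \<in> vec_lambda ` (UNIV \<rightarrow>\<^sub>E S)"
      by blast
  qed
  moreover have "finite (UNIV \<rightarrow>\<^sub>E S :: (7 \<Rightarrow> complex) set)"
    by (intro finite_PiE) (auto simp: S_def)
  ultimately have "finite T"
    using finite_surj by blast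
  have short: "x \<in> T" if x: "x \<in> root_lattice" "cinner x x = 4" for x
    unfolding T_def
  proof (intro CollectI allI)
    fix k
    have "x $ k \<in> \<int>"
      using x(1) by (auto simp: root_lattice_def)
    then obtain n where n: "x $ k = of_int n"
      by (rule Ints_cases)
    have "complex_of_real (\<Sum>i\<in>UNIV. (cmod (x $ i))\<^sup>2) = of_real 4"
      using x(2) by (simp only: cinner_self) simp
    then have "(\<Sum>i\<in>UNIV. (cmod (x $ i))\<^sup>2) = 4"
      unfolding of_real_eq_iff .
    moreover have "(cmod (x $ k))\<^sup>2 \<le> (\<Sum>i\<in>UNIV. (cmod (x $ i))\<^sup>2)"
      by (rule member_le_sum) auto
    ultimately have "real_of_int (n\<^sup>2) \<le> 2\<^sup>2"
      by (simp add: n)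
    then have "real_of_int (n\<^sup>2) \<le> real_of_int (2\<^sup>2)"
      by simp
    then have "n\<^sup>2 \<le> 2\<^sup>2"
      unfolding of_int_le_iff .
    then have "\<bar>n\<bar> \<le> 2"
      using abs_le_square_iff[of n 2] by simp
    then have "n \<in> {-2..2}"
      by auto
    then show "x $ k \<in> S"
      unfolding n S_def by (rule imageI)
  qed
  define f where "f w = (\<lambda>i\<in>{1..7 :: nat}. rho w (simple_root i))" for w
  have "f w \<in> {1..7} \<rightarrow>\<^sub>E T" if w: "w \<in> carrier W_E7" for w
    unfolding f_def
  proof (intro restrict_PiE_iff[THEN iffD2] ballI)
    fix i :: nat assume i: "i \<in> {1..7}"
    show "rho w (simple_root i) \<in> T"
    proof (rule short)
      show "rho w (simple_root i) \<in> root_lattice"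
        by (intro rho_in_lattice w simple_root_in_lattice i)
      show "cinner (rho w (simple_root i)) (rho w (simple_root i)) = 4"
        by (simp add: rho_cinner[OF w] cinner_simple_root[OF i i])
    qed
  qed
  then have "f ` carrier W_E7 \<subseteq> {1..7} \<rightarrow>\<^sub>E T"
    by blast
  moreover have "finite ({1..7 :: nat} \<rightarrow>\<^sub>E T)"
    using \<open>finite T\<close> by (intro finite_PiE) auto
  ultimately have "finite (f ` carrier W_E7)"
    by (rule finite_subset)
  moreover have "inj_on f (carrier W_E7)"
  proof (rule inj_onI)
    fix v w assume vw: "v \<in> carrier W_E7" "w \<in> carrier W_E7" and eq: "f v = f w"
    show "v = w"
    proof (rule rho_eq_on_simple_roots[OF vw])
      fix i :: nat assume "i \<in> {1..7}"
      then show "rho v (simple_root i) = rho w (simple_root i)"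
        using fun_cong[OF eq, of i] by (simp add: f_def)
    qed
  qed
  ultimately show ?thesis
    by (rule finite_imageD)
qed

text \<open>Finite order comes from Lagrange's theorem in the finite group W.\<close>

lemma finite_unitary_rho:
  assumes w: "w \<in> carrier W_E7"
  shows "finite_unitary (rho w)"
  unfolding finite_unitary_def
proof (intro conjI allI)
  show "Vector_Spaces.linear (*s) (*s) (rho w)"
    unfolding Vector_Spaces.linear_iff
    by (intro conjI allI vec.vector_space_axioms rho_add rho_scale w)
  show "cinner (rho w x) (rho w y) = cinner x y" for x y
    by (rule rho_cinner[OF w])
  have pow: "rho (w [^]\<^bsub>W_E7\<^esub> n) = rho w ^^ n" for n :: nat
    by (induction n) (simp_all add: rho_one rho_mult w funpow_Suc_right del: funpow.simps(2))
  have "w [^]\<^bsub>W_E7\<^esub> Coset.order W_E7 = \<one>\<^bsub>W_E7\<^esub>"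
    by (rule group.pow_order_eq_1[OF W.group_axioms w])
  then have "rho w ^^ Coset.order W_E7 = id"
    by (metis pow rho_one)
  moreover have "Coset.order W_E7 > 0"
    using finite_W_E7 by (rule W.order_gt_0_iff_finite[THEN iffD2])
  ultimately show "\<exists>n>0. rho w ^^ n = id"
    by blast
qed

section \<open>The longest element\<close>

text \<open>A Coxeter element has order 18 and all exponents of E7 are odd, so its ninth power is
  -1. The number of letters is 9 * 7 = 63, the number of positive roots.\<close>

definition neg_word :: "nat list"
  where "neg_word = concat (replicate 9 [1..<8])"

lemma neg_word_set: "set neg_word \<subseteq> {1..7}"
  by (auto simp: neg_word_def)

lemma arg_cong7:
  assumes "a = a'" "b = b'" "c = c'" "d = d'" "e = e'" "f = f'" "g = g'"
  shows "h a b c d e f g = h a' b' c' d' e' f' g'"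
  using assms by simp

text \<open>The ninth power of the Coxeter element, computed in simple root coordinates.\<close>

lemma foldr_reflection_neg_word: "foldr reflection neg_word x = - x"
proof -
  define comb where "comb a b c d e f g =
    a *s simple_root 1 + b *s simple_root 2 + c *s simple_root 3 + d *s simple_root 4
      + e *s simple_root 5 + f *s simple_root 6 + g *s simple_root 7" for a b c d e f g
  have fu: "finite_unitary (reflection i)" if "i \<in> {1..7}" for i
    using that by (rule finite_unitary_reflection)
  have r: "reflection i (simple_root j) = (if i = j then - simple_root i
    else if {i, j} \<in> E7_edges then simple_root j + simple_root i else simple_root j)"
    if "i \<in> {1..7}" "j \<in> {1..7}" for i j
    using that by (rule reflection_simple_root)
  have refl_comb: "reflection i (comb a b c d e f g) =
      a *s reflection i (simple_root 1) + b *s reflection i (simple_root 2) + c *s reflection i (simple_root 3)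
      + d *s reflection i (simple_root 4) + e *s reflection i (simple_root 5)
      + f *s reflection i (simple_root 6) + g *s reflection i (simple_root 7)"
    if "i \<in> {1..7}" for i a b c d e f g
    using fu[OF that] by (simp add: comb_def finite_unitary_add finite_unitary_scale)
  note edges = E7_edges_def doubleton_eq_iff
  have comb_simps:
    "reflection 1 (comb a b c d e f g) = comb (c - a) b c d e f g"
    "reflection 2 (comb a b c d e f g) = comb a (d - b) c d e f g"
    "reflection 3 (comb a b c d e f g) = comb a b (a + d - c) d e f g"
    "reflection 4 (comb a b c d e f g) = comb a b c (b + c + e - d) e f g"
    "reflection 5 (comb a b c d e f g) = comb a b c d (d + f - e) f g"
    "reflection 6 (comb a b c d e f g) = comb a b c d e (e + g - f) g"
    "reflection 7 (comb a b c d e f g) = comb a b c d e f (f - g)" for a b c d e f g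
    by (simp_all add: refl_comb r edges, simp_all add: comb_def vec_eq_iff algebra_simps)
  have l: "[1..<8] = [1, 2, 3, 4, 5, 6, 7 :: nat]"
    by (simp add: upt_rec)
  have cox: "foldr reflection [1..<8] (comb a b c d e f g)
      = comb (b - g) (c - g) (a + b - g) (b + c - g) (d - g) (e - g) (f - g)" for a b c d e f g
    by (simp add: l comb_simps algebra_simps)
  have pow: "foldr reflection (concat (replicate n [1..<8])) = foldr reflection [1..<8] ^^ n" for n
    by (induction n) (auto simp del: upt_rec_numeral)
  \<comment> \<open>As 9 = 3 * 3, the cube is computed once and then applied three times.\<close>
  have cox3: "(foldr reflection [1..<8] ^^ 3) (comb a b c d e f g)
      = comb (a + b - e) (b + c - e - g) (a + b + c - e - f) (a + 2 * b + c - e - f - g) (a + b + c - e - g) (b + c - e) (d - e)" for a b c d e f g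
    unfolding numeral_3_eq_3 funpow.simps comp_apply id_apply cox
    by (rule arg_cong7[where h = comb]) (simp_all add: algebra_simps)
  have neg: "foldr reflection neg_word (comb a b c d e f g) = comb (-a) (-b) (-c) (-d) (-e) (-f) (-g)"
    for a b c d e f g
  proof -
    have "foldr reflection neg_word = (foldr reflection [1..<8] ^^ 3) ^^ 3"
      by (simp add: neg_word_def pow funpow_mult del: upt_rec_numeral)
    then have eq: "foldr reflection neg_word x
        = (foldr reflection [1..<8] ^^ 3) ((foldr reflection [1..<8] ^^ 3) ((foldr reflection [1..<8] ^^ 3) x))" for x
      by (simp add: numeral_3_eq_3 del: upt_rec_numeral)
    show ?thesis
      unfolding eq cox3 by (rule arg_cong7[where h = comb]; simp add: algebra_simps)
  qed
  note lin = foldr_reflection_add[OF neg_word_set] foldr_reflection_scale[OF neg_word_set]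
  have root: "foldr reflection neg_word (simple_root i) = - simple_root i" if "i \<in> {1..7}" for i
  proof -
    have "simple_root 1 = comb 1 0 0 0 0 0 0" "simple_root 2 = comb 0 1 0 0 0 0 0"
      "simple_root 3 = comb 0 0 1 0 0 0 0" "simple_root 4 = comb 0 0 0 1 0 0 0"
      "simple_root 5 = comb 0 0 0 0 1 0 0" "simple_root 6 = comb 0 0 0 0 0 1 0"
      "simple_root 7 = comb 0 0 0 0 0 0 1"
      by (simp_all add: comb_def)
    then have "\<exists>a b c d e f g. simple_root i = comb a b c d e f g"
      using vertex_cases[OF that] by blast
    then obtain a b c d e f g where i: "simple_root i = comb a b c d e f g"
      by blast
    show ?thesis
      unfolding i neg by (simp add: comb_def vec_eq_iff algebra_simps)
  qed
  have "vec.subspace {x. foldr reflection neg_word x = - x}"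
    using lin(2)[of 0 0] unfolding vec.subspace_def by (auto simp: lin vec_eq_iff)
  then have "vec.span (simple_root ` {1..7}) \<subseteq> {x. foldr reflection neg_word x = - x}"
    using root by (intro vec.span_minimal) auto
  then show ?thesis
    using span_simple_root by blast
qed

definition neg_elt :: "nat gword set"
  where "neg_elt = W_word neg_word"

lemma neg_elt_closed: "neg_elt \<in> carrier W_E7"
  by (simp add: neg_elt_def W_word_closed neg_word_set)

lemma rho_neg_elt: "rho neg_elt x = - x"
  by (simp add: neg_elt_def rho_word neg_word_set foldr_reflection_neg_word)

lemma neg_elt_square: "neg_elt \<otimes>\<^bsub>W_E7\<^esub> neg_elt = \<one>\<^bsub>W_E7\<^esub>"
  by (rule rho_faithful) (auto simp: neg_elt_closed rho_mult rho_neg_elt)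

lemma neg_elt_odd: "odd (W_length neg_elt)"
proof -
  have "length neg_word = 63"
    by (simp add: neg_word_def length_concat sum_list_replicate del: upt_rec_numeral)
  then show ?thesis
    using W_length_parity[OF neg_word_set] by (simp add: neg_elt_def)
qed

text \<open>If no generator lengthens \<open>w\<close>, then \<open>w\<close> makes every simple
  root negative; composed with -1 it makes them all positive and is trivial by
  \<open>no_descent\<close>.\<close>

lemma locally_longest_is_neg_elt:
  assumes w: "w \<in> carrier W_E7"
    and le: "\<And>i. i \<in> {1..7} \<Longrightarrow> W_length (w \<otimes>\<^bsub>W_E7\<^esub> s i) \<le> W_length w"
  shows "w = neg_elt"
proof -
  have "neg_elt \<otimes>\<^bsub>W_E7\<^esub> w = \<one>\<^bsub>W_E7\<^esub>"
  proof (rule no_descent)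
    show "neg_elt \<otimes>\<^bsub>W_E7\<^esub> w \<in> carrier W_E7"
      by (simp add: neg_elt_closed w)
    fix i :: nat assume i: "i \<in> {1..7}"
    let ?v = "w \<otimes>\<^bsub>W_E7\<^esub> s i"
    have v: "?v \<in> carrier W_E7"
      using w s_closed[OF i] by simp
    have "height (rho ?v (simple_root i)) > 0"
      using le[OF i] mult_s_s[OF w i] by (intro height_pos v i) simp
    moreover have "rho ?v (simple_root i) = - rho w (simple_root i)"
      using i by (simp add: rho_mult_s[OF w i] reflection_simple_root rho_minus[OF w])
    moreover have "rho (neg_elt \<otimes>\<^bsub>W_E7\<^esub> w) (simple_root i) = - rho w (simple_root i)"
      by (simp add: rho_mult neg_elt_closed w rho_neg_elt)
    ultimately show "height (rho (neg_elt \<otimes>\<^bsub>W_E7\<^esub> w) (simple_root i)) > 0"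
      by simp
  qed
  then have "neg_elt \<otimes>\<^bsub>W_E7\<^esub> (neg_elt \<otimes>\<^bsub>W_E7\<^esub> w) = neg_elt"
    by (simp add: neg_elt_closed)
  then show ?thesis
    using neg_elt_closed w by (simp add: neg_elt_square flip: W.m_assoc)
qed

text \<open>A maximum of the length exists because W is finite, and every maximum is
  \<open>neg_elt\<close>. This makes the description defining \<open>w\<^sub>0\<close>
  meaningful.\<close>

lemma longest_iff: "is_arg_max W_length (\<lambda>x. x \<in> carrier W_E7) w \<longleftrightarrow> w = neg_elt"
proof -
  have *: "v = neg_elt" if v: "is_arg_max W_length (\<lambda>x. x \<in> carrier W_E7) v" for v
  proof (rule locally_longest_is_neg_elt)
    show "v \<in> carrier W_E7"
      using v by (simp add: is_arg_max_def)
    fix i :: nat assume "i \<in> {1..7}"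
    then have "v \<otimes>\<^bsub>W_E7\<^esub> s i \<in> carrier W_E7"
      using \<open>v \<in> carrier W_E7\<close> s_closed by simp
    then show "W_length (v \<otimes>\<^bsub>W_E7\<^esub> s i) \<le> W_length v"
      using v unfolding is_arg_max_def by (meson not_le)
  qed
  have "W_length ` carrier W_E7 \<noteq> {}" "finite (W_length ` carrier W_E7)"
    using finite_W_E7 W.one_closed by blast+
  then have "Max (W_length ` carrier W_E7) \<in> W_length ` carrier W_E7"
    by (intro Max_in)
  then obtain v where v: "v \<in> carrier W_E7" "W_length v = Max (W_length ` carrier W_E7)"
    by (metis imageE)
  have "is_arg_max W_length (\<lambda>x. x \<in> carrier W_E7) v"
    unfolding is_arg_max_def v(2) using v(1) finite_W_E7 by (auto simp: not_less)
  then show ?thesis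
    using * by metis
qed

lemma w\<^sub>0_eq: "w\<^sub>0 = neg_elt"
  unfolding w\<^sub>0_def longest_iff by simp

lemma w\<^sub>0_closed: "w\<^sub>0 \<in> carrier W_E7"
  and rho_w\<^sub>0: "rho w\<^sub>0 x = - x"
  and w\<^sub>0_square: "w\<^sub>0 \<otimes>\<^bsub>W_E7\<^esub> w\<^sub>0 = \<one>\<^bsub>W_E7\<^esub>"
  and w\<^sub>0_odd: "odd (W_length w\<^sub>0)"
  by (simp_all add: w\<^sub>0_eq neg_elt_closed rho_neg_elt neg_elt_square neg_elt_odd)

lemma w\<^sub>0_commute: "w \<in> carrier W_E7 \<Longrightarrow> w\<^sub>0 \<otimes>\<^bsub>W_E7\<^esub> w = w \<otimes>\<^bsub>W_E7\<^esub> w\<^sub>0"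
  by (rule rho_inj) (auto simp: w\<^sub>0_closed rho_mult rho_w\<^sub>0 rho_minus fun_eq_iff)

text \<open>A central element commutes with the reflections, hence preserves their (-1)-eigenlines,
  spanned by the simple roots. Along an edge the scalars agree, because the sum of the two roots is
  an eigenvector too. The common scalar is an integer, by the lattice, and of modulus one.\<close>

lemma center_W_E7: "center W_E7 = {\<one>\<^bsub>W_E7\<^esub>, w\<^sub>0}"
proof (intro equalityI subsetI)
  fix z assume z': "z \<in> center W_E7"
  then have z: "z \<in> carrier W_E7"
    by (simp add: center_def)
  have comm: "rho z (reflection i x) = reflection i (rho z x)" if i: "i \<in> {1..7}" for i x
  proof -
    have "rho (z \<otimes>\<^bsub>W_E7\<^esub> s i) = rho (s i \<otimes>\<^bsub>W_E7\<^esub> z)"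
      using z' s_closed[OF i] by (simp add: center_def)
    then show ?thesis
      using z s_closed[OF i] i by (simp add: rho_mult rho_s fun_eq_iff)
  qed
  have eig: "\<exists>c. rho z (simple_root i) = c *s simple_root i" if i: "i \<in> {1..7}" for i
  proof -
    have "reflection i (rho z (simple_root i)) = - rho z (simple_root i)"
      using comm[OF i, of "simple_root i"] i by (simp add: reflection_simple_root rho_minus[OF z])
    then have "2 *s rho z (simple_root i)
        = (cinner (rho z (simple_root i)) (simple_root i) / 2) *s simple_root i"
      by (simp add: reflection_def vec_eq_iff algebra_simps)
    then have "(1/2) *s (2 *s rho z (simple_root i))
        = (1/2) *s ((cinner (rho z (simple_root i)) (simple_root i) / 2) *s simple_root i)"
      by simp
    then show ?thesis
      unfolding vec.scale_scale by auto
  qed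
  obtain c where c: "rho z (simple_root 1) = c *s simple_root 1"
    using eig[of 1] by auto
  have all: "rho z (simple_root i) = c *s simple_root i" if i: "i \<in> {1..7}" for i
  proof (rule E7_connected[of "\<lambda>i. rho z (simple_root i) = c *s simple_root i", OF c _ i])
    fix i j assume ij: "i \<in> {1..7}" "j \<in> {1..7}" "i \<noteq> j" "{i, j} \<in> E7_edges"
      and ci: "rho z (simple_root i) = c *s simple_root i"
    obtain d where d: "rho z (simple_root j) = d *s simple_root j"
      using eig[OF ij(2)] by blast
    have "rho z (simple_root i + simple_root j) = c *s (simple_root i + simple_root j)"
      using comm[OF ij(2), of "simple_root i"] ij ci finite_unitary_reflection[OF ij(2)]
      by (simp add: reflection_simple_root insert_commute finite_unitary_scale)
    then show "rho z (simple_root j) = c *s simple_root j"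
      by (simp add: rho_add[OF z] ci vec.scale_right_distrib)
  qed
  \<comment> \<open>Coordinate 6 of \<open>simple_root 1\<close> is 1, so \<open>c\<close> is a
    coordinate of a lattice vector.\<close>
  have "c \<in> \<int>"
  proof -
    have "rho z (simple_root 1) \<in> root_lattice"
      by (intro rho_in_lattice z simple_root_in_lattice) simp
    then have "(c *s simple_root 1) $ 6 \<in> \<int>"
      unfolding all[of 1, simplified] by (auto simp: root_lattice_def)
    then show ?thesis
      by (simp add: simple_root_simps axis_nth_7 index_7_neq)
  qed
  then obtain n where n: "c = of_int n"
    by (rule Ints_cases)
  have "cinner (c *s simple_root 1) (c *s simple_root 1) = cinner (simple_root 1) (simple_root 1)"
    using rho_cinner[OF z, of "simple_root 1" "simple_root 1"] c by simp
  then have "c * c = 1"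
    by (simp add: cinner_simps cinner_simple_root n)
  then have "c = 1 \<or> c = -1"
    by (simp add: square_eq_1_iff)
  then show "z \<in> {\<one>\<^bsub>W_E7\<^esub>, w\<^sub>0}"
  proof
    assume "c = 1"
    then have "z = \<one>\<^bsub>W_E7\<^esub>"
      using all by (intro rho_eq_on_simple_roots z) (auto simp: rho_one)
    then show ?thesis by simp
  next
    assume "c = -1"
    then have "z = w\<^sub>0"
      using all by (intro rho_eq_on_simple_roots z w\<^sub>0_closed) (auto simp: rho_w\<^sub>0)
    then show ?thesis by simp
  qed
qed (auto simp: center_def w\<^sub>0_closed w\<^sub>0_commute)

section \<open>Homomorphisms of the Artin group and the Coxeter group\<close>

lemma (in group) word_eval_in_subgroup:
  assumes "subgroup K G" "\<And>x. x \<in> X \<Longrightarrow> f x \<in> K" "w \<in> gwords X"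
  shows "word_eval G f w \<in> K"
  using assms(3)
  by (induction w)
    (auto intro!: subgroup.one_closed[OF assms(1)] subgroup.m_closed[OF assms(1)]
      subgroup.m_inv_closed[OF assms(1)] assms(2))

lemma (in group) presented_image_subset:
  assumes "\<phi> \<in> hom (presented_group X R) G" "subgroup K G"
    and "\<And>x. x \<in> X \<Longrightarrow> \<phi> (pres_gen X R x) \<in> K"
  shows "\<phi> ` carrier (presented_group X R) \<subseteq> K"
proof clarify
  fix C assume "C \<in> carrier (presented_group X R)"
  then obtain w where "w \<in> gwords X" "C = word_class X R w"
    by (rule carrier_presented_groupE)
  then show "\<phi> C \<in> K"
    using word_eval_in_subgroup[OF assms(2), of X "\<lambda>x. \<phi> (pres_gen X R x)" w]
    by (simp add: hom_presented_eq[OF assms(1)] assms(3))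
qed

section \<open>Families satisfying the Artin relations\<close>

context group
begin

text \<open>By the universal property such a family is the same as a homomorphism from the Artin
  group, given by the images of the generators.\<close>

definition artin_family :: "(nat \<Rightarrow> 'a) \<Rightarrow> bool"
  where "artin_family a \<longleftrightarrow> (\<forall>i\<in>{1..7}. a i \<in> carrier G) \<and>
    (\<forall>i\<in>{1..7}. \<forall>j\<in>{1..7}. i \<noteq> j \<longrightarrow> {i, j} \<in> E7_edges \<longrightarrow>
      a i \<otimes> (a j \<otimes> a i) = a j \<otimes> (a i \<otimes> a j)) \<and>
    (\<forall>i\<in>{1..7}. \<forall>j\<in>{1..7}. i \<noteq> j \<longrightarrow> {i, j} \<notin> E7_edges \<longrightarrow> a i \<otimes> a j = a j \<otimes> a i)"

lemma artin_familyI: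
  assumes "\<And>i. i \<in> {1..7} \<Longrightarrow> a i \<in> carrier G"
    and "\<And>i j. i \<in> {1..7} \<Longrightarrow> j \<in> {1..7} \<Longrightarrow> i \<noteq> j \<Longrightarrow> {i, j} \<in> E7_edges \<Longrightarrow>
      a i \<otimes> (a j \<otimes> a i) = a j \<otimes> (a i \<otimes> a j)"
    and "\<And>i j. i \<in> {1..7} \<Longrightarrow> j \<in> {1..7} \<Longrightarrow> i \<noteq> j \<Longrightarrow> {i, j} \<notin> E7_edges \<Longrightarrow>
      a i \<otimes> a j = a j \<otimes> a i"
  shows "artin_family a"
  unfolding artin_family_def by (intro conjI ballI impI assms)

lemma artin_familyD:
  assumes "artin_family a"
  shows "i \<in> {1..7} \<Longrightarrow> a i \<in> carrier G"
    and "i \<in> {1..7} \<Longrightarrow> j \<in> {1..7} \<Longrightarrow> i \<noteq> j \<Longrightarrow> {i, j} \<in> E7_edges \<Longrightarrow>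
      a i \<otimes> (a j \<otimes> a i) = a j \<otimes> (a i \<otimes> a j)"
    and "i \<in> {1..7} \<Longrightarrow> j \<in> {1..7} \<Longrightarrow> i \<noteq> j \<Longrightarrow> {i, j} \<notin> E7_edges \<Longrightarrow>
      a i \<otimes> a j = a j \<otimes> a i"
  using assms unfolding artin_family_def by blast+

lemma artin_family_respects:
  assumes a: "artin_family a" and uv: "(u, v) \<in> artin_relations"
  shows "word_eval G a u = word_eval G a v"
proof -
  consider i j where "u = [(i, True), (j, True), (i, True)]" "v = [(j, True), (i, True), (j, True)]"
      "i \<in> {1..7}" "j \<in> {1..7}" "i \<noteq> j" "{i, j} \<in> E7_edges"
    | i j where "u = [(i, True), (j, True)]" "v = [(j, True), (i, True)]"
      "i \<in> {1..7}" "j \<in> {1..7}" "i \<noteq> j" "{i, j} \<notin> E7_edges"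
    using uv unfolding artin_relations_def E7_vertices_def by auto
  then show ?thesis
  proof cases
    case 1
    then show ?thesis
      using artin_familyD(1)[OF a] artin_familyD(2)[OF a, of i j] by simp
  next
    case 2
    then show ?thesis
      using artin_familyD(1)[OF a] artin_familyD(3)[OF a, of i j] by simp
  qed
qed

lemma artin_family_carrier: "artin_family a \<Longrightarrow> a ` E7_vertices \<subseteq> carrier G"
  by (auto simp: E7_vertices_def artin_family_def)

lemma artin_hom_exists:
  assumes "artin_family a"
  obtains \<phi> where "\<phi> \<in> hom A_E7 G" "\<And>i. i \<in> {1..7} \<Longrightarrow> \<phi> (\<sigma> i) = a i"
proof
  note a = artin_family_carrier[OF assms]
  show "pres_lift E7_vertices artin_relations a \<in> hom A_E7 G"
    unfolding A_E7_def by (rule pres_lift_hom[OF a artin_family_respects[OF assms]])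
  show "pres_lift E7_vertices artin_relations a (\<sigma> i) = a i" if "i \<in> {1..7}" for i
    unfolding \<sigma>_def using that
    by (intro pres_lift_gen[OF a artin_family_respects[OF assms]]) (auto simp: E7_vertices_def)
qed

lemma coxeter_hom_exists:
  assumes a: "artin_family a" and sq: "\<And>i. i \<in> {1..7} \<Longrightarrow> a i \<otimes> a i = \<one>"
  obtains \<phi> where "\<phi> \<in> hom W_E7 G" "\<And>i. i \<in> {1..7} \<Longrightarrow> \<phi> (s i) = a i"
proof
  note car = artin_family_carrier[OF a]
  have resp: "word_eval G a u = word_eval G a v" if uv: "(u, v) \<in> coxeter_relations" for u v
  proof (cases "(u, v) \<in> artin_relations")
    case True
    then show ?thesis by (rule artin_family_respects[OF a])
  next
    case False
    then obtain i where "u = [(i, True), (i, True)]" "v = []" "i \<in> {1..7}"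
      using uv by (auto simp: coxeter_relations_def E7_vertices_def)
    then show ?thesis
      using sq[of i] artin_familyD(1)[OF a, of i] by simp
  qed
  show "pres_lift E7_vertices coxeter_relations a \<in> hom W_E7 G"
    unfolding W_E7_def by (rule pres_lift_hom[OF car resp])
  show "pres_lift E7_vertices coxeter_relations a (s i) = a i" if "i \<in> {1..7}" for i
    unfolding s_def using that by (intro pres_lift_gen[OF car resp]) (auto simp: E7_vertices_def)
qed

end

interpretation A: group A_E7
  by (rule group_A_E7)

lemma \<sigma>_closed: "i \<in> {1..7} \<Longrightarrow> \<sigma> i \<in> carrier A_E7"
  by (simp add: \<sigma>_def A_E7_def pres_gen_closed E7_vertices_def)

lemma A_hom_eqI:
  assumes "group H" "\<phi> \<in> hom A_E7 H" "\<psi> \<in> hom A_E7 H"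
    and "\<And>i. i \<in> {1..7} \<Longrightarrow> \<phi> (\<sigma> i) = \<psi> (\<sigma> i)" and "C \<in> carrier A_E7"
  shows "\<phi> C = \<psi> C"
  using presented_group_hom_eqI[of H \<phi> E7_vertices artin_relations \<psi> C] assms
  by (simp add: A_E7_def \<sigma>_def E7_vertices_def)

lemma A_word_pos:
  "i \<in> {1..7} \<Longrightarrow> w \<in> gwords E7_vertices \<Longrightarrow>
    word_class E7_vertices artin_relations ((i, True) # w) = \<sigma> i \<otimes>\<^bsub>A_E7\<^esub> word_class E7_vertices artin_relations w"
  using word_class_append[of "[(i, True)]" E7_vertices w artin_relations]
  by (simp add: \<sigma>_def A_E7_def word_class_gen E7_vertices_def)

lemma artin_family_\<sigma>: "A.artin_family \<sigma>"
proof (rule A.artin_familyI)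
  show "\<sigma> i \<in> carrier A_E7" if "i \<in> {1..7}" for i
    using that by (rule \<sigma>_closed)
  fix i j :: nat assume ij: "i \<in> {1..7}" "j \<in> {1..7}" "i \<noteq> j"
  have last: "word_class E7_vertices artin_relations [(k, True)] = \<sigma> k" for k
    by (simp add: word_class_gen \<sigma>_def)
  have word: "[(k, True)] \<in> gwords E7_vertices" "[(k, True), (l, True)] \<in> gwords E7_vertices"
    "[(k, True), (l, True), (m, True)] \<in> gwords E7_vertices"
    if "k \<in> {1..7}" "l \<in> {1..7}" "m \<in> {1..7}" for k l m
    using that by (simp_all add: E7_vertices_def)
  show "\<sigma> i \<otimes>\<^bsub>A_E7\<^esub> (\<sigma> j \<otimes>\<^bsub>A_E7\<^esub> \<sigma> i) = \<sigma> j \<otimes>\<^bsub>A_E7\<^esub> (\<sigma> i \<otimes>\<^bsub>A_E7\<^esub> \<sigma> j)" if "{i, j} \<in> E7_edges"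
  proof -
    have "([(i, True), (j, True), (i, True)], [(j, True), (i, True), (j, True)]) \<in> artin_relations"
      using ij that by (auto simp: artin_relations_def E7_vertices_def)
    then have "word_class E7_vertices artin_relations [(i, True), (j, True), (i, True)]
        = word_class E7_vertices artin_relations [(j, True), (i, True), (j, True)]"
      by (rule word_class_relation) (rule word[OF ij(1,2,1)], rule word[OF ij(2,1,2)])
    then show ?thesis
      using A_word_pos[OF ij(1) word(2)[OF ij(2,1,1)]] A_word_pos[OF ij(2) word(1)[OF ij(1,1,1)]]
        A_word_pos[OF ij(2) word(2)[OF ij(1,2,2)]] A_word_pos[OF ij(1) word(1)[OF ij(2,2,2)]]
      by (simp only: last)
  qed
  show "\<sigma> i \<otimes>\<^bsub>A_E7\<^esub> \<sigma> j = \<sigma> j \<otimes>\<^bsub>A_E7\<^esub> \<sigma> i" if "{i, j} \<notin> E7_edges"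
  proof -
    have "([(i, True), (j, True)], [(j, True), (i, True)]) \<in> artin_relations"
      using ij that by (auto simp: artin_relations_def E7_vertices_def)
    then have "word_class E7_vertices artin_relations [(i, True), (j, True)]
        = word_class E7_vertices artin_relations [(j, True), (i, True)]"
      by (rule word_class_relation) (rule word[OF ij(1,2,1)], rule word[OF ij(2,1,2)])
    then show ?thesis
      using A_word_pos[OF ij(1) word(1)[OF ij(2,2,2)]] A_word_pos[OF ij(2) word(1)[OF ij(1,1,1)]]
      by (simp only: last)
  qed
qed

lemma (in group) artin_family_hom:
  assumes \<phi>: "\<phi> \<in> hom A_E7 G"
  shows "artin_family (\<lambda>i. \<phi> (\<sigma> i))"
proof (rule artin_familyI)
  note mult = hom_mult[OF \<phi>] and closed = hom_in_carrier[OF \<phi>]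
  show "\<phi> (\<sigma> i) \<in> carrier G" if "i \<in> {1..7}" for i
    using that by (intro closed \<sigma>_closed)
  fix i j :: nat assume ij: "i \<in> {1..7}" "j \<in> {1..7}" "i \<noteq> j"
  then have c: "\<sigma> i \<in> carrier A_E7" "\<sigma> j \<in> carrier A_E7"
    by (simp_all add: \<sigma>_closed)
  show "\<phi> (\<sigma> i) \<otimes> (\<phi> (\<sigma> j) \<otimes> \<phi> (\<sigma> i)) = \<phi> (\<sigma> j) \<otimes> (\<phi> (\<sigma> i) \<otimes> \<phi> (\<sigma> j))"
    if "{i, j} \<in> E7_edges"
    using A.artin_familyD(2)[OF artin_family_\<sigma> ij that] c by (simp flip: mult)
  show "\<phi> (\<sigma> i) \<otimes> \<phi> (\<sigma> j) = \<phi> (\<sigma> j) \<otimes> \<phi> (\<sigma> i)" if "{i, j} \<notin> E7_edges"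
    using A.artin_familyD(3)[OF artin_family_\<sigma> ij that] c by (simp flip: mult)
qed

lemma W_subgroup_all:
  assumes K: "subgroup K W_E7" and "\<And>i. i \<in> {1..7} \<Longrightarrow> s i \<in> K"
  shows "K = carrier W_E7"
proof
  show "carrier W_E7 \<subseteq> K"
  proof
    fix w assume "w \<in> carrier W_E7"
    then obtain "is" where "set is \<subseteq> {1..7}" "w = W_word is"
      by (rule W_word_exists)
    moreover have "W_word is \<in> K" if "set is \<subseteq> {1..7}" for "is"
      using that by (induction "is")
        (auto simp: W_word_Nil W_word_Cons assms(2) subgroup.one_closed[OF K] intro!: subgroup.m_closed[OF K])
    ultimately show "w \<in> K" by blast
  qed
qed (rule subgroup.subset[OF K])

lemma A_image_subset:
  assumes "\<phi> \<in> hom A_E7 W_E7" "subgroup K W_E7" "\<And>i. i \<in> {1..7} \<Longrightarrow> \<phi> (\<sigma> i) \<in> K"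
  shows "\<phi> ` carrier A_E7 \<subseteq> K"
  using W.presented_image_subset[of \<phi> E7_vertices artin_relations K] assms
  by (simp add: A_E7_def \<sigma>_def E7_vertices_def)

lemma A_image_subgroup: "\<phi> \<in> hom A_E7 W_E7 \<Longrightarrow> subgroup (\<phi> ` carrier A_E7) W_E7"
  by (intro group_hom.img_is_subgroup) (simp add: group_hom_def group_hom_axioms_def A.group_axioms W.group_axioms)

lemma w\<^sub>0_mult_w\<^sub>0_mult:
  assumes "x \<in> carrier W_E7" "y \<in> carrier W_E7"
  shows "w\<^sub>0 \<otimes>\<^bsub>W_E7\<^esub> x \<otimes>\<^bsub>W_E7\<^esub> (w\<^sub>0 \<otimes>\<^bsub>W_E7\<^esub> y) = x \<otimes>\<^bsub>W_E7\<^esub> y"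
proof -
  have "w\<^sub>0 \<otimes>\<^bsub>W_E7\<^esub> x \<otimes>\<^bsub>W_E7\<^esub> (w\<^sub>0 \<otimes>\<^bsub>W_E7\<^esub> y) = x \<otimes>\<^bsub>W_E7\<^esub> w\<^sub>0 \<otimes>\<^bsub>W_E7\<^esub> (w\<^sub>0 \<otimes>\<^bsub>W_E7\<^esub> y)"
    using assms by (simp add: w\<^sub>0_commute)
  also have "\<dots> = x \<otimes>\<^bsub>W_E7\<^esub> (w\<^sub>0 \<otimes>\<^bsub>W_E7\<^esub> w\<^sub>0) \<otimes>\<^bsub>W_E7\<^esub> y"
    using assms w\<^sub>0_closed by (simp add: W.m_assoc)
  finally show ?thesis
    using assms by (simp add: w\<^sub>0_square)
qed

lemma w\<^sub>0_w\<^sub>0_mult: "x \<in> carrier W_E7 \<Longrightarrow> w\<^sub>0 \<otimes>\<^bsub>W_E7\<^esub> (w\<^sub>0 \<otimes>\<^bsub>W_E7\<^esub> x) = x"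
  using w\<^sub>0_closed by (simp add: w\<^sub>0_square flip: W.m_assoc)

text \<open>\<open>w\<^sub>0\<close> is central and both sides of each Artin relation have the same
  number of letters, so it contributes the same factor to both.\<close>

lemma artin_family_w\<^sub>0_mult:
  assumes a: "W.artin_family a"
  shows "W.artin_family (\<lambda>i. w\<^sub>0 \<otimes>\<^bsub>W_E7\<^esub> a i)"
proof (rule W.artin_familyI)
  note closed = W.artin_familyD(1)[OF a]
  have 3: "w\<^sub>0 \<otimes>\<^bsub>W_E7\<^esub> x \<otimes>\<^bsub>W_E7\<^esub> (w\<^sub>0 \<otimes>\<^bsub>W_E7\<^esub> y \<otimes>\<^bsub>W_E7\<^esub> (w\<^sub>0 \<otimes>\<^bsub>W_E7\<^esub> z)) = w\<^sub>0 \<otimes>\<^bsub>W_E7\<^esub> (x \<otimes>\<^bsub>W_E7\<^esub> (y \<otimes>\<^bsub>W_E7\<^esub> z))"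
    if "x \<in> carrier W_E7" "y \<in> carrier W_E7" "z \<in> carrier W_E7" for x y z
    unfolding w\<^sub>0_mult_w\<^sub>0_mult[OF that(2,3)] using that w\<^sub>0_closed by (simp add: W.m_assoc)
  show "w\<^sub>0 \<otimes>\<^bsub>W_E7\<^esub> a i \<in> carrier W_E7" if "i \<in> {1..7}" for i
    using closed[OF that] w\<^sub>0_closed by simp
  fix i j :: nat assume ij: "i \<in> {1..7}" "j \<in> {1..7}" "i \<noteq> j"
  note c = closed[OF ij(1)] closed[OF ij(2)]
  show "w\<^sub>0 \<otimes>\<^bsub>W_E7\<^esub> a i \<otimes>\<^bsub>W_E7\<^esub> (w\<^sub>0 \<otimes>\<^bsub>W_E7\<^esub> a j \<otimes>\<^bsub>W_E7\<^esub> (w\<^sub>0 \<otimes>\<^bsub>W_E7\<^esub> a i))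
      = w\<^sub>0 \<otimes>\<^bsub>W_E7\<^esub> a j \<otimes>\<^bsub>W_E7\<^esub> (w\<^sub>0 \<otimes>\<^bsub>W_E7\<^esub> a i \<otimes>\<^bsub>W_E7\<^esub> (w\<^sub>0 \<otimes>\<^bsub>W_E7\<^esub> a j))" if "{i, j} \<in> E7_edges"
    using W.artin_familyD(2)[OF a ij that] c by (simp only: 3)
  show "w\<^sub>0 \<otimes>\<^bsub>W_E7\<^esub> a i \<otimes>\<^bsub>W_E7\<^esub> (w\<^sub>0 \<otimes>\<^bsub>W_E7\<^esub> a j) = w\<^sub>0 \<otimes>\<^bsub>W_E7\<^esub> a j \<otimes>\<^bsub>W_E7\<^esub> (w\<^sub>0 \<otimes>\<^bsub>W_E7\<^esub> a i)"
    if "{i, j} \<notin> E7_edges"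
    using W.artin_familyD(3)[OF a ij that] c by (simp only: w\<^sub>0_mult_w\<^sub>0_mult)
qed

lemma artin_family_s: "W.artin_family s"
  by (intro W.artin_familyI s_closed s_braid s_comm)

section \<open>Up-to-center-epimorphisms are ordinary\<close>

lemma up_to_center_cases:
  assumes "\<phi> \<in> up_to_center_epis A_E7 W_E7" "w \<in> carrier W_E7"
  shows "w \<in> \<phi> ` carrier A_E7 \<or> w\<^sub>0 \<otimes>\<^bsub>W_E7\<^esub> w \<in> \<phi> ` carrier A_E7"
proof -
  have hom: "\<phi> \<in> hom A_E7 W_E7"
    using assms(1) by (simp add: up_to_center_epis_def homs_def)
  have "w \<in> (\<phi> ` carrier A_E7) <#>\<^bsub>W_E7\<^esub> center W_E7"
    using assms by (auto simp: up_to_center_epis_def)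
  then obtain h z where h: "h \<in> \<phi> ` carrier A_E7" "z = \<one>\<^bsub>W_E7\<^esub> \<or> z = w\<^sub>0" "w = h \<otimes>\<^bsub>W_E7\<^esub> z"
    by (auto simp: set_mult_def center_W_E7)
  then have "h \<in> carrier W_E7"
    using hom_in_carrier[OF hom] by auto
  then show ?thesis
    using h by (auto simp: w\<^sub>0_w\<^sub>0_mult simp flip: w\<^sub>0_commute)
qed

text \<open>If \<open>y\<close> in \<open>X\<close> is not orthogonal to a simple root, then
  \<open>y - reflection i y\<close> is a nonzero multiple of that root, which therefore lies in
  \<open>X\<close>. A nonzero vector gives one such root as the roots span, and adjacent roots are
  not orthogonal.\<close>

lemma reflections_irreducible:
  assumes X: "vec.subspace X" and inv: "\<And>i. i \<in> {1..7} \<Longrightarrow> reflection i ` X \<subseteq> X" and ne: "X \<noteq> {0}"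
  shows "X = UNIV"
proof -
  obtain x where x: "x \<in> X" "x \<noteq> 0"
    using ne vec.subspace_0[OF X] by auto
  have root: "simple_root i \<in> X" if i: "i \<in> {1..7}" and y: "y \<in> X" "cinner y (simple_root i) \<noteq> 0" for i y
  proof -
    have "y - reflection i y \<in> X"
      using inv[OF i] y by (intro vec.subspace_diff[OF X]) auto
    then have "(2 / cinner y (simple_root i)) *s ((cinner y (simple_root i) / 2) *s simple_root i) \<in> X"
      by (intro vec.subspace_scale[OF X, of _ "2 / cinner y (simple_root i)"]) (simp add: reflection_def)
    then show ?thesis
      using y by simp
  qed
  have "\<exists>i\<in>{1..7}. cinner x (simple_root i) \<noteq> 0"
  proof (rule ccontr)
    assume "\<not> ?thesis"
    then have "vec.span (simple_root ` {1..7}) \<subseteq> perp {x}"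
      by (intro vec.span_minimal subspace_perp) (auto simp: perp_def cinner_commute[of x])
    then have "x \<in> perp {x}"
      using span_simple_root by blast
    then show False
      using x by (simp add: perp_def)
  qed
  then obtain i where i: "i \<in> {1..7}" "simple_root i \<in> X"
    using root x by blast
  have step: "simple_root j \<in> X" if ij: "i \<in> {1..7}" "j \<in> {1..7}" "i \<noteq> j" "{i, j} \<in> E7_edges" "simple_root i \<in> X" for i j
    using ij by (intro root[OF ij(2,5)]) (simp add: cinner_simple_root)
  have "simple_root i \<in> X \<longrightarrow> simple_root 1 \<in> X"
    by (rule E7_connected[of "\<lambda>i. simple_root i \<in> X \<longrightarrow> simple_root 1 \<in> X", OF _ _ i(1)])
      (use step in \<open>auto simp: insert_commute\<close>)
  then have 1: "simple_root 1 \<in> X"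
    using i by simp
  have "simple_root j \<in> X" if "j \<in> {1..7}" for j
    by (rule E7_connected[of "\<lambda>i. simple_root i \<in> X" j, OF 1 _ that]) (rule step)
  then have "vec.span (simple_root ` {1..7}) \<subseteq> X"
    by (intro vec.span_minimal X) auto
  then show ?thesis
    using span_simple_root by auto
qed

lemma stabilizer_subgroup:
  assumes X: "vec.subspace X"
  shows "subgroup {w \<in> carrier W_E7. rho w ` X \<subseteq> X} W_E7"
proof (rule W.subgroupI)
  show "{w \<in> carrier W_E7. rho w ` X \<subseteq> X} \<noteq> {}"
    using rho_one by (auto intro!: exI[of _ "\<one>\<^bsub>W_E7\<^esub>"])
  fix v assume "v \<in> {w \<in> carrier W_E7. rho w ` X \<subseteq> X}"
  then have v: "v \<in> carrier W_E7" "rho v ` X \<subseteq> X"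
    by auto
  have "rho (inv\<^bsub>W_E7\<^esub> v) x \<in> X" if "x \<in> X" for x
  proof -
    have "rho v (rho (inv\<^bsub>W_E7\<^esub> v) x) = rho (v \<otimes>\<^bsub>W_E7\<^esub> inv\<^bsub>W_E7\<^esub> v) x"
      using rho_mult[of v "inv\<^bsub>W_E7\<^esub> v"] v by simp
    then have "rho v (rho (inv\<^bsub>W_E7\<^esub> v) x) \<in> X"
      using v that by (simp add: rho_one)
    then show ?thesis
      using finite_unitary_mem_iff[OF finite_unitary_rho[OF v(1)] v(2)] by blast
  qed
  then show "inv\<^bsub>W_E7\<^esub> v \<in> {w \<in> carrier W_E7. rho w ` X \<subseteq> X}"
    using v by auto
  fix w assume "w \<in> {w \<in> carrier W_E7. rho w ` X \<subseteq> X}"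
  then show "v \<otimes>\<^bsub>W_E7\<^esub> w \<in> {w \<in> carrier W_E7. rho w ` X \<subseteq> X}"
    using v by (auto simp: rho_mult)
qed auto

text \<open>The representation stays irreducible after composition with \<open>\<phi>\<close>: the
  image and \<open>w\<^sub>0\<close> give all of W, and \<open>w\<^sub>0\<close> acts as -1, which
  preserves every subspace.\<close>

lemma up_to_center_epi_involution:
  assumes \<phi>: "\<phi> \<in> up_to_center_epis A_E7 W_E7" and i: "i \<in> {1..7}"
  shows "\<phi> (\<sigma> i) \<otimes>\<^bsub>W_E7\<^esub> \<phi> (\<sigma> i) = \<one>\<^bsub>W_E7\<^esub>"
proof (rule rho_faithful)
  have hom: "\<phi> \<in> hom A_E7 W_E7"
    using \<phi> by (simp add: up_to_center_epis_def homs_def)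
  note fam = W.artin_family_hom[OF hom]
  note closed = W.artin_familyD(1)[OF fam]
  define F where "F i = rho (\<phi> (\<sigma> i))" for i
  show "\<phi> (\<sigma> i) \<otimes>\<^bsub>W_E7\<^esub> \<phi> (\<sigma> i) \<in> carrier W_E7"
    using closed[OF i] by simp
  have "F i (F i x) = x" for x
  proof (rule E7_braid_rep[OF _ _ _ _ _ _ i])
    show "CARD(7) = 7" by simp
    fix i :: nat and x assume i: "i \<in> {1..7}"
    show "finite_unitary (F i)"
      unfolding F_def by (rule finite_unitary_rho[OF closed[OF i]])
    show "F i (cnj_vec x) = cnj_vec (F i x)"
      unfolding F_def by (rule rho_cnj_vec[OF closed[OF i]])
    fix j assume j: "j \<in> {1..7}" "i \<noteq> j"
    have m: "F i (F j x) = rho (\<phi> (\<sigma> i) \<otimes>\<^bsub>W_E7\<^esub> \<phi> (\<sigma> j)) x" if "i \<in> {1..7}" "j \<in> {1..7}" for i j x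
      using closed that by (simp add: F_def rho_mult)
    have m3: "F i (F j (F k x)) = rho (\<phi> (\<sigma> i) \<otimes>\<^bsub>W_E7\<^esub> (\<phi> (\<sigma> j) \<otimes>\<^bsub>W_E7\<^esub> \<phi> (\<sigma> k))) x"
      if "i \<in> {1..7}" "j \<in> {1..7}" "k \<in> {1..7}" for i j k x
      using closed that by (simp add: F_def rho_mult)
    show "F i (F j x) = F j (F i x)" if "{i, j} \<notin> E7_edges"
      using W.artin_familyD(3)[OF fam i j that] i j by (simp add: m)
    show "F i (F j (F i x)) = F j (F i (F j x))" if "{i, j} \<in> E7_edges"
      using W.artin_familyD(2)[OF fam i j that] i j by (simp add: m3)
  next
    fix X assume X: "vec.subspace X" "\<And>i. i \<in> {1..7} \<Longrightarrow> F i ` X \<subseteq> X" "X \<noteq> {0}"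
    let ?K = "{w \<in> carrier W_E7. rho w ` X \<subseteq> X}"
    have sub: "\<phi> ` carrier A_E7 \<subseteq> ?K"
      using X(2) closed by (intro A_image_subset hom stabilizer_subgroup X(1)) (auto simp: F_def)
    show "X = UNIV"
    proof (rule reflections_irreducible[OF X(1) _ X(3)])
      fix i :: nat assume i: "i \<in> {1..7}"
      have "rho (s i) x \<in> X" if x: "x \<in> X" for x
        using up_to_center_cases[OF \<phi> s_closed[OF i]]
      proof
        assume "s i \<in> \<phi> ` carrier A_E7"
        then show ?thesis
          using sub x by blast
      next
        assume "w\<^sub>0 \<otimes>\<^bsub>W_E7\<^esub> s i \<in> \<phi> ` carrier A_E7"
        then have "rho (w\<^sub>0 \<otimes>\<^bsub>W_E7\<^esub> s i) x \<in> X"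
          using sub x by blast
        then have "- rho (s i) x \<in> X"
          using s_closed[OF i] by (simp add: rho_mult w\<^sub>0_closed rho_w\<^sub>0)
        then show ?thesis
          using vec.subspace_neg[OF X(1), of "- rho (s i) x"] by simp
      qed
      then show "reflection i ` X \<subseteq> X"
        using i by (auto simp: rho_s)
    qed
  qed
  then show "rho (\<phi> (\<sigma> i) \<otimes>\<^bsub>W_E7\<^esub> \<phi> (\<sigma> i)) = id"
    using closed[OF i] by (auto simp: rho_mult F_def)
qed

section \<open>Proper up-to-center-epimorphisms\<close>

lemma even_subgroup: "subgroup {w \<in> carrier W_E7. even (W_length w)} W_E7"
proof (rule W.subgroupI)
  have one: "even (W_length \<one>\<^bsub>W_E7\<^esub>)"
    using W_length_parity[of "[]"] by (simp add: W_word_Nil)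
  then show "{w \<in> carrier W_E7. even (W_length w)} \<noteq> {}"
    by blast
  show "inv\<^bsub>W_E7\<^esub> v \<in> {w \<in> carrier W_E7. even (W_length w)}"
    if "v \<in> {w \<in> carrier W_E7. even (W_length w)}" for v
    using that one W_length_mult_parity[of v "inv\<^bsub>W_E7\<^esub> v"] by auto
qed (auto simp: W_length_mult_parity)

lemma w\<^sub>0_mult_parity: "w \<in> carrier W_E7 \<Longrightarrow> even (W_length (w\<^sub>0 \<otimes>\<^bsub>W_E7\<^esub> w)) \<longleftrightarrow> odd (W_length w)"
  using w\<^sub>0_odd by (simp add: W_length_mult_parity w\<^sub>0_closed)

text \<open>A single \<open>s i\<close> in the image would bring in all of them, so a proper image
  contains every product of \<open>w\<^sub>0\<close> with a generator, hence all even elements. With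
  an odd element it would contain \<open>w\<^sub>0\<close>, and then every
  \<open>s j\<close>.\<close>

lemma proper_image_even:
  assumes \<phi>: "\<phi> \<in> proper_up_to_center_epis A_E7 W_E7" and h: "h \<in> \<phi> ` carrier A_E7"
  shows "even (W_length h)"
proof (rule ccontr)
  assume odd: "odd (W_length h)"
  have epi: "\<phi> \<in> up_to_center_epis A_E7 W_E7" and proper: "\<phi> ` carrier A_E7 \<noteq> carrier W_E7"
    and hom: "\<phi> \<in> hom A_E7 W_E7"
    using \<phi> by (auto simp: proper_up_to_center_epis_def up_to_center_epis_def homs_def)
  define H where "H = \<phi> ` carrier A_E7"
  have H: "subgroup H W_E7"
    unfolding H_def by (rule A_image_subgroup[OF hom])
  note mult = subgroup.m_closed[OF H] and sub = subgroup.mem_carrier[OF H]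
  have cases: "w \<in> H \<or> w\<^sub>0 \<otimes>\<^bsub>W_E7\<^esub> w \<in> H" if "w \<in> carrier W_E7" for w
    unfolding H_def by (rule up_to_center_cases[OF epi that])
  \<comment> \<open>The two factors \<open>w\<^sub>0\<close> in \<open>?t\<close>,
    \<open>s i\<close>, \<open>?t\<close> cancel, leaving the braid word in \<open>s j\<close> and
    \<open>s i\<close>. Rewritten by the braid relation it begins and ends with \<open>s i\<close>,
    and these can be stripped off inside \<open>H\<close>.\<close>
  have step: "s j \<in> H" if ij: "i \<in> {1..7}" "j \<in> {1..7}" "i \<noteq> j" "{i, j} \<in> E7_edges" and si: "s i \<in> H" for i j
  proof (rule ccontr)
    let ?t = "w\<^sub>0 \<otimes>\<^bsub>W_E7\<^esub> s j"
    assume nj: "s j \<notin> H"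
    then have t: "?t \<in> H"
      using cases[OF s_closed[OF ij(2)]] by blast
    note c = s_closed[OF ij(1)] s_closed[OF ij(2)]
    have "?t \<otimes>\<^bsub>W_E7\<^esub> (s i \<otimes>\<^bsub>W_E7\<^esub> ?t) = s j \<otimes>\<^bsub>W_E7\<^esub> (s i \<otimes>\<^bsub>W_E7\<^esub> s j)"
    proof -
      have "s i \<otimes>\<^bsub>W_E7\<^esub> ?t = w\<^sub>0 \<otimes>\<^bsub>W_E7\<^esub> (s i \<otimes>\<^bsub>W_E7\<^esub> s j)"
        using c w\<^sub>0_closed w\<^sub>0_commute[OF c(1)] by (metis W.m_assoc)
      then show ?thesis
        using c by (simp add: w\<^sub>0_mult_w\<^sub>0_mult)
    qed
    also have "\<dots> = s i \<otimes>\<^bsub>W_E7\<^esub> (s j \<otimes>\<^bsub>W_E7\<^esub> s i)"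
      using s_braid[OF ij(1-4)] by simp
    finally have "s i \<otimes>\<^bsub>W_E7\<^esub> (s j \<otimes>\<^bsub>W_E7\<^esub> s i) \<in> H"
      using mult[OF t mult[OF si t]] by simp
    then have "s i \<otimes>\<^bsub>W_E7\<^esub> (s i \<otimes>\<^bsub>W_E7\<^esub> (s j \<otimes>\<^bsub>W_E7\<^esub> s i)) \<otimes>\<^bsub>W_E7\<^esub> s i \<in> H"
      using mult si by blast
    moreover have "s i \<otimes>\<^bsub>W_E7\<^esub> (s i \<otimes>\<^bsub>W_E7\<^esub> (s j \<otimes>\<^bsub>W_E7\<^esub> s i)) = s j \<otimes>\<^bsub>W_E7\<^esub> s i"
      using c ij(1) by (simp add: s_s flip: W.m_assoc)
    ultimately show False
      using nj mult_s_s[OF c(2) ij(1)] by simp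
  qed
  have not1: "s 1 \<notin> H"
  proof
    assume 1: "s 1 \<in> H"
    have "s j \<in> H" if "j \<in> {1..7}" for j
      by (rule E7_connected[of "\<lambda>j. s j \<in> H" j, OF 1 _ that]) (rule step)
    then have "H = carrier W_E7"
      by (rule W_subgroup_all[OF H])
    then show False
      using proper by (simp add: H_def)
  qed
  have "s j \<in> H \<longrightarrow> s 1 \<in> H" if "j \<in> {1..7}" for j
    by (rule E7_connected[of "\<lambda>j. s j \<in> H \<longrightarrow> s 1 \<in> H", OF _ _ that])
      (use step in \<open>auto simp: insert_commute\<close>)
  then have gen: "w\<^sub>0 \<otimes>\<^bsub>W_E7\<^esub> s j \<in> H" if "j \<in> {1..7}" for j
    using not1 cases[OF s_closed[OF that]] that by blast
  \<comment> \<open>Pairs of factors \<open>w\<^sub>0\<close> cancel, so a word in the generators is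
    in \<open>H\<close> up to one \<open>w\<^sub>0\<close> per letter, counted modulo 2.\<close>
  have words: "if even (length is) then W_word is \<in> H else w\<^sub>0 \<otimes>\<^bsub>W_E7\<^esub> W_word is \<in> H"
    if "set is \<subseteq> {1..7}" for "is"
    using that
  proof (induction "is")
    case Nil
    then show ?case by (simp add: W_word_Nil subgroup.one_closed[OF H])
  next
    case (Cons i "is")
    then have i: "i \<in> {1..7}" "set is \<subseteq> {1..7}"
      by auto
    note c = s_closed[OF i(1)] W_word_closed[OF i(2)]
    show ?case
    proof (cases "even (length is)")
      case True
      then have "w\<^sub>0 \<otimes>\<^bsub>W_E7\<^esub> s i \<otimes>\<^bsub>W_E7\<^esub> W_word is \<in> H"
        using Cons.IH[OF i(2)] mult[OF gen[OF i(1)]] by simp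
      then show ?thesis
        using True i c w\<^sub>0_closed by (simp add: W_word_Cons W.m_assoc)
    next
      case False
      then have "w\<^sub>0 \<otimes>\<^bsub>W_E7\<^esub> s i \<otimes>\<^bsub>W_E7\<^esub> (w\<^sub>0 \<otimes>\<^bsub>W_E7\<^esub> W_word is) \<in> H"
        using Cons.IH[OF i(2)] mult[OF gen[OF i(1)]] by simp
      then show ?thesis
        using False i c by (simp add: W_word_Cons w\<^sub>0_mult_w\<^sub>0_mult)
    qed
  qed
  have hH: "h \<in> H"
    using h by (simp add: H_def)
  obtain "is" where is': "set is \<subseteq> {1..7}" "h = W_word is"
    using W_word_exists[OF sub[OF hH]] by blast
  then have "w\<^sub>0 \<otimes>\<^bsub>W_E7\<^esub> h \<in> H"
    using words[OF is'(1)] W_length_parity[OF is'(1)] odd by simp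
  then have "w\<^sub>0 \<otimes>\<^bsub>W_E7\<^esub> h \<otimes>\<^bsub>W_E7\<^esub> inv\<^bsub>W_E7\<^esub> h \<in> H"
    using mult subgroup.m_inv_closed[OF H hH] by blast
  then have "w\<^sub>0 \<in> H"
    using sub[OF hH] w\<^sub>0_closed by (simp add: W.m_assoc)
  have "s j \<in> H" if j: "j \<in> {1..7}" for j
    using mult[OF \<open>w\<^sub>0 \<in> H\<close> gen[OF j]] s_closed[OF j] by (simp add: w\<^sub>0_w\<^sub>0_mult)
  then show False
    using not1 by simp
qed

text \<open>Everything hinges on \<open>\<beta> w\<^sub>0 = w\<^sub>0\<close>: it turns the
  definition of \<open>\<beta>\<close> on generators into the required formula and puts both
  \<open>w\<^sub>0\<close> and all \<open>a i\<close> into the image of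
  \<open>\<beta>\<close>.\<close>

lemma proper_hom_automorphism:
  assumes \<phi>: "\<phi> \<in> proper_up_to_center_epis A_E7 W_E7"
  obtains \<alpha> where "\<alpha> \<in> auto W_E7" "\<And>i. i \<in> {1..7} \<Longrightarrow> \<alpha> (w\<^sub>0 \<otimes>\<^bsub>W_E7\<^esub> s i) = \<phi> (\<sigma> i)"
proof -
  have epi: "\<phi> \<in> up_to_center_epis A_E7 W_E7" and hom: "\<phi> \<in> hom A_E7 W_E7"
    using \<phi> by (auto simp: proper_up_to_center_epis_def up_to_center_epis_def homs_def)
  define a where "a i = \<phi> (\<sigma> i)" for i
  have fam: "W.artin_family a"
    unfolding a_def by (rule W.artin_family_hom[OF hom])
  note closed = W.artin_familyD(1)[OF fam]
  have "w\<^sub>0 \<otimes>\<^bsub>W_E7\<^esub> a i \<otimes>\<^bsub>W_E7\<^esub> (w\<^sub>0 \<otimes>\<^bsub>W_E7\<^esub> a i) = \<one>\<^bsub>W_E7\<^esub>" if i: "i \<in> {1..7}" for i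
    using up_to_center_epi_involution[OF epi i] closed[OF i] by (simp add: w\<^sub>0_mult_w\<^sub>0_mult a_def)
  then obtain \<beta> where \<beta>: "\<beta> \<in> hom W_E7 W_E7" "\<And>i. i \<in> {1..7} \<Longrightarrow> \<beta> (s i) = w\<^sub>0 \<otimes>\<^bsub>W_E7\<^esub> a i"
    using W.coxeter_hom_exists[OF artin_family_w\<^sub>0_mult[OF fam]] by metis
  interpret \<beta>: group_hom W_E7 W_E7 \<beta>
    by unfold_locales (rule \<beta>(1))
  have a_even: "even (W_length (a i))" if i: "i \<in> {1..7}" for i
    using proper_image_even[OF \<phi>] \<sigma>_closed[OF i] by (simp add: a_def)
  have \<beta>_parity: "even (W_length (\<beta> w)) = even (W_length w)" if w: "w \<in> carrier W_E7" for w
  proof -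
    obtain "is" where is': "set is \<subseteq> {1..7}" "w = W_word is"
      using w by (rule W_word_exists)
    have "even (W_length (\<beta> (W_word is))) = even (W_length (W_word is))"
      using is'(1)
    proof (induction "is")
      case Nil
      then show ?case by (simp add: W_word_Nil)
    next
      case (Cons i "is")
      then have i: "i \<in> {1..7}" "set is \<subseteq> {1..7}"
        by auto
      have "odd (W_length (\<beta> (s i)))"
        using a_even[OF i(1)] closed[OF i(1)] by (simp add: \<beta>(2)[OF i(1)] w\<^sub>0_mult_parity)
      then show ?case
        using Cons.IH[OF i(2)] i W_length_s_odd[OF i(1)]
        by (simp add: W_word_Cons W_length_mult_parity s_closed W_word_closed)
    qed
    then show ?thesis
      by (simp add: is')
  qed
  have cw: "\<beta> w\<^sub>0 \<in> carrier W_E7"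
    by (simp add: w\<^sub>0_closed)
  \<comment> \<open>The centralizer of \<open>\<beta> w\<^sub>0\<close> contains
    \<open>w\<^sub>0\<close> and the image of \<open>\<beta>\<close>, hence every
    \<open>a i\<close>, and these generate W. So \<open>\<beta> w\<^sub>0\<close> is central, and
    being odd it is not trivial.\<close>
  define C where "C = {x \<in> carrier W_E7. \<beta> w\<^sub>0 \<otimes>\<^bsub>W_E7\<^esub> x = x \<otimes>\<^bsub>W_E7\<^esub> \<beta> w\<^sub>0}"
  have C: "subgroup C W_E7"
  proof (rule W.subgroupI)
    show "C \<noteq> {}"
      using cw by (auto simp: C_def intro!: exI[of _ "\<one>\<^bsub>W_E7\<^esub>"])
    show "inv\<^bsub>W_E7\<^esub> x \<in> C" if "x \<in> C" for x
    proof -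
      have x: "x \<in> carrier W_E7" "\<beta> w\<^sub>0 \<otimes>\<^bsub>W_E7\<^esub> x = x \<otimes>\<^bsub>W_E7\<^esub> \<beta> w\<^sub>0"
        using that by (auto simp: C_def)
      have "inv\<^bsub>W_E7\<^esub> x \<otimes>\<^bsub>W_E7\<^esub> \<beta> w\<^sub>0 = inv\<^bsub>W_E7\<^esub> x \<otimes>\<^bsub>W_E7\<^esub> (\<beta> w\<^sub>0 \<otimes>\<^bsub>W_E7\<^esub> x) \<otimes>\<^bsub>W_E7\<^esub> inv\<^bsub>W_E7\<^esub> x"
        using x(1) cw by (simp add: W.m_assoc)
      also have "\<dots> = inv\<^bsub>W_E7\<^esub> x \<otimes>\<^bsub>W_E7\<^esub> (x \<otimes>\<^bsub>W_E7\<^esub> \<beta> w\<^sub>0) \<otimes>\<^bsub>W_E7\<^esub> inv\<^bsub>W_E7\<^esub> x"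
        by (simp only: x(2))
      also have "\<dots> = \<beta> w\<^sub>0 \<otimes>\<^bsub>W_E7\<^esub> inv\<^bsub>W_E7\<^esub> x"
        using x(1) cw by (simp flip: W.m_assoc)
      finally have "inv\<^bsub>W_E7\<^esub> x \<otimes>\<^bsub>W_E7\<^esub> \<beta> w\<^sub>0 = \<beta> w\<^sub>0 \<otimes>\<^bsub>W_E7\<^esub> inv\<^bsub>W_E7\<^esub> x" .
      then show ?thesis
        using x by (simp add: C_def)
    qed
    show "x \<otimes>\<^bsub>W_E7\<^esub> y \<in> C" if "x \<in> C" "y \<in> C" for x y
    proof -
      have x: "x \<in> carrier W_E7" "\<beta> w\<^sub>0 \<otimes>\<^bsub>W_E7\<^esub> x = x \<otimes>\<^bsub>W_E7\<^esub> \<beta> w\<^sub>0"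
        and y: "y \<in> carrier W_E7" "\<beta> w\<^sub>0 \<otimes>\<^bsub>W_E7\<^esub> y = y \<otimes>\<^bsub>W_E7\<^esub> \<beta> w\<^sub>0"
        using that by (auto simp: C_def)
      have "\<beta> w\<^sub>0 \<otimes>\<^bsub>W_E7\<^esub> (x \<otimes>\<^bsub>W_E7\<^esub> y) = x \<otimes>\<^bsub>W_E7\<^esub> y \<otimes>\<^bsub>W_E7\<^esub> \<beta> w\<^sub>0"
        using x y cw by (metis W.m_assoc)
      then show ?thesis
        using x y by (simp add: C_def)
    qed
  qed (auto simp: C_def)
  have w0C: "w\<^sub>0 \<in> C"
    using cw w\<^sub>0_closed by (simp add: C_def w\<^sub>0_commute)
  have \<beta>C: "\<beta> x \<in> C" if x: "x \<in> carrier W_E7" for x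
  proof -
    have "\<beta> (w\<^sub>0 \<otimes>\<^bsub>W_E7\<^esub> x) = \<beta> (x \<otimes>\<^bsub>W_E7\<^esub> w\<^sub>0)"
      using x by (simp only: w\<^sub>0_commute)
    then show ?thesis
      using x w\<^sub>0_closed by (simp add: C_def)
  qed
  have aC: "a i \<in> C" if i: "i \<in> {1..7}" for i
    using subgroup.m_closed[OF C w0C \<beta>C[OF s_closed[OF i]]] closed[OF i]
    by (simp add: \<beta>(2)[OF i] w\<^sub>0_w\<^sub>0_mult)
  have image_generates: "K = carrier W_E7"
    if K: "subgroup K W_E7" "w\<^sub>0 \<in> K" "\<And>i. i \<in> {1..7} \<Longrightarrow> a i \<in> K" for K
  proof (rule W_subgroup_all[OF K(1)])
    fix i :: nat assume i: "i \<in> {1..7}"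
    have sub: "\<phi> ` carrier A_E7 \<subseteq> K"
      using K(3) by (intro A_image_subset[OF hom K(1)]) (auto simp: a_def)
    show "s i \<in> K"
      using up_to_center_cases[OF epi s_closed[OF i]]
    proof
      assume "w\<^sub>0 \<otimes>\<^bsub>W_E7\<^esub> s i \<in> \<phi> ` carrier A_E7"
      then have "w\<^sub>0 \<otimes>\<^bsub>W_E7\<^esub> (w\<^sub>0 \<otimes>\<^bsub>W_E7\<^esub> s i) \<in> K"
        using subgroup.m_closed[OF K(1,2)] sub by blast
      then show ?thesis
        using s_closed[OF i] by (simp add: w\<^sub>0_w\<^sub>0_mult)
    qed (use sub in auto)
  qed
  have "C = carrier W_E7"
    by (rule image_generates[OF C w0C aC])
  then have "\<beta> w\<^sub>0 \<in> center W_E7"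
    using cw by (auto simp: center_def C_def)
  moreover have "\<beta> w\<^sub>0 \<noteq> \<one>\<^bsub>W_E7\<^esub>"
  proof
    assume "\<beta> w\<^sub>0 = \<one>\<^bsub>W_E7\<^esub>"
    then have "odd (W_length \<one>\<^bsub>W_E7\<^esub>)"
      using \<beta>_parity[OF w\<^sub>0_closed] w\<^sub>0_odd by simp
    then show False
      using W_length_parity[of "[]"] by (simp add: W_word_Nil)
  qed
  ultimately have \<beta>w: "\<beta> w\<^sub>0 = w\<^sub>0"
    by (simp add: center_W_E7)
  \<comment> \<open>\<open>a i\<close> is \<open>w\<^sub>0\<close> times
    \<open>\<beta> (s i)\<close>, and \<open>w\<^sub>0\<close> is now in the image; W is finite, so
    surjectivity gives bijectivity.\<close>
  have surj: "\<beta> ` carrier W_E7 = carrier W_E7"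
  proof (rule image_generates)
    show K: "subgroup (\<beta> ` carrier W_E7) W_E7"
      by (rule \<beta>.img_is_subgroup)
    show w0K: "w\<^sub>0 \<in> \<beta> ` carrier W_E7"
      using \<beta>w w\<^sub>0_closed by (metis imageI)
    fix i :: nat assume i: "i \<in> {1..7}"
    have "w\<^sub>0 \<otimes>\<^bsub>W_E7\<^esub> \<beta> (s i) \<in> \<beta> ` carrier W_E7"
      using s_closed[OF i] by (intro subgroup.m_closed[OF K w0K]) auto
    then show "a i \<in> \<beta> ` carrier W_E7"
      using closed[OF i] by (simp add: \<beta>(2)[OF i] w\<^sub>0_w\<^sub>0_mult)
  qed
  then have "bij_betw \<beta> (carrier W_E7) (carrier W_E7)"
    unfolding bij_betw_def using finite_W_E7 by (simp add: eq_card_imp_inj_on)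
  show thesis
  proof (rule that)
    show "restrict \<beta> (carrier W_E7) \<in> auto W_E7"
      using \<open>bij_betw \<beta> (carrier W_E7) (carrier W_E7)\<close>
      by (auto simp: auto_def Bij_def hom_def bij_betw_restrict_eq)
    show "restrict \<beta> (carrier W_E7) (w\<^sub>0 \<otimes>\<^bsub>W_E7\<^esub> s i) = \<phi> (\<sigma> i)" if i: "i \<in> {1..7}" for i
      using w\<^sub>0_closed s_closed[OF i] closed[OF i] i by (simp add: \<beta>w \<beta>(2) w\<^sub>0_w\<^sub>0_mult) (simp add: a_def)
  qed
qed

section \<open>The equivalence of homomorphisms and its unique class\<close>

text \<open>Automorphisms are extensional on the carrier, so identity, inverse and composite are
  restricted to it.\<close>

lemma equiv_hom_equiv:
  assumes "group G" "group H"
  shows "equiv (homs G H) (hom_equiv G H)"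
proof -
  interpret H: group H by (rule assms(2))
  have range: "\<phi> \<in> carrier G \<rightarrow> carrier H" "\<phi> \<in> extensional (carrier G)" if "\<phi> \<in> homs G H" for \<phi>
    using that by (auto simp: homs_def hom_def)
  show ?thesis
  proof (rule equivI)
    show "hom_equiv G H \<subseteq> homs G H \<times> homs G H"
      by (auto simp: hom_equiv_def)
    show "refl_on (homs G H) (hom_equiv G H)"
    proof (rule refl_onI)
      fix \<phi> assume \<phi>: "\<phi> \<in> homs G H"
      have "\<phi> = compose (carrier G) (\<lambda>x\<in>carrier H. x) \<phi>"
        using range[OF \<phi>] by (auto simp: compose_def fun_eq_iff extensional_def)
      then show "(\<phi>, \<phi>) \<in> hom_equiv G H"
        using \<phi> H.id_in_auto by (auto simp: hom_equiv_def)
    qed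
    show "Relation.sym (hom_equiv G H)"
    proof (rule symI)
      fix \<phi> \<psi> assume "(\<phi>, \<psi>) \<in> hom_equiv G H"
      then obtain \<alpha> where \<alpha>: "\<alpha> \<in> auto H" "\<psi> = compose (carrier G) \<alpha> \<phi>"
        and \<phi>: "\<phi> \<in> homs G H" "\<psi> \<in> homs G H"
        by (auto simp: hom_equiv_def)
      let ?\<beta> = "restrict (inv_into (carrier H) \<alpha>) (carrier H)"
      have "\<alpha> \<in> hom H H" "\<alpha> \<in> Bij (carrier H)"
        using \<alpha>(1) by (auto simp: auto_def)
      then have "?\<beta> \<in> auto H"
        by (simp add: auto_def H.restrict_inv_into_hom restrict_inv_into_Bij)
      moreover have "\<phi> = compose (carrier G) ?\<beta> \<psi>"
      proof
        fix g
        show "\<phi> g = compose (carrier G) ?\<beta> \<psi> g"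
        proof (cases "g \<in> carrier G")
          case True
          then have "\<phi> g \<in> carrier H" "\<alpha> (\<phi> g) \<in> carrier H"
            using range(1)[OF \<phi>(1)] \<open>\<alpha> \<in> hom H H\<close> by (auto simp: hom_def)
          then show ?thesis
            using True \<open>\<alpha> \<in> Bij (carrier H)\<close>
            by (simp add: \<alpha>(2) compose_def Bij_def bij_betw_def inv_into_f_f)
        qed (use range(2)[OF \<phi>(1)] in \<open>simp add: compose_def extensional_def\<close>)
      qed
      ultimately show "(\<psi>, \<phi>) \<in> hom_equiv G H"
        using \<phi> by (auto simp: hom_equiv_def)
    qed
    show "Relation.trans (hom_equiv G H)"
    proof (rule transI)
      fix \<phi> \<psi> \<theta> assume "(\<phi>, \<psi>) \<in> hom_equiv G H" "(\<psi>, \<theta>) \<in> hom_equiv G H"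
      then obtain \<alpha> \<beta> where \<alpha>: "\<alpha> \<in> auto H" "\<psi> = compose (carrier G) \<alpha> \<phi>"
        and \<beta>: "\<beta> \<in> auto H" "\<theta> = compose (carrier G) \<beta> \<psi>"
        and \<phi>: "\<phi> \<in> homs G H" "\<theta> \<in> homs G H"
        by (auto simp: hom_equiv_def)
      have "compose (carrier H) \<beta> \<alpha> \<in> auto H"
        using \<alpha>(1) \<beta>(1) by (auto simp: auto_def compose_Bij H.hom_compose)
      moreover have "\<theta> = compose (carrier G) (compose (carrier H) \<beta> \<alpha>) \<phi>"
        using range(1)[OF \<phi>(1)] by (auto simp: \<alpha>(2) \<beta>(2) compose_def fun_eq_iff)
      ultimately show "(\<phi>, \<theta>) \<in> hom_equiv G H"
        using \<phi> by (auto simp: hom_equiv_def)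
    qed
  qed
qed

text \<open>The image \<open>K\<close> consists of even elements and so misses the odd
  \<open>w\<^sub>0\<close>. Yet \<open>K\<close> and its translate by \<open>w\<^sub>0\<close> form
  a subgroup containing every \<open>s i\<close>. Restriction to the carrier makes the homomorphism
  extensional.\<close>

lemma proper_up_to_center_epi_exists:
  obtains \<mu> where "\<mu> \<in> proper_up_to_center_epis A_E7 W_E7"
    "\<And>i. i \<in> {1..7} \<Longrightarrow> \<mu> (\<sigma> i) = w\<^sub>0 \<otimes>\<^bsub>W_E7\<^esub> s i"
proof -
  obtain \<mu> where \<mu>: "\<mu> \<in> hom A_E7 W_E7" "\<And>i. i \<in> {1..7} \<Longrightarrow> \<mu> (\<sigma> i) = w\<^sub>0 \<otimes>\<^bsub>W_E7\<^esub> s i"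
    using W.artin_hom_exists[OF artin_family_w\<^sub>0_mult[OF artin_family_s]] by metis
  define K where "K = \<mu> ` carrier A_E7"
  have K: "subgroup K W_E7"
    unfolding K_def by (rule A_image_subgroup[OF \<mu>(1)])
  note Kc = subgroup.mem_carrier[OF K] and Km = subgroup.m_closed[OF K]
  define L where "L = {w \<in> carrier W_E7. w \<in> K \<or> w\<^sub>0 \<otimes>\<^bsub>W_E7\<^esub> w \<in> K}"
  have "L = carrier W_E7"
  proof (rule W_subgroup_all)
    show "subgroup L W_E7"
    proof (rule W.subgroupI)
      show "L \<noteq> {}"
        using subgroup.one_closed[OF K] by (auto simp: L_def)
      show "inv\<^bsub>W_E7\<^esub> x \<in> L" if "x \<in> L" for x
      proof -
        have x: "x \<in> carrier W_E7" "x \<in> K \<or> w\<^sub>0 \<otimes>\<^bsub>W_E7\<^esub> x \<in> K"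
          using that by (auto simp: L_def)
        have "inv\<^bsub>W_E7\<^esub> (w\<^sub>0 \<otimes>\<^bsub>W_E7\<^esub> x) = w\<^sub>0 \<otimes>\<^bsub>W_E7\<^esub> inv\<^bsub>W_E7\<^esub> x"
          using x(1) w\<^sub>0_closed by (intro W.inv_equality) (simp_all add: w\<^sub>0_mult_w\<^sub>0_mult)
        then show ?thesis
          using x subgroup.m_inv_closed[OF K] unfolding L_def by (metis (mono_tags, lifting) W.inv_closed mem_Collect_eq)
      qed
      show "x \<otimes>\<^bsub>W_E7\<^esub> y \<in> L" if "x \<in> L" "y \<in> L" for x y
      proof -
        have x: "x \<in> carrier W_E7" "x \<in> K \<or> w\<^sub>0 \<otimes>\<^bsub>W_E7\<^esub> x \<in> K"
          and y: "y \<in> carrier W_E7" "y \<in> K \<or> w\<^sub>0 \<otimes>\<^bsub>W_E7\<^esub> y \<in> K"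
          using that by (auto simp: L_def)
        have 1: "w\<^sub>0 \<otimes>\<^bsub>W_E7\<^esub> x \<otimes>\<^bsub>W_E7\<^esub> y = w\<^sub>0 \<otimes>\<^bsub>W_E7\<^esub> (x \<otimes>\<^bsub>W_E7\<^esub> y)"
          using x y w\<^sub>0_closed by (simp add: W.m_assoc)
        have 2: "x \<otimes>\<^bsub>W_E7\<^esub> (w\<^sub>0 \<otimes>\<^bsub>W_E7\<^esub> y) = w\<^sub>0 \<otimes>\<^bsub>W_E7\<^esub> (x \<otimes>\<^bsub>W_E7\<^esub> y)"
          using x y w\<^sub>0_closed w\<^sub>0_commute[OF x(1)] by (metis W.m_assoc)
        have 3: "w\<^sub>0 \<otimes>\<^bsub>W_E7\<^esub> x \<otimes>\<^bsub>W_E7\<^esub> (w\<^sub>0 \<otimes>\<^bsub>W_E7\<^esub> y) = x \<otimes>\<^bsub>W_E7\<^esub> y"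
          by (rule w\<^sub>0_mult_w\<^sub>0_mult[OF x(1) y(1)])
        have "x \<otimes>\<^bsub>W_E7\<^esub> y \<in> K \<or> w\<^sub>0 \<otimes>\<^bsub>W_E7\<^esub> (x \<otimes>\<^bsub>W_E7\<^esub> y) \<in> K"
          using x(2) y(2) Km 1 2 3 by metis
        then show ?thesis
          using x y by (simp add: L_def)
      qed
    qed (auto simp: L_def)
    fix i :: nat assume i: "i \<in> {1..7}"
    have "\<mu> (\<sigma> i) \<in> K"
      using \<sigma>_closed[OF i] by (simp add: K_def)
    then show "s i \<in> L"
      using s_closed[OF i] by (simp add: L_def \<mu>(2)[OF i])
  qed
  have "carrier W_E7 \<subseteq> K <#>\<^bsub>W_E7\<^esub> center W_E7"
  proof
    fix w assume w: "w \<in> carrier W_E7"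
    then have "w \<in> K \<or> w\<^sub>0 \<otimes>\<^bsub>W_E7\<^esub> w \<in> K"
      using \<open>L = carrier W_E7\<close> by (auto simp: L_def)
    moreover have "w = w \<otimes>\<^bsub>W_E7\<^esub> \<one>\<^bsub>W_E7\<^esub>"
      using w by simp
    moreover have "w = w\<^sub>0 \<otimes>\<^bsub>W_E7\<^esub> w \<otimes>\<^bsub>W_E7\<^esub> w\<^sub>0"
      using w w\<^sub>0_closed w\<^sub>0_commute[of "w\<^sub>0 \<otimes>\<^bsub>W_E7\<^esub> w"] by (simp add: w\<^sub>0_w\<^sub>0_mult)
    ultimately show "w \<in> K <#>\<^bsub>W_E7\<^esub> center W_E7"
      unfolding set_mult_def center_W_E7 by blast
  qed
  moreover have "K <#>\<^bsub>W_E7\<^esub> center W_E7 \<subseteq> carrier W_E7"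
    using Kc w\<^sub>0_closed by (auto simp: set_mult_def center_W_E7)
  moreover have "K \<noteq> carrier W_E7"
  proof
    assume "K = carrier W_E7"
    moreover have "K \<subseteq> {w \<in> carrier W_E7. even (W_length w)}"
      unfolding K_def
    proof (rule A_image_subset[OF \<mu>(1) even_subgroup])
      fix i :: nat assume i: "i \<in> {1..7}"
      then show "\<mu> (\<sigma> i) \<in> {w \<in> carrier W_E7. even (W_length w)}"
        using W_length_s_odd[OF i] by (simp add: \<mu>(2) w\<^sub>0_mult_parity s_closed w\<^sub>0_closed)
    qed
    ultimately show False
      using w\<^sub>0_odd w\<^sub>0_closed by blast
  qed
  moreover have "restrict \<mu> (carrier A_E7) ` carrier A_E7 = K"
    by (simp add: K_def)
  moreover have "restrict \<mu> (carrier A_E7) \<in> homs A_E7 W_E7"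
    using \<mu>(1) by (auto simp: homs_def hom_def)
  ultimately have "restrict \<mu> (carrier A_E7) \<in> proper_up_to_center_epis A_E7 W_E7"
    by (auto simp: proper_up_to_center_epis_def up_to_center_epis_def)
  then show thesis
    using that[of "restrict \<mu> (carrier A_E7)"] \<mu>(2) \<sigma>_closed by simp
qed

theorem proposition2p7:
  shows "(\<exists>\<mu>' \<in> proper_up_to_center_epis A_E7 W_E7.
      (\<forall>i\<in>{1..7}. \<mu>' (\<sigma> i) = w\<^sub>0 \<otimes>\<^bsub>W_E7\<^esub> s i) \<and>
      proper_up_to_center_epis A_E7 W_E7 // hom_equiv A_E7 W_E7 = {hom_equiv A_E7 W_E7 `` {\<mu>'}}) \<and>
    (\<forall>\<phi>\<in>proper_up_to_center_epis A_E7 W_E7. ordinary \<phi>)"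
proof
  let ?P = "proper_up_to_center_epis A_E7 W_E7" and ?r = "hom_equiv A_E7 W_E7"
  have homs: "\<phi> \<in> homs A_E7 W_E7" if "\<phi> \<in> ?P" for \<phi>
    using that by (simp add: proper_up_to_center_epis_def up_to_center_epis_def)
  obtain \<mu> where \<mu>: "\<mu> \<in> ?P" "\<And>i. i \<in> {1..7} \<Longrightarrow> \<mu> (\<sigma> i) = w\<^sub>0 \<otimes>\<^bsub>W_E7\<^esub> s i"
    by (rule proper_up_to_center_epi_exists) (rule that)
  have "(\<mu>, \<phi>) \<in> ?r" if \<phi>: "\<phi> \<in> ?P" for \<phi>
  proof -
    obtain \<alpha> where \<alpha>: "\<alpha> \<in> auto W_E7" "\<And>i. i \<in> {1..7} \<Longrightarrow> \<alpha> (w\<^sub>0 \<otimes>\<^bsub>W_E7\<^esub> s i) = \<phi> (\<sigma> i)"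
      using proper_hom_automorphism[OF \<phi>] by blast
    have hom: "\<mu> \<in> hom A_E7 W_E7" "\<phi> \<in> hom A_E7 W_E7" "\<alpha> \<in> hom W_E7 W_E7"
      using homs[OF \<mu>(1)] homs[OF \<phi>] \<alpha>(1) by (auto simp: homs_def auto_def)
    have comp: "compose (carrier A_E7) \<alpha> \<mu> \<in> hom A_E7 W_E7"
      using A.hom_compose[OF hom(1,3)] .
    have "compose (carrier A_E7) \<alpha> \<mu> C = \<phi> C" if C: "C \<in> carrier A_E7" for C
      using \<sigma>_closed \<mu>(2) \<alpha>(2) by (intro A_hom_eqI[OF W.group_axioms comp hom(2) _ C]) (simp add: compose_def)
    then have "\<phi> = compose (carrier A_E7) \<alpha> \<mu>"
      using homs[OF \<phi>] by (auto simp: fun_eq_iff homs_def extensional_def compose_def)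
    then show ?thesis
      using \<alpha>(1) homs[OF \<mu>(1)] homs[OF \<phi>] by (auto simp: hom_equiv_def)
  qed
  then have "?r `` {\<phi>} = ?r `` {\<mu>}" if "\<phi> \<in> ?P" for \<phi>
    using equiv_class_eq[OF equiv_hom_equiv[OF A.group_axioms W.group_axioms]] that by metis
  then have "?P // ?r \<subseteq> {?r `` {\<mu>}}"
    by (auto elim!: quotientE)
  moreover have "?r `` {\<mu>} \<in> ?P // ?r"
    using \<mu>(1) by (rule quotientI)
  ultimately have "?P // ?r = {?r `` {\<mu>}}"
    by blast
  then show "\<exists>\<mu>' \<in> ?P. (\<forall>i\<in>{1..7}. \<mu>' (\<sigma> i) = w\<^sub>0 \<otimes>\<^bsub>W_E7\<^esub> s i) \<and> ?P // ?r = {?r `` {\<mu>'}}"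
    using \<mu> by blast
  show "\<forall>\<phi>\<in>?P. ordinary \<phi>"
  proof
    fix \<phi> assume "\<phi> \<in> ?P"
    then have epi: "\<phi> \<in> up_to_center_epis A_E7 W_E7" and "\<phi> \<in> hom A_E7 W_E7"
      by (auto simp: proper_up_to_center_epis_def up_to_center_epis_def homs_def)
    then have "\<phi> (\<sigma> i \<otimes>\<^bsub>A_E7\<^esub> \<sigma> i) = \<one>\<^bsub>W_E7\<^esub>" if "i \<in> {1..7}" for i
      using up_to_center_epi_involution[OF epi that] \<sigma>_closed[OF that] by (simp add: hom_mult)
    then show "ordinary \<phi>"
      using epi by (simp add: ordinary_def E7_vertices_def)
  qed
qed

end
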